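(* The parametric matroid one-interdiction problem can be solved in time $$\mathcal{O}\bigl(m^2(\log m+f(m))+mG(m)+mk(H(m)+k\log k)\bigr),$$ where $m$ is the number of elements of the matroid, $k$ is its rank, $f(m)$ is the time needed to perform a single independence test, $G(m)$ is the time needed to perform $m$ successive component updates, and $H(m)$ is the (amortised) cost of computing all $k$ replacement elements of the elements of a minimum weight basis.
   Context: $\mathcal{M}=(E,\mathcal{F})$ is a matroid on a finite ground set $E$ with independent sets $\mathcal{F}$, $m=|E|$, and $k$ is its rank. $I\subseteq\mathbb{R}$ is an interval, and each $e\in E$ has weight $w(e,\lambda)=a_e+\lambda b_e$ with $a_e,b_e\in\mathbb{Q}$, $\lambda\in I$. For a basis $B$, $w(B,\lambda)=\sum_{e\in B}w(e,\lambda)$. For $E'\subseteq E$, $\mathcal{M}|E'$ is the restriction of $\mathcal{M}$ to $E'$, and $\mathcal{M}_e=\mathcal{M}|(E\setminus\{e\})$ for $e\in E$. $B_\lambda^*$ is the minimum weight basis of $\mathcal{M}$ at $\lambda$, $B_\lambda^e$ is a minimum weight basis of $\mathcal{M}_e$ at $\lambda$, and $y_e(\lambda)=w(B_\lambda^e,\lambda)$. An element $e^*\in E$ is most vital at $\lambda$ if $y_{e^*}(\lambda)\ge y_e(\lambda)$ for all $e\in E$. The optimal interdiction value function is $y(\lambda)=\max\{y_e(\lambda): e\in E\}$; it is continuous and piecewise linear. Parametric matroid one-interdiction problem: given $\mathcal{M}$ with parametric weights $w(e,\lambda)$ and the interval $I$, compute, for every $\lambda\in I$, a most vital element $e^*$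 and the corresponding value $y(\lambda)=y_{e^*}(\lambda)$ (i.e. a partition of $I$ into subintervals on each of which $y$ is linear, together with a most vital element valid on each subinterval). The components of a matroid are the equivalence classes of the relation: $e\sim f$ iff $e=f$ or some circuit contains both $e$ and $f$. For $e\in B_\lambda^*$ let $R_\lambda(e)=\{r\in E\setminus B_\lambda^*: (B_\lambda^*\setminus\{e\})\cup\{r\}\in\mathcal{F}\}$; the replacement element $r_\lambda(e)$ is the element of $R_\lambda(e)$ of minimum weight $w(\cdot,\lambda)$ (ties broken by a predetermined ordering). Operation costs: $f(m)$ is the time for a single independence test. $G(m)$ is the time needed to do $m$ component updates for matroids $\mathcal{M}|E_0,\ldots,\mathcal{M}|E_m$, where $E_0=\emptyset$, $E_m=E$, $E_{i}\supseteq E_{i-1}$ and $E_i\setminus E_{i-1}$ contains exactly one element (an update computes the components of $\mathcal{M}|E_i$ from those of $\mathcal{M}|E_{i-1}$). $H(m)$ is the amortised cost of computing all $k$ replacement elements $r_\lambda(e)$, $e\in B_\lambda^*$, for a given $\lambda\in I$. An equality point $\lambda(e,f)$ is a point at which the weights of two distinct elements $e,f$ become equal. Standing assumptions: (a) for every $\lambda\in I$ there is a unique minimum weight basis $B_\lambda^*$ of $\mathcal{M}$ (ties being resolved by a fixed ordering of $E$); (b) for every $e\in E$, $\mathcal{M}_e$ has a basis of cardinality $k$; (c) no two distinct pairs of elements have weights that become equal simultaneously (distinct pairs have distinct equality points). *)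

theory Defs
  imports "HOL-Analysis.Analysis"
begin

section \<open>Matroids\<close>

locale matroid =
  fixes E :: "'a set" and F :: "'a set set"
  assumes finite_ground: "finite E"
    and indep_subset_ground: "S \<in> F \<Longrightarrow> S \<subseteq> E"
    and indep_empty: "{} \<in> F"
    and indep_subset: "S \<in> F \<Longrightarrow> T \<subseteq> S \<Longrightarrow> T \<in> F"
    and augmentation: "S \<in> F \<Longrightarrow> T \<in> F \<Longrightarrow> card S < card T \<Longrightarrow> \<exists>x\<in>T - S. insert x S \<in> F"

definition basis :: "'a set set \<Rightarrow> 'a set \<Rightarrow> bool" where
  "basis F B \<longleftrightarrow> B \<in> F \<and> (\<forall>S\<in>F. B \<subseteq> S \<longrightarrow> S = B)"

definition matroid_rank :: "'a set set \<Rightarrow> nat" where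
  "matroid_rank F = Max (card ` F)"

text \<open>The independent sets of the restriction to \<open>E'\<close>; its ground set is \<open>E'\<close>.\<close>

definition restriction :: "'a set set \<Rightarrow> 'a set \<Rightarrow> 'a set set" where
  "restriction F E' = {S \<in> F. S \<subseteq> E'}"

definition circuit :: "'a set \<Rightarrow> 'a set set \<Rightarrow> 'a set \<Rightarrow> bool" where
  "circuit E F C \<longleftrightarrow> C \<subseteq> E \<and> C \<notin> F \<and> (\<forall>D. D \<subset> C \<longrightarrow> D \<in> F)"

definition component_rel :: "'a set \<Rightarrow> 'a set set \<Rightarrow> ('a \<times> 'a) set" where
  "component_rel E F =
     {(e, g). e \<in> E \<and> g \<in> E \<and> (e = g \<or> (\<exists>C. circuit E F C \<and> e \<in> C \<and> g \<in> C))}"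

section \<open>Parametric weights and interdiction\<close>

definition weight :: "('a \<Rightarrow> rat) \<Rightarrow> ('a \<Rightarrow> rat) \<Rightarrow> 'a \<Rightarrow> real \<Rightarrow> real" where
  "weight a b e l = of_rat (a e) + l * of_rat (b e)"

definition set_weight :: "('a \<Rightarrow> rat) \<Rightarrow> ('a \<Rightarrow> rat) \<Rightarrow> 'a set \<Rightarrow> real \<Rightarrow> real" where
  "set_weight a b B l = (\<Sum>e\<in>B. weight a b e l)"

definition min_weight_basis ::
    "'a set set \<Rightarrow> ('a \<Rightarrow> rat) \<Rightarrow> ('a \<Rightarrow> rat) \<Rightarrow> real \<Rightarrow> 'a set \<Rightarrow> bool" where
  "min_weight_basis F a b l B \<longleftrightarrow>
     basis F B \<and> (\<forall>B'. basis F B' \<longrightarrow> set_weight a b B l \<le> set_weight a b B' l)"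

text \<open>The value \<open>y\<^sub>e\<close>. All minimum weight bases of the matroid without \<open>e\<close> have the same weight,
  so the choice of the basis does not matter.\<close>

definition interdicted_value ::
    "'a set \<Rightarrow> 'a set set \<Rightarrow> ('a \<Rightarrow> rat) \<Rightarrow> ('a \<Rightarrow> rat) \<Rightarrow> 'a \<Rightarrow> real \<Rightarrow> real" where
  "interdicted_value E F a b e l =
     set_weight a b (SOME B. min_weight_basis (restriction F (E - {e})) a b l B) l"

definition most_vital ::
    "'a set \<Rightarrow> 'a set set \<Rightarrow> ('a \<Rightarrow> rat) \<Rightarrow> ('a \<Rightarrow> rat) \<Rightarrow> 'a \<Rightarrow> real \<Rightarrow> bool" where
  "most_vital E F a b e l \<longleftrightarrow>
     e \<in> E \<and> (\<forall>g\<in>E. interdicted_value E F a b g l \<le> interdicted_value E F a b e l)"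

definition optimal_value ::
    "'a set \<Rightarrow> 'a set set \<Rightarrow> ('a \<Rightarrow> rat) \<Rightarrow> ('a \<Rightarrow> rat) \<Rightarrow> real \<Rightarrow> real" where
  "optimal_value E F a b l = Max ((\<lambda>e. interdicted_value E F a b e l) ` E)"

text \<open>Two weights \<^emph>\<open>become\<close> equal at a point if they agree there but not everywhere.\<close>

definition equality_point :: "('a \<Rightarrow> rat) \<Rightarrow> ('a \<Rightarrow> rat) \<Rightarrow> 'a \<Rightarrow> 'a \<Rightarrow> real \<Rightarrow> bool" where
  "equality_point a b e g l \<longleftrightarrow> e \<noteq> g \<and> b e \<noteq> b g \<and> weight a b e l = weight a b g l"

definition distinct_equality_points ::
    "'a set \<Rightarrow> ('a \<Rightarrow> rat) \<Rightarrow> ('a \<Rightarrow> rat) \<Rightarrow> real set \<Rightarrow> bool" where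
  "distinct_equality_points E a b I \<longleftrightarrow>
     (\<forall>l\<in>I. \<forall>e\<in>E. \<forall>g\<in>E. \<forall>e'\<in>E. \<forall>g'\<in>E.
        equality_point a b e g l \<and> equality_point a b e' g' l \<longrightarrow> {e, g} = {e', g'})"

section \<open>Instances as seen by a machine\<close>

text \<open>A machine names the elements of \<open>E\<close> by their positions \<open>0, \<dots>, m - 1\<close> in the fixed ordering
  of \<open>E\<close> (given as a list), which is also the ordering used to break ties.\<close>

record instance_data =
  ground_size :: nat
  indep_sets :: "nat set set"
  const_coeff :: "nat \<Rightarrow> rat"
  slope_coeff :: "nat \<Rightarrow> rat"
  param_interval :: "real set"

definition encode ::
    "'a list \<Rightarrow> 'a set set \<Rightarrow> ('a \<Rightarrow> rat) \<Rightarrow> ('a \<Rightarrow> rat) \<Rightarrow> real set \<Rightarrow> instance_data" where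
  "encode es F a b I =
     \<lparr>ground_size = length es,
      indep_sets = {S. S \<subseteq> {..<length es} \<and> (!) es ` S \<in> F},
      const_coeff = (\<lambda>i. a (es ! i)),
      slope_coeff = (\<lambda>i. b (es ! i)),
      param_interval = I\<rparr>"

abbreviation iweight :: "instance_data \<Rightarrow> nat \<Rightarrow> real \<Rightarrow> real" where
  "iweight M \<equiv> weight (const_coeff M) (slope_coeff M)"

definition lex_less :: "nat set \<Rightarrow> nat set \<Rightarrow> bool" where
  "lex_less A B \<longleftrightarrow> (\<exists>i\<in>A - B. \<forall>j<i. j \<in> A \<longleftrightarrow> j \<in> B)"

text \<open>The minimum weight basis \<open>B\<^sup>*\<close> at \<open>l\<close>, ties being resolved by the ordering of the elements.
  It exists and is unique, see \<open>ex1_opt_basis\<close> below.\<close>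

definition opt_basis :: "instance_data \<Rightarrow> real \<Rightarrow> nat set \<Rightarrow> bool" where
  "opt_basis M l B \<longleftrightarrow>
     (let is_min = min_weight_basis (indep_sets M) (const_coeff M) (slope_coeff M) l
      in is_min B \<and> (\<forall>B'. is_min B' \<and> B' \<noteq> B \<longrightarrow> lex_less B B'))"

definition replacement_set :: "instance_data \<Rightarrow> nat set \<Rightarrow> nat \<Rightarrow> nat set" where
  "replacement_set M B e = {r \<in> {..<ground_size M} - B. insert r (B - {e}) \<in> indep_sets M}"

definition replacement :: "instance_data \<Rightarrow> nat set \<Rightarrow> real \<Rightarrow> nat \<Rightarrow> nat" where
  "replacement M B l e =
     (THE r. r \<in> replacement_set M B e \<and>
        (\<forall>s\<in>replacement_set M B e - {r}.
           iweight M r l < iweight M s l \<or> iweight M r l = iweight M s l \<and> r < s))"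

text \<open>The component of \<open>i\<close> in the restriction to \<open>S\<close> is represented by its least element.\<close>

definition component_label :: "instance_data \<Rightarrow> nat set \<Rightarrow> nat \<Rightarrow> nat" where
  "component_label M S i = Min (component_rel S (restriction (indep_sets M) S) `` {i})"

section \<open>Machine model\<close>

text \<open>Running times refer to programs of a small imperative language with arrays of natural
  numbers (indices, elements, flags) and arrays of real numbers, i.e. a unit-cost random access
  machine with real arithmetic but no rounding. A scalar variable is the cell with index \<open>0\<close> of an
  array. Every elementary command costs one time unit; since a program is a fixed finite
  object, the sizes of its expressions only contribute a constant factor. The matroid is accessible
  only through the following three operations.

  \<^item> \<open>IndepTest x y\<close> tests independence of the set of those elements whose entry in array \<open>x\<close> is
    nonzero and stores the answer in \<open>y[0]\<close>; it costs \<open>f(m)\<close>.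
  \<^item> \<open>CompStart\<close> begins a new sequence of component updates with \<open>E\<^sub>0 = {}\<close> and pays the cost \<open>G(m)\<close>
    of the entire sequence; each \<open>CompAdd i\<close> adds one new element \<open>i\<close> (and costs one further time
    unit). As elements are never added twice, a sequence has at most \<open>m\<close> updates. The current
    components can be read with the expression \<open>CompLabel i\<close>.
  \<^item> \<open>Replacements x r y\<close> stores the replacement elements at \<open>l = r\<close> of all elements of the minimum
    weight basis \<open>B\<^sup>*\<close>, which has to be supplied in array \<open>x\<close>, in array \<open>y\<close>; it costs \<open>H(m)\<close>. The
    amortised nature of \<open>H\<close> is reflected by the fact that \<open>N\<close> calls cost \<open>N * H(m)\<close> in total.

  Like every command, each of these operations is understood to take at least one time unit:
  \<open>f(m)\<close>, \<open>G(m)\<close> and \<open>H(m)\<close> are arbitrary reals that are at least \<open>1\<close>.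

  A program that uses an operation outside its domain is stuck and has no terminating run.\<close>

type_synonym name = string

datatype nexp =
    NConst nat
  | NRead name nexp
  | NAdd nexp nexp
  | NSub nexp nexp
  | CompLabel nexp

datatype rexp =
    RConst rat
  | RRead name nexp
  | RAdd rexp rexp
  | RSub rexp rexp
  | RMul rexp rexp
  | RDiv rexp rexp

datatype bexp =
    NLess nexp nexp
  | RLess rexp rexp
  | BNot bexp
  | BAnd bexp bexp

datatype com =
    Skip
  | NAssign name nexp nexp
  | RAssign name nexp rexp
  | Seq com com
  | Cond bexp com com
  | While bexp com
  | IndepTest name name
  | CompStart
  | CompAdd nexp
  | Replacements name rexp name

text \<open>\<open>cur\<close> is the current set \<open>E\<^sub>i\<close> of the sequence of component updates.\<close>

record state =
  nmem :: "name \<Rightarrow> nat \<Rightarrow> nat"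
  rmem :: "name \<Rightarrow> nat \<Rightarrow> real"
  cur :: "nat set"
  labels :: "nat \<Rightarrow> nat"

fun nval :: "state \<Rightarrow> nexp \<Rightarrow> nat" where
  "nval s (NConst n) = n"
| "nval s (NRead x i) = nmem s x (nval s i)"
| "nval s (NAdd e e') = nval s e + nval s e'"
| "nval s (NSub e e') = nval s e - nval s e'"
| "nval s (CompLabel i) = labels s (nval s i)"

fun rval :: "state \<Rightarrow> rexp \<Rightarrow> real" where
  "rval s (RConst q) = of_rat q"
| "rval s (RRead x i) = rmem s x (nval s i)"
| "rval s (RAdd e e') = rval s e + rval s e'"
| "rval s (RSub e e') = rval s e - rval s e'"
| "rval s (RMul e e') = rval s e * rval s e'"
| "rval s (RDiv e e') = rval s e / rval s e'"

fun bval :: "state \<Rightarrow> bexp \<Rightarrow> bool" where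
  "bval s (NLess e e') \<longleftrightarrow> nval s e < nval s e'"
| "bval s (RLess e e') \<longleftrightarrow> rval s e < rval s e'"
| "bval s (BNot c) \<longleftrightarrow> \<not> bval s c"
| "bval s (BAnd c c') \<longleftrightarrow> bval s c \<and> bval s c'"

definition marked :: "instance_data \<Rightarrow> state \<Rightarrow> name \<Rightarrow> nat set" where
  "marked M s x = {i. i < ground_size M \<and> nmem s x i \<noteq> 0}"

definition nwrite :: "state \<Rightarrow> name \<Rightarrow> nat \<Rightarrow> nat \<Rightarrow> state" where
  "nwrite s x i v = s\<lparr>nmem := (nmem s)(x := (nmem s x)(i := v))\<rparr>"

definition rwrite :: "state \<Rightarrow> name \<Rightarrow> nat \<Rightarrow> real \<Rightarrow> state" where
  "rwrite s x i v = s\<lparr>rmem := (rmem s)(x := (rmem s x)(i := v))\<rparr>"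

definition comp_add :: "instance_data \<Rightarrow> state \<Rightarrow> nat \<Rightarrow> state" where
  "comp_add M s i =
     (let S = insert i (cur s)
      in s\<lparr>cur := S,
           labels := (\<lambda>j. if j \<in> S then component_label M S j else labels s j)\<rparr>)"

definition write_replacements ::
    "instance_data \<Rightarrow> state \<Rightarrow> nat set \<Rightarrow> real \<Rightarrow> name \<Rightarrow> state" where
  "write_replacements M s B l y =
     s\<lparr>nmem := (nmem s)(y := (\<lambda>j. if j \<in> B then replacement M B l j else nmem s y j))\<rparr>"

text \<open>\<open>run M f G H c s t s'\<close>: started in state \<open>s\<close>, the program \<open>c\<close> terminates in state \<open>s'\<close> after
  time \<open>t\<close>.\<close>

inductive run ::
    "instance_data \<Rightarrow> (nat \<Rightarrow> real) \<Rightarrow> (nat \<Rightarrow> real) \<Rightarrow> (nat \<Rightarrow> real) \<Rightarrow>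
     com \<Rightarrow> state \<Rightarrow> real \<Rightarrow> state \<Rightarrow> bool"
  for M :: instance_data and f G H :: "nat \<Rightarrow> real" where
  Skip: "run M f G H Skip s 1 s"
| NAssign: "run M f G H (NAssign x i e) s 1 (nwrite s x (nval s i) (nval s e))"
| RAssign: "run M f G H (RAssign x i e) s 1 (rwrite s x (nval s i) (rval s e))"
| Seq: "run M f G H c s t s' \<Longrightarrow> run M f G H c' s' t' s'' \<Longrightarrow>
    run M f G H (Seq c c') s (t + t') s''"
| CondTrue: "bval s d \<Longrightarrow> run M f G H c s t s' \<Longrightarrow> run M f G H (Cond d c c') s (1 + t) s'"
| CondFalse: "\<not> bval s d \<Longrightarrow> run M f G H c' s t s' \<Longrightarrow> run M f G H (Cond d c c') s (1 + t) s'"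
| WhileFalse: "\<not> bval s d \<Longrightarrow> run M f G H (While d c) s 1 s"
| WhileTrue: "bval s d \<Longrightarrow> run M f G H c s t s' \<Longrightarrow> run M f G H (While d c) s' t' s'' \<Longrightarrow>
    run M f G H (While d c) s (1 + t + t') s''"
| IndepTest: "run M f G H (IndepTest x y) s (f (ground_size M))
    (nwrite s y 0 (of_bool (marked M s x \<in> indep_sets M)))"
| CompStart: "run M f G H CompStart s (G (ground_size M)) (s\<lparr>cur := {}\<rparr>)"
| CompAdd: "nval s i < ground_size M \<Longrightarrow> nval s i \<notin> cur s \<Longrightarrow>
    run M f G H (CompAdd i) s 1 (comp_add M s (nval s i))"
| Replacements: "rval s r \<in> param_interval M \<Longrightarrow> opt_basis M (rval s r) (marked M s x) \<Longrightarrow>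
    run M f G H (Replacements x r y) s (H (ground_size M))
      (write_replacements M s (marked M s x) (rval s r) y)"

text \<open>Runs are deterministic, so final state and running time are functions of the input.\<close>

lemma run_deterministic:
  "run M f G H c s t s' \<Longrightarrow> run M f G H c s u s'' \<Longrightarrow> u = t \<and> s'' = s'"
proof (induction arbitrary: u s'' rule: run.induct)
  case (Seq c s t s' c' t' s1)
  from Seq.prems show ?case by cases (metis Seq.IH)
next
  case (WhileTrue s d c t s' t' s1)
  from WhileTrue.prems show ?case
    by cases (use WhileTrue.hyps(1) in simp, metis WhileTrue.IH)
qed (erule run.cases; force)+

section \<open>Input and output conventions\<close>

text \<open>The interval is described by its endpoints (\<open>0\<close> if infinite), together with a flag that is \<open>0\<close>
  for an infinite endpoint, \<open>1\<close> for an open one and \<open>2\<close> for a closed one. All other cells are \<open>0\<close>.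
  Initially \<open>cur\<close> is full, so that no component updates are possible before \<open>CompStart\<close>.\<close>

definition input_state :: "instance_data \<Rightarrow> state" where
  "input_state M =
     (let m = ground_size M; I = param_interval M in
      \<lparr>nmem = (\<lambda>x i.
         if x = ''m'' \<and> i = 0 then m
         else if x = ''lo_kind'' \<and> i = 0
           then (if \<not> bdd_below I then 0 else if Inf I \<notin> I then 1 else 2)
         else if x = ''hi_kind'' \<and> i = 0
           then (if \<not> bdd_above I then 0 else if Sup I \<notin> I then 1 else 2)
         else 0),
       rmem = (\<lambda>x i.
         if x = ''a'' \<and> i < m then of_rat (const_coeff M i)
         else if x = ''b'' \<and> i < m then of_rat (slope_coeff M i)
         else if x = ''lo'' \<and> i = 0 \<and> bdd_below I then Inf I
         else if x = ''hi'' \<and> i = 0 \<and> bdd_above I then Sup I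
         else 0),
       cur = {..<m},
       labels = (\<lambda>i. 0)\<rparr>)"

text \<open>The output consists of \<open>n\<close> breakpoints in \<open>I\<close>, in increasing order, which divide \<open>I\<close> into \<open>n + 1\<close>
  subintervals, and, for every subinterval, of an element that is most vital on it and of
  the coefficients of the linear function that is equal to the optimal value on it.\<close>

definition solves_interdiction ::
    "'a list \<Rightarrow> 'a set set \<Rightarrow> ('a \<Rightarrow> rat) \<Rightarrow> ('a \<Rightarrow> rat) \<Rightarrow> real set \<Rightarrow> state \<Rightarrow> bool" where
  "solves_interdiction es F a b I s \<longleftrightarrow>
     (let E = set es; n = nmem s ''n'' 0; bp = rmem s ''bp''; v = nmem s ''vital'' in
      (\<forall>i<n. bp i \<in> I) \<and> (\<forall>i j. i < j \<and> j < n \<longrightarrow> bp i < bp j) \<and>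
      (\<forall>i\<le>n. v i < length es \<and>
         (\<forall>l\<in>I. (i > 0 \<longrightarrow> bp (i - 1) \<le> l) \<and> (i < n \<longrightarrow> l \<le> bp i) \<longrightarrow>
            most_vital E F a b (es ! v i) l \<and>
            optimal_value E F a b l = interdicted_value E F a b (es ! v i) l \<and>
            optimal_value E F a b l = rmem s ''icpt'' i + l * rmem s ''slope'' i)))"

section \<open>Uniqueness of the minimum weight basis\<close>

lemma lex_less_total: "A \<noteq> B \<Longrightarrow> lex_less A B \<or> lex_less B A"
proof -
  assume "A \<noteq> B"
  then have ex: "\<exists>i. (i \<in> A) \<noteq> (i \<in> B)" by blast
  define i where "i = (LEAST i. (i \<in> A) \<noteq> (i \<in> B))"
  have "(i \<in> A) \<noteq> (i \<in> B)" using LeastI_ex[OF ex] by (simp add: i_def)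
  moreover have "\<forall>j<i. j \<in> A \<longleftrightarrow> j \<in> B" unfolding i_def using not_less_Least by blast
  ultimately show ?thesis unfolding lex_less_def by auto
qed

lemma lex_less_asym: "lex_less A B \<Longrightarrow> \<not> lex_less B A"
  unfolding lex_less_def by (metis DiffD1 DiffD2 linorder_neqE_nat)

lemma lex_less_trans: "lex_less A B \<Longrightarrow> lex_less B C \<Longrightarrow> lex_less A C"
proof -
  assume "lex_less A B" "lex_less B C"
  then obtain i j where i: "i \<in> A - B" "\<forall>k<i. k \<in> A \<longleftrightarrow> k \<in> B"
    and j: "j \<in> B - C" "\<forall>k<j. k \<in> B \<longleftrightarrow> k \<in> C"
    unfolding lex_less_def by blast
  then have "i \<noteq> j" by blast
  then have "min i j \<in> A - C" using i j by (cases "i < j") (auto simp: min_def)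
  moreover have "\<forall>k<min i j. k \<in> A \<longleftrightarrow> k \<in> C" using i j by auto
  ultimately show ?thesis unfolding lex_less_def by blast
qed

lemma lex_least:
  "finite X \<Longrightarrow> X \<noteq> {} \<Longrightarrow> \<exists>B\<in>X. \<forall>B'\<in>X. B' \<noteq> B \<longrightarrow> lex_less B B'"
proof (induction rule: finite_ne_induct)
  case (insert A X)
  then obtain B where "B \<in> X" "\<forall>B'\<in>X. B' \<noteq> B \<longrightarrow> lex_less B B'" by blast
  then show ?case using lex_less_total lex_less_trans by (metis insert_iff)
qed auto

lemma matroid_ex_basis: "matroid E F \<Longrightarrow> \<exists>B. basis F B"
proof -
  assume "matroid E F"
  then interpret matroid E F .
  have "finite F" by (rule finite_subset[of _ "Pow E"])
      (use finite_ground indep_subset_ground in auto)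
  with finite_has_maximal[of F] indep_empty show ?thesis unfolding basis_def by auto
qed

lemma ex1_opt_basis:
  assumes "matroid {..<ground_size M} (indep_sets M)"
  shows "\<exists>!B. opt_basis M l B"
proof -
  interpret matroid "{..<ground_size M}" "indep_sets M" by fact
  let ?w = "\<lambda>B. set_weight (const_coeff M) (slope_coeff M) B l"
  let ?mb = "min_weight_basis (indep_sets M) (const_coeff M) (slope_coeff M) l"
  have fin: "finite {B. basis (indep_sets M) B}"
    by (rule finite_subset[of _ "Pow {..<ground_size M}"])
      (use indep_subset_ground in \<open>auto simp: basis_def\<close>)
  have "{B. basis (indep_sets M) B} \<noteq> {}" using matroid_ex_basis[OF assms] by blast
  from ex_min_if_finite[OF finite_imageI[OF fin, of ?w]] this
  obtain B where "?mb B" unfolding min_weight_basis_def by (auto simp: not_less)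
  moreover have "finite {B. ?mb B}"
    by (rule finite_subset[OF _ fin]) (auto simp: min_weight_basis_def)
  ultimately obtain B where "?mb B" "\<forall>B'. ?mb B' \<and> B' \<noteq> B \<longrightarrow> lex_less B B'"
    using lex_least[of "{B. ?mb B}"] by blast
  then show ?thesis unfolding opt_basis_def Let_def using lex_less_asym by metis
qed

end

theory Submission
  imports Defs "HOL-Library.Multiset"
begin

text \<open>
The weights of \<open>m\<close> elements have \<open>O(m\<^sup>2)\<close> equality points, but only \<open>O(m k)\<close> of them can affect the
minimum weight basis of the matroid or of a matroid from which one element \<open>g\<close> has been deleted. To see this, fix \<open>e\<close> and
let \<open>f\<^sub>1, f\<^sub>2, \<dots>\<close> be the elements of smaller slope in the order in which they overtake \<open>e\<close>, that is,
become lighter than \<open>e\<close>. If \<open>f\<^sub>i\<close> replaces \<open>e\<close> in a minimum weight basis at their crossing, then \<open>f\<^sub>i\<close> is not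
spanned by \<open>{f\<^sub>1, \<dots>, f\<^sub>i\<^sub>-\<^sub>1} - {g}\<close>: these elements are lighter than \<open>e\<close> and
therefore spanned by the rest of the basis (\<open>exchange_is_candidate\<close>). So \<open>f\<^sub>i\<close> is independent of its
predecessors and becomes a coloop of the matroid restricted to \<open>{f\<^sub>1, \<dots>, f\<^sub>i}\<close>, or it closes a circuit through a
coloop, which is lost. At most \<open>k\<close> coloops are gained, hence at most \<open>k\<close> are lost; this leaves at
most \<open>2 k\<close> candidates for each \<open>e\<close> and \<open>2 m k\<close> in total. Between consecutive candidate points, all
the bases concerned stay optimal (\<open>min_weight_basis_persists\<close>).

The program finds the candidates by sorting, for each \<open>e\<close>, the elements that overtake it, and adding them one by one.
It maintains a maximal independent set and its part outside the coloops; an independence test for each of the two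
sets tells whether \<open>f\<^sub>i\<close> is a candidate. In the second case it has to find the coloops that are lost.
They are those that share the component of \<open>f\<^sub>i\<close> afterwards (\<open>component_label_coloop\<close>), so a scan of at most
\<open>k\<close> coloops finds them, without further independence tests. Over all \<open>e\<close> this takes time
\<open>O(m\<^sup>2 (log m + f(m)) + m G(m) + m k\<^sup>2)\<close>.

The candidate points divide \<open>I\<close> into \<open>O(m k)\<close> regions. The minimum weight basis of the first region is found by the
greedy algorithm, and it passes from one region to the next by at most one exchange (\<open>opt_basis_swap\<close>), which
is decided by one independence test. In each region, the replacement elements at one sample point yield the linear functions
\<open>y\<^sub>e\<close> of the \<open>k\<close> basis elements \<open>e\<close>; deleting any other element does not change the minimum weight basis, so it is
at most as good. The optimal value is the upper envelope of these \<open>k\<close> lines. It is computed in time \<open>O(k log k)\<close> by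
sorting the lines by slope and keeping a stack, and clipped to the region (\<open>wp_region\<close>).

The programs are verified with weakest preconditions that carry the elapsed time along, so that each invariant
states both what has been computed and how long it has taken.
\<close>


section \<open>Spans and exchange in a matroid\<close>

text \<open>Membership in the closure of \<open>S\<close>. Only independent sets are mentioned, so the closure of \<open>S\<close> in a
  restriction of the matroid is the part of the closure that lies in the smaller ground set.\<close>

definition spans :: "'a set set \<Rightarrow> 'a set \<Rightarrow> 'a \<Rightarrow> bool" where
  "spans F S x \<longleftrightarrow> x \<in> S \<or> (\<exists>T\<subseteq>S. T \<in> F \<and> insert x T \<notin> F)"

lemma spans_mono: "spans F S x \<Longrightarrow> S \<subseteq> T \<Longrightarrow> spans F T x"
  unfolding spans_def by (meson subset_iff order_trans)

lemma spans_self: "x \<in> S \<Longrightarrow> spans F S x"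
  by (simp add: spans_def)

context matroid
begin

lemma indep_finite: "S \<in> F \<Longrightarrow> finite S"
  using finite_ground indep_subset_ground finite_subset by blast

lemma finite_indep_sets: "finite F"
  by (rule finite_subset[of _ "Pow E"]) (use finite_ground indep_subset_ground in auto)

lemma spans_indep: "J \<in> F \<Longrightarrow> spans F J x \<longleftrightarrow> x \<in> J \<or> insert x J \<notin> F"
  unfolding spans_def by (meson indep_subset insert_mono subset_refl)

lemma extend_indep:
  assumes "T \<in> F" "T \<subseteq> S"
  obtains J where "T \<subseteq> J" "J \<subseteq> S" "J \<in> F" "\<And>x. x \<in> S \<Longrightarrow> spans F J x"
proof -
  define X where "X = {J \<in> F. T \<subseteq> J \<and> J \<subseteq> S}"
  have "finite X" "T \<in> X" using finite_indep_sets assms by (auto simp: X_def)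
  from finite_has_maximal2[OF this] obtain J
    where JX: "J \<in> X" and J: "\<And>K. K \<in> X \<Longrightarrow> J \<subseteq> K \<Longrightarrow> J = K" by blast
  have "spans F J x" if "x \<in> S" for x
  proof (cases "insert x J \<in> F")
    case True
    then have "insert x J \<in> X" using JX that by (auto simp: X_def)
    then have "J = insert x J" using J by blast
    then have "x \<in> J" by blast
    then show ?thesis by (rule spans_self)
  next
    case False
    moreover have "J \<in> F" using JX by (simp add: X_def)
    ultimately show ?thesis by (simp add: spans_indep)
  qed
  then show thesis using JX that[of J] by (simp add: X_def)
qed

lemma spanning_subset:
  obtains J where "J \<subseteq> S" "J \<in> F" "\<And>x. x \<in> S \<Longrightarrow> spans F J x"
  using extend_indep[OF indep_empty empty_subsetI, of S] by metis

lemma maximal_card: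
  assumes "J \<in> F" "\<And>x. x \<in> T \<Longrightarrow> spans F J x" "T \<in> F"
  shows "card T \<le> card J"
proof (rule ccontr)
  assume "\<not> ?thesis"
  then obtain x where "x \<in> T - J" "insert x J \<in> F" using augmentation[OF assms(1,3)] by auto
  then show False using assms spans_indep by blast
qed

text \<open>If \<open>x\<close> could be added to \<open>J\<close>, then a subset \<open>T\<close> of \<open>S\<close> that depends on \<open>x\<close> could be enlarged from
  \<open>J\<close> and \<open>x\<close> to an independent set with more elements than \<open>J\<close>. It cannot contain \<open>x\<close>, so it
  lies in \<open>S\<close>, in contradiction to the maximality of \<open>J\<close>.\<close>

lemma spans_basis:
  assumes J: "J \<in> F" "J \<subseteq> S" "\<And>y. y \<in> S \<Longrightarrow> spans F J y" and x: "spans F S x"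
  shows "spans F J x"
proof (cases "x \<in> S")
  case False
  then obtain T where T: "T \<subseteq> S" "T \<in> F" "insert x T \<notin> F" using x unfolding spans_def by blast
  show ?thesis
  proof (rule ccontr)
    assume "\<not> ?thesis"
    then have xJ: "x \<notin> J" "insert x J \<in> F" using J(1) spans_indep by auto
    obtain K where K: "T \<subseteq> K" "K \<subseteq> T \<union> insert x J" "K \<in> F" "\<And>y. y \<in> T \<union> insert x J \<Longrightarrow> spans F K y"
      using extend_indep[of T "T \<union> insert x J"] T(2) by auto
    have "x \<notin> K" using K(1,3) T(3) indep_subset by (metis insert_subset)
    then have "K \<subseteq> S" using K(2) T(1) J(2) by auto
    then have "card K \<le> card J" using maximal_card[OF J(1) _ K(3)] J(3) by blast
    moreover have "card (insert x J) \<le> card K" using maximal_card[OF K(3) _ xJ(2)] K(4) by blast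
    ultimately show False using xJ(1) indep_finite[OF J(1)] by simp
  qed
qed (use J in auto)

lemma spans_trans:
  assumes "\<And>y. y \<in> S \<Longrightarrow> spans F T y" "spans F S x"
  shows "spans F T x"
proof -
  obtain J where J: "J \<subseteq> T" "J \<in> F" "\<And>x. x \<in> T \<Longrightarrow> spans F J x"
    using spanning_subset by metis
  have "spans F J y" if "y \<in> S \<union> T" for y
  proof (cases "y \<in> T")
    case False
    then show ?thesis using that spans_basis[OF J(2,1,3) assms(1)] by simp
  qed (rule J(3))
  moreover have "spans F (S \<union> T) x" using spans_mono[OF assms(2)] by simp
  ultimately have "spans F J x" using spans_basis[OF J(2), of "S \<union> T" x] J(1) by auto
  then show ?thesis using J(1) by (rule spans_mono)
qed

lemma spans_exchange:
  assumes "spans F (insert y S) x" "\<not> spans F S x"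
  shows "spans F (insert x S) y"
proof (rule ccontr)
  assume n: "\<not> spans F (insert x S) y"
  obtain J where J: "J \<subseteq> S" "J \<in> F" "\<And>x. x \<in> S \<Longrightarrow> spans F J x"
    using spanning_subset by metis
  have xJ: "x \<notin> J" "insert x J \<in> F" using assms(2) spans_mono[OF _ J(1)] spans_indep[OF J(2)] by auto
  have xy: "insert y (insert x J) \<in> F" "y \<notin> insert x J"
    using n spans_mono[of F "insert x J" y "insert x S"] J(1) spans_indep[OF xJ(2), of y] by auto
  then have yJ: "insert y J \<in> F" using indep_subset[OF xy(1), of "insert y J"] by auto
  have "spans F (insert y J) x"
  proof (rule spans_basis[OF yJ _ _ assms(1)])
    show "spans F (insert y J) z" if "z \<in> insert y S" for z
      using that J(3) spans_mono[of F J z "insert y J"] spans_self[of y "insert y J" F] by auto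
  qed (use J(1) in auto)
  then show False using xy xJ spans_indep[OF yJ, of x] by (auto simp: insert_commute)
qed

lemma indep_remove_insert:
  assumes "A \<in> F" "y \<in> A"
  shows "insert x (A - {y}) \<in> F \<longleftrightarrow> x \<in> A - {y} \<or> \<not> spans F (A - {y}) x"
proof -
  have A: "A - {y} \<in> F" using indep_subset[OF assms(1)] by blast
  show ?thesis unfolding spans_indep[OF A] using A by (auto simp: insert_absorb)
qed

lemma indep_not_spans: "A \<in> F \<Longrightarrow> y \<in> A \<Longrightarrow> \<not> spans F (A - {y}) y"
  using indep_remove_insert[of A y y] by (auto simp: insert_absorb)

text \<open>The elements of \<open>A\<close> that \<open>x\<close> can replace are the rest of the fundamental circuit of \<open>x\<close>. A
  minimal subset of \<open>A\<close> that spans \<open>x\<close> consists of such elements.\<close>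

lemma spans_exchangeable:
  assumes A: "A \<in> F" and x: "spans F A x"
  shows "spans F {y \<in> A. insert x (A - {y}) \<in> F} x"
proof (cases "x \<in> A")
  case True
  then have "insert x (A - {x}) = A" by blast
  then show ?thesis using A True by (intro spans_self) simp
next
  case False
  define X where "X = {T. T \<subseteq> A \<and> spans F T x}"
  have "finite X" "A \<in> X" using indep_finite[OF A] x by (auto simp: X_def)
  from finite_has_minimal2[OF this] obtain T
    where "T \<in> X" "\<And>K. K \<in> X \<Longrightarrow> K \<subseteq> T \<Longrightarrow> T = K" by blast
  then have T: "T \<subseteq> A" "spans F T x" "\<And>K. K \<subseteq> A \<Longrightarrow> spans F K x \<Longrightarrow> K \<subseteq> T \<Longrightarrow> T = K"
    by (simp_all add: X_def)
  have "insert x (A - {y}) \<in> F" if y: "y \<in> T" for y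
  proof (rule ccontr)
    assume "insert x (A - {y}) \<notin> F"
    then have sx: "spans F (A - {y}) x" using indep_remove_insert[OF A, of y x] T(1) y by auto
    have "\<not> spans F (T - {y}) x" using T(3)[of "T - {y}"] T(1) y by blast
    then have "spans F (insert x (T - {y})) y"
      using spans_exchange[of y "T - {y}" x] T(2) y by (simp add: insert_absorb)
    then have "spans F (A - {y}) y"
    proof (rule spans_trans[rotated])
      show "spans F (A - {y}) z" if "z \<in> insert x (T - {y})" for z
        using that sx T(1) spans_self[of z "A - {y}" F] by auto
    qed
    then show False using indep_not_spans[OF A] y T(1) by auto
  qed
  then show ?thesis using T(1) by (intro spans_mono[OF T(2)]) blast
qed

lemma basis_iff: "basis F B \<longleftrightarrow> B \<in> F \<and> (\<forall>x\<in>E. spans F B x)"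
proof -
  have "(\<forall>S\<in>F. B \<subseteq> S \<longrightarrow> S = B) \<longleftrightarrow> (\<forall>x\<in>E. spans F B x)" if "B \<in> F"
  proof
    assume *: "\<forall>S\<in>F. B \<subseteq> S \<longrightarrow> S = B"
    show "\<forall>x\<in>E. spans F B x"
    proof
      fix x assume "x \<in> E"
      show "spans F B x" using *[rule_format, of "insert x B"] that by (auto simp: spans_indep)
    qed
  next
    assume *: "\<forall>x\<in>E. spans F B x"
    show "\<forall>S\<in>F. B \<subseteq> S \<longrightarrow> S = B"
    proof (intro ballI impI)
      fix S assume S: "S \<in> F" "B \<subseteq> S"
      have "x \<in> B" if "x \<in> S" for x
        using * that S indep_subset[OF S(1), of "insert x B"] indep_subset_ground[OF S(1)]
          spans_indep[OF \<open>B \<in> F\<close>, of x] by auto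
      then show "S = B" using S(2) by auto
    qed
  qed
  then show ?thesis unfolding basis_def by blast
qed

lemma basis_card: "basis F B \<Longrightarrow> card B = matroid_rank F"
  unfolding matroid_rank_def
proof (rule Max_eqI[symmetric])
  show "finite (card ` F)" using finite_indep_sets by simp
  assume B: "basis F B"
  then show "card B \<in> card ` F" by (auto simp: basis_iff)
  fix c assume "c \<in> card ` F"
  then obtain T where T: "T \<in> F" "c = card T" by auto
  show "c \<le> card B" unfolding T(2)
    by (rule maximal_card) (use B T(1) indep_subset_ground[OF T(1)] in \<open>auto simp: basis_iff\<close>)
qed

lemma card_le_rank: "S \<in> F \<Longrightarrow> card S \<le> matroid_rank F"
  unfolding matroid_rank_def using finite_indep_sets by simp

lemma indep_card_basis:
  assumes "B \<in> F" "card B = matroid_rank F"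
  shows "basis F B"
  unfolding basis_def
proof (intro conjI ballI impI)
  fix S assume S: "S \<in> F" "B \<subseteq> S"
  then show "S = B" using card_le_rank[OF S(1)] assms(2) card_seteq[OF indep_finite[OF S(1)] S(2)] by simp
qed fact

lemma rank_le_card_ground: "matroid_rank F \<le> card E"
proof -
  obtain B where B: "basis F B" using matroid_ex_basis[OF matroid_axioms] by blast
  then have "card B = matroid_rank F" "B \<subseteq> E" using basis_card indep_subset_ground basis_iff by auto
  then show ?thesis using card_mono[OF finite_ground] by metis
qed

lemma exchange_card:
  assumes "A \<in> F" "y \<in> A" "x \<notin> A"
  shows "card (insert x (A - {y})) = card A"
  using assms indep_finite[OF assms(1)]
  by (metis DiffD1 card.insert_remove card_Suc_Diff1 card_insert_disjoint finite_Diff)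

lemma basis_exchange:
  "basis F B \<Longrightarrow> y \<in> B \<Longrightarrow> x \<notin> B \<Longrightarrow> insert x (B - {y}) \<in> F \<Longrightarrow> basis F (insert x (B - {y}))"
  using exchange_card[of B y x] basis_card[of B] by (intro indep_card_basis) (auto simp: basis_iff)

text \<open>The fundamental circuit of \<open>x\<close> in \<open>A\<close> cannot lie in the hyperplane spanned by
  \<open>D - {x}\<close>, so one of its elements can replace \<open>x\<close> in \<open>D\<close>.\<close>

lemma symmetric_exchange:
  assumes A: "basis F A" and D: "basis F D" and x: "x \<in> D - A"
  obtains y where "y \<in> A - D" "insert x (A - {y}) \<in> F" "insert y (D - {x}) \<in> F"
proof -
  have A': "A \<in> F" "spans F A x" and D': "D \<in> F"
    using A D x indep_subset_ground unfolding basis_iff by blast+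
  let ?C = "{y \<in> A. insert x (A - {y}) \<in> F}"
  have "\<not> (\<forall>y\<in>?C. spans F (D - {x}) y)"
    using spans_trans[of ?C "D - {x}" x] spans_exchangeable[OF A'] indep_not_spans[OF D', of x] x by blast
  then obtain y where y: "y \<in> ?C" "\<not> spans F (D - {x}) y" by blast
  then have "insert y (D - {x}) \<in> F" using indep_remove_insert[OF D', of x y] x by blast
  moreover have "y \<in> A - D" using y x spans_self[of y "D - {x}" F] by auto
  ultimately show thesis using y that by blast
qed

lemma restriction_matroid: "U \<subseteq> E \<Longrightarrow> matroid U (restriction F U)"
proof
  show "finite U" if "U \<subseteq> E" using that finite_ground finite_subset by blast
  show "\<exists>x\<in>T - S. insert x S \<in> restriction F U"
    if "S \<in> restriction F U" "T \<in> restriction F U" "card S < card T" for S T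
    using that augmentation[of S T] unfolding restriction_def by auto
qed (use indep_empty indep_subset in \<open>auto simp: restriction_def\<close>)

lemma restriction_ground: "restriction F E = F"
  unfolding restriction_def using indep_subset_ground by auto

section \<open>Coloops and components\<close>

lemma spans_insert_spanned:
  assumes "spans F S f"
  shows "spans F (insert f S) x \<longleftrightarrow> spans F S x"
proof -
  have "spans F S y" if "y \<in> insert f S" for y
    using that assms spans_self[of y S F] by auto
  then show ?thesis using spans_trans[of "insert f S" S x] spans_mono[of F S x "insert f S"] by auto
qed

end

definition coloops :: "'a set set \<Rightarrow> 'a set \<Rightarrow> 'a set" where
  "coloops F S = {g \<in> S. \<not> spans F (S - {g}) g}"

context matroid
begin

text \<open>If \<open>f\<close> helped to span a coloop \<open>g\<close> of \<open>S\<close>, then by exchange \<open>f\<close> would be spanned by \<open>S\<close>.\<close>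

lemma coloops_insert_unspanned:
  assumes "f \<notin> S" "\<not> spans F S f"
  shows "coloops F (insert f S) = insert f (coloops F S)"
proof -
  have "spans F (insert f (S - {g})) g \<longleftrightarrow> spans F (S - {g}) g" if "g \<in> S" for g
    using spans_exchange[of f "S - {g}" g] spans_mono[of F "S - {g}" g "insert f (S - {g})"]
      assms(2) that by (auto simp: insert_absorb)
  moreover have "insert f S - {g} = insert f (S - {g})" if "g \<in> S" for g using that assms(1) by auto
  ultimately show ?thesis using assms unfolding coloops_def by auto
qed

lemma coloops_insert_spanned:
  assumes "f \<notin> S" "spans F S f"
  shows "coloops F (insert f S) = {g \<in> coloops F S. \<not> spans F (insert f S - {g}) g}"
proof -
  have "spans F (insert f S - {g}) g" if "spans F (S - {g}) g" for g
    using spans_mono[OF that, of "insert f S - {g}"] by auto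
  moreover have "spans F (insert f S - {f}) f" using assms by simp
  ultimately show ?thesis unfolding coloops_def by auto
qed

text \<open>If \<open>f\<close> is spanned by elements that are not coloops, then the closure of \<open>S - {g}\<close> contains
  \<open>f\<close> for each coloop \<open>g\<close>, so adding \<open>f\<close> does not help to span \<open>g\<close>.\<close>

lemma coloops_insert_spanned_by_others:
  assumes "f \<notin> S" "J \<subseteq> S - coloops F S" "spans F J f"
  shows "coloops F (insert f S) = coloops F S"
proof -
  have "spans F S f" using assms spans_mono[of F J f S] by blast
  moreover have "\<not> spans F (insert f S - {g}) g" if g: "g \<in> coloops F S" for g
  proof -
    have "J \<subseteq> S - {g}" using assms(2) g by auto
    then have "spans F (S - {g}) f" by (rule spans_mono[OF assms(3)])
    moreover have "insert f S - {g} = insert f (S - {g})" using assms(1) g by (auto simp: coloops_def)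
    ultimately show ?thesis using spans_insert_spanned[of "S - {g}" f g] g by (auto simp: coloops_def)
  qed
  ultimately show ?thesis using coloops_insert_spanned[OF assms(1)] by blast
qed

lemma spans_circuit:
  assumes "spans F S x" "x \<notin> S" "insert x S \<subseteq> U"
  obtains C where "circuit U (restriction F U) C" "x \<in> C" "C \<subseteq> insert x S"
proof -
  define X where "X = {T. T \<in> F \<and> T \<subseteq> S \<and> insert x T \<notin> F}"
  have "finite X" "X \<noteq> {}" using finite_indep_sets assms by (auto simp: spans_def X_def)
  from finite_has_minimal[OF this] obtain T
    where TX: "T \<in> X" and T: "\<And>K. K \<in> X \<Longrightarrow> K \<subseteq> T \<Longrightarrow> T = K" by blast
  have T1: "T \<in> F" "T \<subseteq> S" "insert x T \<notin> F" using TX by (auto simp: X_def)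
  have "D \<in> F" if D: "D \<subset> insert x T" for D
  proof (cases "x \<in> D")
    case True
    then have sub: "D - {x} \<subset> T" using D T1(2) assms(2) by auto
    then have "D - {x} \<notin> X" using T[of "D - {x}"] by blast
    moreover have "insert x (D - {x}) = D" using True by auto
    ultimately show ?thesis using sub T1 indep_subset[of T "D - {x}"] by (auto simp: X_def)
  next
    case False
    then show ?thesis using D T1 indep_subset[of T D] by blast
  qed
  then have "circuit U (restriction F U) (insert x T)"
    using T1 assms(3) unfolding circuit_def restriction_def by auto
  then show thesis using that T1 by blast
qed

lemma circuit_spans:
  assumes "circuit U (restriction F U) C" "x \<in> C" "C - {x} \<subseteq> S"
  shows "spans F S x"
proof -
  have "C - {x} \<in> F" "insert x (C - {x}) \<notin> F"
    using assms(1,2) unfolding circuit_def restriction_def by (auto simp: insert_absorb)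
  then show ?thesis using assms(3) unfolding spans_def by blast
qed

end

text \<open>When a spanned element \<open>f\<close> is added to \<open>S\<close>, a coloop \<open>g\<close> of \<open>S\<close> ceases to be one exactly if it
  joins the component of \<open>f\<close>. Then \<open>f\<close> and \<open>g\<close> are in series: every circuit that contains one of
  them contains the other, so both are related to the same elements and their component labels
  agree.\<close>

lemma component_label_coloop:
  assumes M: "matroid {..<ground_size M} (indep_sets M)" and S: "insert f S \<subseteq> {..<ground_size M}"
    and f: "f \<notin> S" "spans (indep_sets M) S f" and g: "g \<in> coloops (indep_sets M) S"
  shows "component_label M (insert f S) g = component_label M (insert f S) f \<longleftrightarrow>
    spans (indep_sets M) (insert f S - {g}) g"
proof -
  let ?F = "indep_sets M" and ?S = "insert f S"
  interpret matroid "{..<ground_size M}" ?F by fact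
  let ?circ = "circuit ?S (restriction ?F ?S)"
  define cls where "cls x = component_rel ?S (restriction ?F ?S) `` {x}" for x
  have cls: "cls x = {h \<in> ?S. x = h \<or> (\<exists>C. ?circ C \<and> x \<in> C \<and> h \<in> C)}" if "x \<in> ?S" for x
    using that unfolding cls_def component_rel_def by auto
  have gS: "g \<in> S" "g \<noteq> f" "\<not> spans ?F (S - {g}) g" using g f unfolding coloops_def by auto
  have fin: "finite ?S" using finite_subset[OF S] by simp
  have label: "component_label M ?S x = Min (cls x)" for x
    unfolding component_label_def cls_def by simp
  \<comment> \<open>A circuit through \<open>g\<close> that avoids \<open>f\<close> would lie in \<open>S\<close>, where \<open>g\<close> is a coloop.\<close>
  have gf: "f \<in> C" if "?circ C" "g \<in> C" for C
  proof (rule ccontr)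
    assume "f \<notin> C"
    then have "C - {g} \<subseteq> S - {g}" using that unfolding circuit_def by auto
    then have "spans ?F (S - {g}) g" by (rule circuit_spans[OF that])
    then show False using gS by simp
  qed
  show ?thesis
  proof
    assume sp: "spans ?F (?S - {g}) g"
    \<comment> \<open>A circuit through \<open>f\<close> that avoids \<open>g\<close> shows that \<open>f\<close> does not help to span \<open>g\<close>.\<close>
    have fg: "g \<in> C" if "?circ C" "f \<in> C" for C
    proof (rule ccontr)
      assume "g \<notin> C"
      then have "C - {f} \<subseteq> S - {g}" using that unfolding circuit_def by auto
      then have "spans ?F (S - {g}) f" by (rule circuit_spans[OF that])
      moreover have "?S - {g} = insert f (S - {g})" using gS by auto
      ultimately show False using sp spans_insert_spanned gS by metis
    qed
    have "insert g (?S - {g}) \<subseteq> ?S" using gS by auto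
    then obtain C where C: "?circ C" "g \<in> C" using spans_circuit[OF sp, of ?S] by (metis DiffD2 insertI1)
    define R where "R x h \<longleftrightarrow> (\<exists>C. ?circ C \<and> x \<in> C \<and> h \<in> C)" for x h
    have same: "R g h \<longleftrightarrow> R f h" for h unfolding R_def using gf fg by metis
    have "R f g" "R f f" unfolding R_def using gf[OF C] C by metis+
    then have "cls g = cls f" using gS same by (simp add: cls flip: R_def) metis
    then show "component_label M ?S g = component_label M ?S f" using label by simp
  next
    assume eq: "component_label M ?S g = component_label M ?S f"
    show "spans ?F (?S - {g}) g"
    proof (rule ccontr)
      assume n: "\<not> ?thesis"
      have no: "\<not> (?circ C \<and> g \<in> C)" for C
        using n circuit_spans[of ?S C g "?S - {g}"] unfolding circuit_def by auto
      have "cls g = {g}" using cls[of g] no gS by auto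
      then have "Min (cls f) = g" using eq label by simp
      moreover have "finite (cls f)" "f \<in> cls f" using fin cls[of f] by auto
      ultimately have "g \<in> cls f" using Min_in[of "cls f"] by blast
      then show False using cls[of f] gS no by auto
    qed
  qed
qed

section \<open>Minimum weight bases of linearly parametrised matroids\<close>

lemma set_weight_exchange:
  assumes "finite A" "y \<in> A" "x \<notin> A"
  shows "set_weight a b (insert x (A - {y})) l = set_weight a b A l - weight a b y l + weight a b x l"
  using assms unfolding set_weight_def by (subst sum.insert) (auto simp: sum_diff1)

context matroid
begin

lemma ex_min_weight_basis: "\<exists>B. min_weight_basis F a b l B"
proof -
  have "finite {B. basis F B}" "{B. basis F B} \<noteq> {}"
    using finite_indep_sets matroid_ex_basis[OF matroid_axioms]
    by (auto simp: basis_def intro: finite_subset[of _ F])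
  from ex_min_if_finite[OF finite_imageI[OF this(1), of "\<lambda>B. set_weight a b B l"]] this(2)
  show ?thesis unfolding min_weight_basis_def by (auto simp: not_less)
qed

text \<open>A local optimum is a global one: among the minimum weight bases, one that has the most elements
  in common with the local optimum \<open>A\<close> is \<open>A\<close> itself, for otherwise a symmetric exchange would
  bring it closer to \<open>A\<close>.\<close>

lemma min_weight_basis_iff:
  "min_weight_basis F a b l A \<longleftrightarrow> basis F A \<and>
     (\<forall>y\<in>A. \<forall>x\<in>E - A. insert x (A - {y}) \<in> F \<longrightarrow> weight a b y l \<le> weight a b x l)"
proof
  assume A: "min_weight_basis F a b l A"
  then have bA: "basis F A" by (simp add: min_weight_basis_def)
  have "weight a b y l \<le> weight a b x l"
    if "y \<in> A" "x \<in> E - A" "insert x (A - {y}) \<in> F" for x y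
  proof -
    have "basis F (insert x (A - {y}))" using basis_exchange[OF bA that(1) _ that(3)] that(2) by simp
    then have "set_weight a b A l \<le> set_weight a b (insert x (A - {y})) l"
      using A by (simp add: min_weight_basis_def)
    moreover have "finite A" using bA indep_finite by (simp add: basis_iff)
    ultimately show ?thesis using set_weight_exchange[of A y x a b l] that by simp
  qed
  then show "basis F A \<and> (\<forall>y\<in>A. \<forall>x\<in>E - A. insert x (A - {y}) \<in> F \<longrightarrow> weight a b y l \<le> weight a b x l)"
    using bA by blast
next
  assume A: "basis F A \<and>
     (\<forall>y\<in>A. \<forall>x\<in>E - A. insert x (A - {y}) \<in> F \<longrightarrow> weight a b y l \<le> weight a b x l)"
  let ?X = "{B. min_weight_basis F a b l B}"
  have "finite A" using A indep_finite by (simp add: basis_iff)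
  then have "\<forall>B. B \<in> ?X \<longrightarrow> card (B \<inter> A) < Suc (card A)" by (simp add: card_mono less_Suc_eq_le)
  moreover obtain B where "B \<in> ?X" using ex_min_weight_basis by blast
  ultimately obtain D where D: "D \<in> ?X" "\<And>B. B \<in> ?X \<Longrightarrow> card (B \<inter> A) \<le> card (D \<inter> A)"
    using ex_has_greatest_nat[of "\<lambda>B. B \<in> ?X" B "\<lambda>B. card (B \<inter> A)" "Suc (card A)"] by metis
  have bD: "basis F D" using D by (simp add: min_weight_basis_def)
  have fin: "finite A" "finite D" "D \<subseteq> E"
    using A bD indep_finite indep_subset_ground by (auto simp: basis_iff)
  have "D \<subseteq> A"
  proof
    fix x assume xD: "x \<in> D"
    show "x \<in> A"
    proof (rule ccontr)
      assume "x \<notin> A"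
      then have xDA: "x \<in> D - A" using xD by simp
      obtain y where y: "y \<in> A - D" "insert x (A - {y}) \<in> F" "insert y (D - {x}) \<in> F"
        using symmetric_exchange[OF conjunct1[OF A] bD xDA] by metis
      let ?D = "insert y (D - {x})"
      have "weight a b y l \<le> weight a b x l" using conjunct2[OF A] y xDA fin(3) by (meson DiffD1 DiffI \<open>x \<notin> A\<close> subsetD)
      then have "set_weight a b ?D l \<le> set_weight a b D l"
        using set_weight_exchange[of D x y a b l] fin xD y by simp
      moreover have "basis F ?D" using basis_exchange[OF bD xD _ y(3)] y by simp
      ultimately have "?D \<in> ?X" using D(1) unfolding min_weight_basis_def mem_Collect_eq by (meson order_trans)
      then have "card (?D \<inter> A) \<le> card (D \<inter> A)" by (rule D(2))
      moreover have "?D \<inter> A = insert y (D \<inter> A)" using y \<open>x \<notin> A\<close> by auto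
      moreover have "card (insert y (D \<inter> A)) = Suc (card (D \<inter> A))" using y fin by (subst card_insert_disjoint) auto
      ultimately show False by simp
    qed
  qed
  then have "D = A" using A bD fin basis_card card_subset_eq by metis
  then show "min_weight_basis F a b l A" using D by blast
qed

lemma min_weight_basis_exchange_eq:
  assumes "min_weight_basis F a b l A" "y \<in> A" "x \<notin> A" "insert x (A - {y}) \<in> F"
    "weight a b y l = weight a b x l"
  shows "min_weight_basis F a b l (insert x (A - {y}))"
  using assms basis_exchange[of A y x] set_weight_exchange[of A y x a b l] indep_finite[of A]
  unfolding min_weight_basis_def by (auto simp: basis_iff)

text \<open>A basis \<open>D\<close> that avoids \<open>e\<close> becomes a basis with \<open>e\<close> by a symmetric exchange with some \<open>y\<close> that can
  replace \<open>e\<close> in \<open>B\<close>. As \<open>B\<close> is at most as heavy as the new basis, \<open>D\<close> is at least as heavy as \<open>B\<close>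
  with \<open>e\<close> replaced by \<open>y\<close>.\<close>

lemma min_weight_basis_replacement:
  assumes B: "min_weight_basis F a b l B" and e: "e \<in> B" and r: "r \<in> E - B" "insert r (B - {e}) \<in> F"
    and least: "\<And>x. x \<in> E - B \<Longrightarrow> insert x (B - {e}) \<in> F \<Longrightarrow> weight a b r l \<le> weight a b x l"
  shows "min_weight_basis (restriction F (E - {e})) a b l (insert r (B - {e}))"
proof -
  interpret R: matroid "E - {e}" "restriction F (E - {e})" by (rule restriction_matroid) auto
  let ?A = "insert r (B - {e})"
  have bB: "basis F B" and finB: "finite B"
    using B indep_finite[of B] by (auto simp: min_weight_basis_def basis_iff)
  have bA: "basis F ?A" using basis_exchange[OF bB e] r by blast
  have AR: "?A \<in> restriction F (E - {e})"
    using bA indep_subset_ground[of ?A] r e by (auto simp: restriction_def basis_iff)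
  then have bAR: "basis (restriction F (E - {e})) ?A"
    using bA unfolding basis_def restriction_def by blast
  have "set_weight a b ?A l \<le> set_weight a b D l" if D: "basis (restriction F (E - {e})) D" for D
  proof -
    have DF: "D \<in> F" "e \<notin> D" "D \<subseteq> E" using D by (auto simp: basis_def restriction_def)
    have "card D = card ?A" using R.basis_card[OF D] R.basis_card[OF bAR] by simp
    then have bD: "basis F D" using indep_card_basis[OF DF(1)] basis_card[OF bA] by simp
    obtain y where y: "y \<in> D - B" "insert e (D - {y}) \<in> F" "insert y (B - {e}) \<in> F"
      using symmetric_exchange[OF bD bB, of e] e DF by (metis DiffI)
    have "set_weight a b B l \<le> set_weight a b (insert e (D - {y})) l"
      using B basis_exchange[OF bD _ DF(2) y(2)] y unfolding min_weight_basis_def by simp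
    moreover have "weight a b r l \<le> weight a b y l" using least[of y] y DF by auto
    ultimately show ?thesis
      using set_weight_exchange[of D y e a b l] set_weight_exchange[of B e r a b l] DF y r e finB
        indep_finite[OF DF(1)] by auto
  qed
  then show ?thesis using bAR unfolding min_weight_basis_def by blast
qed

end

section \<open>Candidate points\<close>

text \<open>If \<open>f\<close> has the smaller slope, this is the point after which \<open>f\<close> is lighter than \<open>e\<close>.\<close>

definition crossing :: "('a \<Rightarrow> rat) \<Rightarrow> ('a \<Rightarrow> rat) \<Rightarrow> 'a \<Rightarrow> 'a \<Rightarrow> real" where
  "crossing a b e f = (of_rat (a f) - of_rat (a e)) / (of_rat (b e) - of_rat (b f))"

lemma weight_crossing:
  assumes "b f < b e"
  shows "weight a b f l < weight a b e l \<longleftrightarrow> crossing a b e f < l"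
    and "weight a b e l < weight a b f l \<longleftrightarrow> l < crossing a b e f"
    and "weight a b e l = weight a b f l \<longleftrightarrow> crossing a b e f = l"
proof -
  have d: "(0::real) < of_rat (b e) - of_rat (b f)" using assms by (simp add: of_rat_less)
  show 1: "weight a b f l < weight a b e l \<longleftrightarrow> crossing a b e f < l"
    unfolding crossing_def weight_def by (subst pos_divide_less_eq[OF d]) (simp add: algebra_simps)
  show 2: "weight a b e l < weight a b f l \<longleftrightarrow> l < crossing a b e f"
    unfolding crossing_def weight_def by (subst pos_less_divide_eq[OF d]) (simp add: algebra_simps)
  show "weight a b e l = weight a b f l \<longleftrightarrow> crossing a b e f = l"
    using 1 2 by (metis linorder_neq_iff)
qed

text \<open>The elements that overtake \<open>e\<close> before \<open>l\<close>. At \<open>l\<close> all of them are lighter than \<open>e\<close>.\<close>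

definition earlier :: "'a set \<Rightarrow> ('a \<Rightarrow> rat) \<Rightarrow> ('a \<Rightarrow> rat) \<Rightarrow> 'a \<Rightarrow> real \<Rightarrow> 'a set" where
  "earlier E a b e l = {h \<in> E. b h < b e \<and> crossing a b e h < l}"

text \<open>Once \<open>f\<close> has become lighter than \<open>e\<close>, it can replace \<open>e\<close> in the minimum weight basis of the
  matroid without \<open>g\<close> only if it is not spanned by the elements that have become lighter than
  \<open>e\<close> before, \<open>g\<close> not being counted.\<close>

definition candidate ::
    "'a set \<Rightarrow> 'a set set \<Rightarrow> ('a \<Rightarrow> rat) \<Rightarrow> ('a \<Rightarrow> rat) \<Rightarrow> 'a \<Rightarrow> 'a \<Rightarrow> bool" where
  "candidate E F a b e f \<longleftrightarrow> e \<in> E \<and> f \<in> E \<and> b f < b e \<and>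
     (\<exists>g. \<not> spans F (earlier E a b e (crossing a b e f) - {g}) f)"

context matroid
begin

text \<open>All elements in \<open>earlier\<close> are lighter than \<open>e\<close> at the crossing, so a minimum weight basis \<open>A\<close> spans
  each of them without using \<open>e\<close>. If they spanned \<open>f\<close>, then so would \<open>A - {e}\<close>.\<close>

lemma exchange_is_candidate:
  assumes U: "E - {g} \<subseteq> U" "U \<subseteq> E" and A: "min_weight_basis (restriction F U) a b l A"
    and e: "e \<in> A" and f: "f \<in> U - A" and ex: "insert f (A - {e}) \<in> F"
    and eq: "weight a b e l = weight a b f l" and lt: "b f < b e"
  shows "candidate E F a b e f \<and> crossing a b e f = l"
proof -
  interpret R: matroid U "restriction F U" by (rule restriction_matroid) fact
  have cr: "crossing a b e f = l" using weight_crossing(3)[where a = a and b = b, OF lt] eq by blast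
  have A': "A \<in> F" "A \<subseteq> U" "\<And>x. x \<in> U \<Longrightarrow> spans (restriction F U) A x"
    using A R.basis_iff by (auto simp: min_weight_basis_def restriction_def)
  have "spans F (A - {e}) h" if h: "h \<in> U" "weight a b h l < weight a b e l" for h
  proof (rule ccontr)
    assume n: "\<not> ?thesis"
    then have hA: "h \<notin> A" using h spans_self[of h "A - {e}" F] by auto
    have "insert h (A - {e}) \<in> restriction F U"
      using n h A' indep_remove_insert[OF A'(1) e, of h] by (auto simp: restriction_def)
    then have "weight a b e l \<le> weight a b h l"
      using A R.min_weight_basis_iff[of a b l A] e h hA by blast
    then show False using h(2) by simp
  qed
  then have "\<And>h. h \<in> earlier E a b e l - {g} \<Longrightarrow> spans F (A - {e}) h"
    using weight_crossing(1)[of b _ e a l] U(1) unfolding earlier_def by blast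
  moreover have "\<not> spans F (A - {e}) f"
    using ex f indep_remove_insert[OF A'(1) e, of f] by auto
  ultimately have "\<not> spans F (earlier E a b e l - {g}) f" using spans_trans[of "earlier E a b e l - {g}" "A - {e}" f] by metis
  then show ?thesis using cr lt e f A'(2) U(2) unfolding candidate_def by auto
qed

lemma weight_segment:
  "weight a b x (u + t * (v - u)) = (1 - t) * weight a b x u + t * weight a b x v"
  unfolding weight_def by (simp add: algebra_simps)

text \<open>Moving from \<open>u\<close> towards \<open>v\<close>, the basis \<open>A\<close> stays optimal up to the first point at which an
  exchange breaks even. This is a candidate point, either for \<open>A\<close> (moving to the right) or
  for the basis after the exchange (moving to the left).\<close>

lemma min_weight_basis_persists:
  assumes U: "E - {g} \<subseteq> U" "U \<subseteq> E" and A: "min_weight_basis (restriction F U) a b u A"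
    and no: "\<And>e f. candidate E F a b e f \<Longrightarrow> crossing a b e f \<notin> {u..<v} \<union> {v<..u}"
  shows "min_weight_basis (restriction F U) a b v A"
proof (rule ccontr)
  assume nv: "\<not> ?thesis"
  interpret R: matroid U "restriction F U" by (rule restriction_matroid) fact
  define d where "d p l = weight a b (fst p) l - weight a b (snd p) l" for p l
  define X where "X = {p \<in> A \<times> (U - A). insert (snd p) (A - {fst p}) \<in> restriction F U}"
  have opt_iff: "min_weight_basis (restriction F U) a b l A \<longleftrightarrow> (\<forall>p\<in>X. d p l \<le> 0)" for l
    using A unfolding R.min_weight_basis_iff X_def d_def by (auto simp: min_weight_basis_def)
  define V where "V = {p \<in> X. d p v > 0}"
  define t where "t p = - d p u / (d p v - d p u)" for p
  have du: "d p u \<le> 0" if "p \<in> X" for p using A opt_iff that by blast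
  have dt: "d p (u + s * (v - u)) = (1 - s) * d p u + s * d p v" for p s
    unfolding d_def weight_segment by (simp add: algebra_simps)
  have "V \<noteq> {}" using nv opt_iff unfolding V_def by (auto simp: not_le)
  have "A \<subseteq> U" using A R.indep_subset_ground unfolding min_weight_basis_def basis_def by blast
  then have "finite X" unfolding X_def
    using R.finite_ground finite_subset[of A U] by auto
  then have "finite V" unfolding V_def by simp
  with \<open>V \<noteq> {}\<close> obtain p where p: "p \<in> V" "\<And>q. q \<in> V \<Longrightarrow> t p \<le> t q"
    using ex_min_if_finite[of "t ` V"] by (fastforce simp: not_less)
  have dv: "d q v - d q u > 0" if "q \<in> V" for q using that du[of q] unfolding V_def by auto
  have tq: "0 \<le> t q" "t q < 1" if "q \<in> V" for q
    using dv[OF that] du[of q] that unfolding t_def V_def by (auto simp: field_simps)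
  \<comment> \<open>\<open>t q\<close> is the fraction of the segment after which the exchange \<open>q\<close> breaks even; \<open>p\<close> is the first to do so.\<close>
  define l where "l = u + t p * (v - u)"
  have dp: "d p l = 0" using dv[OF p(1)] unfolding l_def dt unfolding t_def by (simp add: field_simps)
  have "d q l \<le> 0" if q: "q \<in> X" for q
  proof (cases "q \<in> V")
    case True
    have "d q l = d q u + t p * (d q v - d q u)" unfolding l_def dt by (simp add: algebra_simps)
    also have "\<dots> \<le> d q u + t q * (d q v - d q u)"
      using p(2)[OF True] dv[OF True] by (intro add_left_mono mult_right_mono) auto
    also have "\<dots> = 0" using dv[OF True] unfolding t_def by (simp add: field_simps)
    finally show ?thesis .
  next
    case False
    then have "d q v \<le> 0" using q unfolding V_def by auto
    then show ?thesis using du[OF q] tq[OF p(1)] unfolding l_def dt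
      by (intro add_nonpos_nonpos mult_nonneg_nonpos) auto
  qed
  then have Al: "min_weight_basis (restriction F U) a b l A" using opt_iff by blast
  obtain y x where yx: "p = (y, x)" by (cases p)
  have y: "y \<in> A" and x: "x \<in> U - A" and ex: "insert x (A - {y}) \<in> restriction F U"
    using p(1) yx unfolding V_def X_def by auto
  have eq: "weight a b y l = weight a b x l" using dp yx unfolding d_def by simp
  have "b y \<noteq> b x"
    using dv[OF p(1)] yx unfolding d_def weight_def by auto
  have "\<exists>e f. candidate E F a b e f \<and> crossing a b e f = l"
  proof (cases "b x < b y")
    case True
    then show ?thesis
      using exchange_is_candidate[OF U Al y x _ eq] ex unfolding restriction_def by blast
  next
    case False
    then have lt: "b y < b x" using \<open>b y \<noteq> b x\<close> by simp
    \<comment> \<open>The roles are interchanged: the basis after the exchange contains \<open>x\<close> and could take \<open>y\<close> back.\<close>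
    have A': "min_weight_basis (restriction F U) a b l (insert x (A - {y}))"
      using R.min_weight_basis_exchange_eq[OF Al y _ ex eq] x by blast
    have "insert y (insert x (A - {y}) - {x}) = A" using x y by auto
    moreover have "A \<in> F" using A unfolding min_weight_basis_def basis_def restriction_def by blast
    ultimately have "insert y (insert x (A - {y}) - {x}) \<in> F" by simp
    then show ?thesis
      using exchange_is_candidate[OF U A' _ _ _ eq[symmetric] lt] x y \<open>A \<subseteq> U\<close> by blast
  qed
  then obtain e f where "candidate E F a b e f" "crossing a b e f = l" by blast
  moreover have "l \<in> {u..<v} \<union> {v<..u}"
  proof -
    have "u \<noteq> v" using dv[OF p(1)] by auto
    consider "u < v" | "v < u" using \<open>u \<noteq> v\<close> by linarith
    then show ?thesis
    proof cases
      case 1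
      then have "0 \<le> t p * (v - u)" "t p * (v - u) < 1 * (v - u)"
        using tq[OF p(1)] by (auto intro!: mult_strict_right_mono)
      then show ?thesis unfolding l_def by auto
    next
      case 2
      then have "0 \<le> t p * (u - v)" "t p * (u - v) < 1 * (u - v)"
        using tq[OF p(1)] by (auto intro!: mult_strict_right_mono)
      moreover have "l = u - t p * (u - v)" unfolding l_def by (simp add: algebra_simps)
      ultimately show ?thesis by auto
    qed
  qed
  ultimately show False using no by blast
qed

end


section \<open>The minimum weight basis under the fixed ordering\<close>

definition precedes :: "(nat \<Rightarrow> rat) \<Rightarrow> (nat \<Rightarrow> rat) \<Rightarrow> real \<Rightarrow> nat \<Rightarrow> nat \<Rightarrow> bool" where
  "precedes a b l y x \<longleftrightarrow> weight a b y l < weight a b x l \<or> weight a b y l = weight a b x l \<and> y < x"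

text \<open>An instance as the machine sees it: the elements are their positions in the fixed ordering.\<close>

locale parametric_matroid = matroid "{..<m}" F
  for m :: nat and F :: "nat set set" +
  fixes a b :: "nat \<Rightarrow> rat" and M :: instance_data
  assumes ground_size_M: "ground_size M = m" and indep_sets_M: "indep_sets M = F"
    and const_coeff_M: "const_coeff M = a" and slope_coeff_M: "slope_coeff M = b"
begin

lemma ex1_opt_basis': "\<exists>!B. opt_basis M l B"
  by (rule ex1_opt_basis) (use matroid_axioms in \<open>simp add: ground_size_M indep_sets_M\<close>)

lemma opt_basis_min: "opt_basis M l B \<Longrightarrow> min_weight_basis F a b l B"
  unfolding opt_basis_def Let_def indep_sets_M const_coeff_M slope_coeff_M by simp

text \<open>If an exchange of \<open>y\<close> for an element \<open>x\<close> at a smaller position broke even, it would lead to a minimum weight basis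
  that is lexicographically smaller.\<close>

lemma opt_basis_precedes:
  assumes B: "opt_basis M l B" and y: "y \<in> B" and x: "x < m" "x \<notin> B" and ex: "insert x (B - {y}) \<in> F"
  shows "precedes a b l y x"
proof -
  have mB: "min_weight_basis F a b l B" using opt_basis_min[OF B] .
  have "weight a b y l \<le> weight a b x l" using mB y x ex unfolding min_weight_basis_iff by blast
  moreover have "y < x" if eq: "weight a b y l = weight a b x l"
  proof -
    let ?B = "insert x (B - {y})"
    have "min_weight_basis F a b l ?B" by (rule min_weight_basis_exchange_eq[OF mB y x(2) ex eq])
    moreover have "?B \<noteq> B" using x by auto
    ultimately have "lex_less B ?B"
      using B unfolding opt_basis_def Let_def indep_sets_M const_coeff_M slope_coeff_M by blast
    then obtain i where i: "i \<in> B - ?B" "\<forall>j<i. j \<in> B \<longleftrightarrow> j \<in> ?B" unfolding lex_less_def by blast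
    have "i = y" using i(1) by auto
    then have "\<not> x < y" using i(2) x by auto
    then show ?thesis using x y by (metis linorder_neqE_nat)
  qed
  ultimately show ?thesis unfolding precedes_def by auto
qed

text \<open>Local optimality with respect to the ordering determines the basis: an exchange between
  two such bases would have to satisfy \<open>precedes\<close> in both directions.\<close>

lemma opt_basis_iff:
  "opt_basis M l B \<longleftrightarrow> basis F B \<and>
     (\<forall>y\<in>B. \<forall>x\<in>{..<m} - B. insert x (B - {y}) \<in> F \<longrightarrow> precedes a b l y x)"
proof
  assume "opt_basis M l B"
  then show "basis F B \<and> (\<forall>y\<in>B. \<forall>x\<in>{..<m} - B. insert x (B - {y}) \<in> F \<longrightarrow> precedes a b l y x)"
    using opt_basis_min[of l B] opt_basis_precedes[of l B] by (auto simp: min_weight_basis_def)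
next
  assume B: "basis F B \<and> (\<forall>y\<in>B. \<forall>x\<in>{..<m} - B. insert x (B - {y}) \<in> F \<longrightarrow> precedes a b l y x)"
  obtain D where D: "opt_basis M l D" using ex1_opt_basis' by blast
  have bD: "basis F D" using opt_basis_min[OF D] by (simp add: min_weight_basis_def)
  have fin: "finite B" "finite D" "D \<subseteq> {..<m}"
    using B bD indep_finite indep_subset_ground by (auto simp: basis_iff)
  have "D \<subseteq> B"
  proof
    fix x assume xD: "x \<in> D"
    show "x \<in> B"
    proof (rule ccontr)
      assume "x \<notin> B"
      then have x: "x \<in> D - B" using xD by simp
      obtain y where y: "y \<in> B - D" "insert x (B - {y}) \<in> F" "insert y (D - {x}) \<in> F"
        using symmetric_exchange[OF conjunct1[OF B] bD x] by metis
      have "y < m" using y(1) B indep_subset_ground by (auto simp: basis_iff)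
      then have "precedes a b l x y" using opt_basis_precedes[OF D xD _ _ y(3)] y(1) by simp
      moreover have "precedes a b l y x" using conjunct2[OF B] y x fin(3) by auto
      ultimately show False unfolding precedes_def by auto
    qed
  qed
  then have "D = B" using B bD fin basis_card card_subset_eq by metis
  then show "opt_basis M l B" using D by simp
qed

text \<open>The basis changes at an equality point only by the exchange of the two elements concerned.
  Both bases have minimum weight at \<open>p\<close>; so an exchange between them breaks even at \<open>p\<close>, and it is
  decided in opposite directions on the two sides, which is possible only for the pair \<open>e, f\<close>.\<close>

lemma opt_basis_swap:
  assumes B: "opt_basis M u B" "min_weight_basis F a b p B"
    and D: "opt_basis M v D" "min_weight_basis F a b p D"
    and uv: "u < p" "p < v" and ef: "b f < b e" "crossing a b e f = p" "f < m"
    and only: "\<And>x y. x < m \<Longrightarrow> y < m \<Longrightarrow> b x \<noteq> b y \<Longrightarrow> weight a b x p = weight a b y p \<Longrightarrow> {x, y} = {e, f}"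
  shows "D = (if e \<in> B \<and> f \<notin> B \<and> insert f (B - {e}) \<in> F then insert f (B - {e}) else B)"
proof -
  have bB: "basis F B" and bD: "basis F D" using B D by (simp_all add: min_weight_basis_def)
  have fin: "finite B" "finite D" "D \<subseteq> {..<m}" "B \<subseteq> {..<m}"
    using bB bD indep_finite indep_subset_ground by (auto simp: basis_iff)
  have cards: "card B = card D" using basis_card bB bD by simp
  have step: "x = f \<and> e \<in> B - D" if x: "x \<in> D - B" for x
  proof -
    obtain y where y: "y \<in> B - D" "insert x (B - {y}) \<in> F" "insert y (D - {x}) \<in> F"
      using symmetric_exchange[OF bB bD x] by metis
    have xy: "x < m" "y < m" using x y fin by auto
    have "weight a b y p \<le> weight a b x p" "weight a b x p \<le> weight a b y p"
      using B(2) D(2) x y xy unfolding min_weight_basis_iff by auto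
    then have eq: "weight a b x p = weight a b y p" by simp
    have pB: "precedes a b u y x" using opt_basis_precedes[OF B(1) _ xy(1) _ y(2)] x y by simp
    have pD: "precedes a b v x y" using opt_basis_precedes[OF D(1) _ xy(2) _ y(3)] x y by simp
    \<comment> \<open>Elements with equal weight functions would be ordered by their positions on both sides.\<close>
    have "b x \<noteq> b y" using pB pD eq unfolding precedes_def weight_def by auto
    then have "{x, y} = {e, f}" using only xy eq by blast
    moreover have "\<not> (x = e \<and> y = f)"
      using pB uv weight_crossing(2)[where a = a and b = b, OF ef(1), of u] ef(2)
      unfolding precedes_def by auto
    ultimately have "x = f" "y = e" by (auto simp: doubleton_eq_iff)
    then show ?thesis using y by simp
  qed
  show ?thesis
  proof (cases "D \<subseteq> B")
    case True
    then have DB: "D = B" using fin cards card_subset_eq by metis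
    have "\<not> (e \<in> B \<and> f \<notin> B \<and> insert f (B - {e}) \<in> F)"
    proof
      assume "e \<in> B \<and> f \<notin> B \<and> insert f (B - {e}) \<in> F"
      then have "precedes a b v e f" using opt_basis_precedes[OF D(1)] DB ef(3) by simp
      then show False using uv weight_crossing(1)[where a = a and b = b, OF ef(1), of v] ef(2)
        unfolding precedes_def by auto
    qed
    then show ?thesis using DB by auto
  next
    case False
    then obtain x where x: "x \<in> D - B" by blast
    have eB: "e \<in> B - D" and DB: "D - B = {f}" using step x by blast+
    have "card (B - D) = card (D - B)"
      using cards fin card_Diff_subset_Int[of B D] card_Diff_subset_Int[of D B] by (simp add: Int_commute)
    then have "card (B - D) = 1" using DB by simp
    then have "B - D = {e}" using eB by (metis card_1_singletonE singletonD)
    then have "D = insert f (B - {e})" using DB by blast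
    moreover have "insert f (B - {e}) \<in> F" using bD calculation by (simp add: basis_iff)
    ultimately show ?thesis using eB DB by auto
  qed
qed

text \<open>Correctness of the greedy algorithm. It rejects \<open>x\<close> when the elements of \<open>B\<close> that precede \<open>x\<close> are
  present; so what \<open>x\<close> can replace later must be one of them.\<close>

lemma greedy_opt_basis:
  assumes B: "B \<in> F" and rej: "\<And>x. x < m \<Longrightarrow> x \<notin> B \<Longrightarrow> insert x {y \<in> B. precedes a b l y x} \<notin> F"
  shows "opt_basis M l B"
  unfolding opt_basis_iff
proof (intro conjI ballI impI)
  have "insert x B \<notin> F" if "x < m" "x \<notin> B" for x
    using rej[OF that] indep_subset[of "insert x B" "insert x {y \<in> B. precedes a b l y x}"] by auto
  then show "basis F B" using B spans_indep[OF B] by (auto simp: basis_iff)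
  fix y x assume y: "y \<in> B" and x: "x \<in> {..<m} - B" and ex: "insert x (B - {y}) \<in> F"
  show "precedes a b l y x"
  proof (rule ccontr)
    assume "\<not> ?thesis"
    then have "insert x {y \<in> B. precedes a b l y x} \<subseteq> insert x (B - {y})" by auto
    then have "insert x {y \<in> B. precedes a b l y x} \<in> F" by (rule indep_subset[OF ex])
    then show False using rej[of x] x by auto
  qed
qed

lemma interdicted_value_eq:
  assumes "min_weight_basis (restriction F ({..<m} - {e})) a b l A"
  shows "interdicted_value {..<m} F a b e l = set_weight a b A l"
proof -
  let ?P = "min_weight_basis (restriction F ({..<m} - {e})) a b l"
  have "?P (SOME B. ?P B)" using someI[of ?P, OF assms] .
  then show ?thesis using assms unfolding interdicted_value_def min_weight_basis_def
    by (metis (mono_tags, lifting) order_antisym)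
qed

lemma indep_card_restriction_basis:
  assumes "B \<in> F" "card B = matroid_rank F" "B \<subseteq> U"
  shows "basis (restriction F U) B"
proof -
  have "basis F B" using indep_card_basis assms by simp
  then show ?thesis using assms(3) unfolding basis_def restriction_def by blast
qed

end

text \<open>Deleting an element does not lower the rank, so the bases of the matroid without \<open>e\<close> are
  the bases that avoid \<open>e\<close>.\<close>

locale interdiction_instance = parametric_matroid +
  assumes interdicted_rank:
    "e < m \<Longrightarrow> \<exists>B. basis (restriction F ({..<m} - {e})) B \<and> card B = matroid_rank F"
begin

abbreviation y_val :: "nat \<Rightarrow> real \<Rightarrow> real" where
  "y_val e l \<equiv> interdicted_value {..<m} F a b e l"

lemma restricted_basis:
  assumes e: "e < m" and B: "basis (restriction F ({..<m} - {e})) B"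
  shows "basis F B"
proof -
  interpret R: matroid "{..<m} - {e}" "restriction F ({..<m} - {e})" by (rule restriction_matroid) auto
  obtain D where "basis (restriction F ({..<m} - {e})) D" "card D = matroid_rank F"
    using interdicted_rank[OF e] by blast
  then have "card B = matroid_rank F" using R.basis_card B by metis
  moreover have "B \<in> F" using B by (simp add: basis_def restriction_def)
  ultimately show ?thesis by (rule indep_card_basis[rotated])
qed

text \<open>The set of candidates for a replacement is not empty because some basis avoids \<open>e\<close>.\<close>

lemma replacement_correct:
  assumes e: "e \<in> B" and B: "basis F B"
  shows "replacement M B l e < m" "replacement M B l e \<notin> B" "insert (replacement M B l e) (B - {e}) \<in> F"
    and "\<And>x. x < m \<Longrightarrow> x \<notin> B \<Longrightarrow> insert x (B - {e}) \<in> F \<Longrightarrow>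
      weight a b (replacement M B l e) l \<le> weight a b x l"
proof -
  let ?R = "replacement_set M B e"
  define less where "less r s \<longleftrightarrow> precedes a b l r s" for r s
  have R: "?R = {r \<in> {..<m} - B. insert r (B - {e}) \<in> F}"
    unfolding replacement_set_def ground_size_M indep_sets_M by simp
  have em: "e < m" using e B indep_subset_ground by (auto simp: basis_iff)
  obtain D where D: "basis (restriction F ({..<m} - {e})) D" using interdicted_rank[OF em] by blast
  then have bD: "basis F D" "e \<notin> D" using restricted_basis[OF em D] by (auto simp: basis_def restriction_def)
  then obtain r0 where "r0 \<in> D - B" "insert r0 (B - {e}) \<in> F"
    using symmetric_exchange[OF bD(1) B, of e] e by auto
  moreover have "D \<subseteq> {..<m}" using bD indep_subset_ground by (simp add: basis_iff)
  ultimately have "r0 \<in> ?R" using R by blast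
  then have ne: "?R \<noteq> {}" and fin: "finite ?R" using R by auto
  define w where "w = Min ((\<lambda>r. weight a b r l) ` ?R)"
  let ?W = "{r \<in> ?R. weight a b r l = w}"
  have "w \<in> (\<lambda>r. weight a b r l) ` ?R" unfolding w_def using ne fin by (intro Min_in) auto
  then have neW: "?W \<noteq> {}" by auto
  have finW: "finite ?W" using fin by simp
  define r where "r = Min ?W"
  have rW: "r \<in> ?W" unfolding r_def using neW finW by (intro Min_in) auto
  have wmin: "w \<le> weight a b s l" if "s \<in> ?R" for s
    unfolding w_def using that fin by (intro Min_le) auto
  have rmin: "r \<le> s" if "s \<in> ?W" for s unfolding r_def using that finW by (intro Min_le) auto
  have prec: "less r s" if "s \<in> ?R - {r}" for s
    using that rW wmin[of s] rmin[of s] unfolding less_def precedes_def by force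
  have rep: "replacement M B l e = r"
    unfolding replacement_def const_coeff_M slope_coeff_M
  proof (rule the_equality)
    show "r \<in> ?R \<and> (\<forall>s\<in>?R - {r}. weight a b r l < weight a b s l \<or> weight a b r l = weight a b s l \<and> r < s)"
      using rW prec unfolding less_def precedes_def by blast
    fix r'
    assume r': "r' \<in> ?R \<and> (\<forall>s\<in>?R - {r'}. weight a b r' l < weight a b s l \<or> weight a b r' l = weight a b s l \<and> r' < s)"
    show "r' = r"
    proof (rule ccontr)
      assume "r' \<noteq> r"
      then have "less r r'" "less r' r" using prec[of r'] r' rW unfolding less_def precedes_def by auto
      then show False unfolding less_def precedes_def by auto
    qed
  qed
  show "replacement M B l e < m" "replacement M B l e \<notin> B" "insert (replacement M B l e) (B - {e}) \<in> F"
    using rW R unfolding rep by auto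
  show "weight a b (replacement M B l e) l \<le> weight a b x l"
    if "x < m" "x \<notin> B" "insert x (B - {e}) \<in> F" for x
    using that rW wmin[of x] R unfolding rep by auto
qed

text \<open>Between two consecutive candidate points, the minimum weight basis and the bases
  obtained from it by replacement stay optimal, so the values are linear functions there.\<close>

lemma region_values:
  assumes B: "opt_basis M u B"
    and no: "\<And>e f. candidate {..<m} F a b e f \<Longrightarrow> crossing a b e f \<notin> {u..<l} \<union> {l<..u}"
  shows "min_weight_basis F a b l B"
    and "e \<in> B \<Longrightarrow> y_val e l = set_weight a b B l - weight a b e l + weight a b (replacement M B u e) l"
    and "e < m \<Longrightarrow> e \<notin> B \<Longrightarrow> y_val e l = set_weight a b B l"
    and "e \<in> B \<Longrightarrow> set_weight a b B l \<le> y_val e l"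
proof -
  have mB: "min_weight_basis F a b u B" by (rule opt_basis_min[OF B])
  then have bB: "basis F B" by (simp add: min_weight_basis_def)
  have BF: "B \<in> F" "finite B" "B \<subseteq> {..<m}" using bB indep_finite indep_subset_ground by (auto simp: basis_iff)
  have "min_weight_basis (restriction F {..<m}) a b l B"
    by (rule min_weight_basis_persists[where g = 0, OF _ _ _ no]) (use mB restriction_ground in auto)
  then show mBl: "min_weight_basis F a b l B" using restriction_ground by simp
  have val: "y_val e l = set_weight a b B l - weight a b e l + weight a b (replacement M B u e) l \<and>
    set_weight a b B l \<le> y_val e l" if e: "e \<in> B" for e
  proof -
    let ?r = "replacement M B u e"
    note r = replacement_correct[where l = u, OF e bB]
    have "min_weight_basis (restriction F ({..<m} - {e})) a b u (insert ?r (B - {e}))"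
      by (rule min_weight_basis_replacement[OF mB e]) (use r in auto)
    then have "min_weight_basis (restriction F ({..<m} - {e})) a b l (insert ?r (B - {e}))"
      by (rule min_weight_basis_persists[OF _ _ _ no, rotated 2]) auto
    then have "y_val e l = set_weight a b (insert ?r (B - {e})) l" by (rule interdicted_value_eq)
    moreover have "basis F (insert ?r (B - {e}))" using basis_exchange[OF bB e r(2,3)] .
    ultimately show ?thesis
      using set_weight_exchange[OF BF(2) e r(2), of a b l] mBl unfolding min_weight_basis_def by auto
  qed
  show "y_val e l = set_weight a b B l - weight a b e l + weight a b (replacement M B u e) l" if "e \<in> B" for e
    using val[OF that] by simp
  show "set_weight a b B l \<le> y_val e l" if "e \<in> B" for e using val[OF that] by simp
  show "y_val e l = set_weight a b B l" if e: "e < m" "e \<notin> B" for e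
  proof (rule interdicted_value_eq)
    have "basis (restriction F ({..<m} - {e})) B"
      by (rule indep_card_restriction_basis[OF BF(1) basis_card[OF bB]]) (use BF(3) e in auto)
    then show "min_weight_basis (restriction F ({..<m} - {e})) a b l B"
      using mBl restricted_basis[OF e(1)] unfolding min_weight_basis_def by blast
  qed
qed

end

section \<open>Transfer to the positions in the fixed ordering\<close>

text \<open>The map from positions to elements is an isomorphism from the encoded to the given matroid; everything
  that the algorithm computes is transported along it.\<close>

locale encoded =
  fixes es :: "'a list" and F :: "'a set set" and a b :: "'a \<Rightarrow> rat" and I :: "real set"
  assumes matroid: "matroid (set es) F" and dist: "distinct es"
begin

abbreviation h :: "nat \<Rightarrow> 'a" where "h \<equiv> (!) es"
abbreviation N :: "nat set" where "N \<equiv> {..<length es}"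
abbreviation IF :: "nat set set" where "IF \<equiv> indep_sets (encode es F a b I)"

lemma IF: "IF = {S. S \<subseteq> N \<and> h ` S \<in> F}"
  by (simp add: encode_def)

lemma inj_h: "inj_on h N"
  using dist by (auto simp: inj_on_def nth_eq_iff_index_eq)

lemma h_N: "h ` N = set es"
  by (auto simp: set_conv_nth)

lemma image_preimage: "D \<subseteq> set es \<Longrightarrow> h ` {i \<in> N. h i \<in> D} = D"
  unfolding h_N[symmetric] by auto

lemma IF_image: "image h ` IF = F"
proof -
  interpret matroid "set es" F by (rule matroid)
  have "D \<in> image h ` IF" if "D \<in> F" for D
    using image_preimage[OF indep_subset_ground[OF that]] that IF
    by (intro image_eqI[of _ _ "{i \<in> N. h i \<in> D}"]) auto
  then show ?thesis using IF by auto
qed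

lemma card_h: "S \<subseteq> N \<Longrightarrow> card (h ` S) = card S"
  by (rule card_image) (rule inj_on_subset[OF inj_h])

lemma h_image_subset: "S \<subseteq> N \<Longrightarrow> T \<subseteq> N \<Longrightarrow> h ` S \<subseteq> h ` T \<longleftrightarrow> S \<subseteq> T"
  using inj_h by (rule inj_on_image_subset_iff)

lemma matroid_N: "matroid N IF"
proof -
  interpret matroid "set es" F by (rule matroid)
  show ?thesis
  proof
    show "T \<in> IF" if "S \<in> IF" "T \<subseteq> S" for S T
      using that IF indep_subset[of "h ` S" "h ` T"] by auto
    show "\<exists>x\<in>T - S. insert x S \<in> IF" if "S \<in> IF" "T \<in> IF" "card S < card T" for S T
    proof -
      have ST: "S \<subseteq> N" "T \<subseteq> N" "h ` S \<in> F" "h ` T \<in> F" using that IF by auto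
      moreover have "card (h ` S) < card (h ` T)" using that(3) card_h ST by simp
      ultimately obtain y where "y \<in> h ` T - h ` S" "insert y (h ` S) \<in> F"
        using augmentation[of "h ` S" "h ` T"] by blast
      then show ?thesis using IF ST by auto
    qed
  qed (use IF indep_empty in auto)
qed

lemma rank_N: "matroid_rank IF = matroid_rank F"
proof -
  have "card ` F = card ` (image h ` IF)" by (simp only: IF_image)
  also have "\<dots> = (\<lambda>S. card (h ` S)) ` IF" by (simp only: image_image)
  also have "\<dots> = card ` IF" using IF card_h by (intro image_cong refl card_h) auto
  finally show ?thesis unfolding matroid_rank_def by simp
qed

lemma basis_N:
  assumes U: "U \<subseteq> N"
  shows "basis (restriction IF U) B \<longleftrightarrow> B \<subseteq> N \<and> basis (restriction F (h ` U)) (h ` B)"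
proof -
  have mem: "S \<in> restriction IF U \<longleftrightarrow> h ` S \<in> restriction F (h ` U)" if "S \<subseteq> N" for S
    using that U IF h_image_subset[OF that U] by (auto simp: restriction_def)
  have sub: "S \<subseteq> N" if "S \<in> restriction IF U" for S using that U by (auto simp: restriction_def)
  have ex: "\<exists>S. S \<subseteq> N \<and> T = h ` S" if "T \<in> restriction F (h ` U)" for T
    using that U unfolding restriction_def by (metis (no_types, lifting) mem_Collect_eq order_trans subset_imageE)
  have eq: "h ` S = h ` T \<longleftrightarrow> S = T" if "S \<subseteq> N" "T \<subseteq> N" for S T
    using inj_on_image_eq_iff[OF inj_h that] .
  show ?thesis unfolding basis_def using mem sub ex eq h_image_subset by (metis (no_types, lifting))
qed

lemma set_weight_N: "B \<subseteq> N \<Longrightarrow> set_weight a b (h ` B) l = set_weight (\<lambda>i. a (h i)) (\<lambda>i. b (h i)) B l"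
  unfolding set_weight_def weight_def
  by (subst sum.reindex[OF inj_on_subset[OF inj_h]]) auto

lemma min_weight_basis_N:
  assumes U: "U \<subseteq> N"
  shows "min_weight_basis (restriction IF U) (\<lambda>i. a (h i)) (\<lambda>i. b (h i)) l B \<longleftrightarrow>
    B \<subseteq> N \<and> min_weight_basis (restriction F (h ` U)) a b l (h ` B)"
proof -
  have ex: "\<exists>S. S \<subseteq> N \<and> D = h ` S" if "basis (restriction F (h ` U)) D" for D
    using that U unfolding basis_def restriction_def
    by (metis (no_types, lifting) mem_Collect_eq order_trans subset_imageE)
  show ?thesis unfolding min_weight_basis_def basis_N[OF U] using ex set_weight_N by metis
qed

lemma interdicted_value_N:
  assumes i: "i < length es"
  shows "interdicted_value (set es) F a b (h i) l = interdicted_value N IF (\<lambda>i. a (h i)) (\<lambda>i. b (h i)) i l"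
proof -
  have U: "h ` (N - {i}) = set es - {h i}"
    using i h_N inj_on_image_set_diff[OF inj_h, of N "{i}"] by auto
  let ?P = "min_weight_basis (restriction IF (N - {i})) (\<lambda>i. a (h i)) (\<lambda>i. b (h i)) l"
  let ?Q = "min_weight_basis (restriction F (set es - {h i})) a b l"
  interpret R: matroid "N - {i}" "restriction IF (N - {i})"
    by (rule matroid.restriction_matroid[OF matroid_N]) auto
  have P: "?P (SOME B. ?P B)" using someI_ex[OF R.ex_min_weight_basis] .
  then have Q: "(SOME B. ?P B) \<subseteq> N" "?Q (h ` (SOME B. ?P B))"
    using min_weight_basis_N[of "N - {i}"] U by auto
  have "?Q (SOME B. ?Q B)" by (rule someI[of ?Q, OF Q(2)])
  then have "set_weight a b (SOME B. ?Q B) l = set_weight a b (h ` (SOME B. ?P B)) l"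
    using Q(2) unfolding min_weight_basis_def by (metis (mono_tags, lifting) order_antisym)
  then show ?thesis unfolding interdicted_value_def using set_weight_N[OF Q(1)] by simp
qed

lemma distinct_equality_points_N:
  assumes "distinct_equality_points (set es) a b I"
  shows "distinct_equality_points N (\<lambda>i. a (h i)) (\<lambda>i. b (h i)) I"
  unfolding distinct_equality_points_def
proof (intro ballI impI)
  fix l e g e' g' assume "l \<in> I" and N: "e \<in> N" "g \<in> N" "e' \<in> N" "g' \<in> N"
    and eq: "equality_point (\<lambda>i. a (h i)) (\<lambda>i. b (h i)) e g l \<and>
      equality_point (\<lambda>i. a (h i)) (\<lambda>i. b (h i)) e' g' l"
  have "equality_point a b (h e) (h g) l" "equality_point a b (h e') (h g') l"
    using eq N inj_h unfolding equality_point_def weight_def by (auto dest: inj_onD)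
  moreover have "h e \<in> set es" "h g \<in> set es" "h e' \<in> set es" "h g' \<in> set es" using N by auto
  ultimately have "{h e, h g} = {h e', h g'}"
    using assms \<open>l \<in> I\<close> unfolding distinct_equality_points_def by metis
  then have "h ` {e, g} = h ` {e', g'}" by simp
  then show "{e, g} = {e', g'}" using N inj_on_image_eq_iff[OF inj_h, of "{e, g}" "{e', g'}"] by simp
qed

lemma interdicted_rank_N:
  assumes "\<forall>e\<in>set es. \<exists>B. basis (restriction F (set es - {e})) B \<and> card B = matroid_rank F" "i < length es"
  shows "\<exists>B. basis (restriction IF (N - {i})) B \<and> card B = matroid_rank IF"
proof -
  have U: "h ` (N - {i}) = set es - {h i}"
    using assms(2) h_N inj_on_image_set_diff[OF inj_h, of N "{i}"] by auto
  obtain D where D: "basis (restriction F (h ` (N - {i}))) D" "card D = matroid_rank F"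
    using assms U by (metis nth_mem)
  then have "D \<subseteq> h ` (N - {i})" by (simp add: basis_def restriction_def)
  then obtain B where B: "B \<subseteq> N" "D = h ` B" by (metis Diff_subset order_trans subset_imageE)
  then show ?thesis using D basis_N[of "N - {i}" B] card_h[OF B(1)] rank_N by auto
qed

end


section \<open>Weakest preconditions with time\<close>

text \<open>The arrays that a command may write can be read off its text. The loop rules below supply for free that all
  other arrays are unchanged, so that an invariant only has to speak of what the loop computes.\<close>

fun nwrites :: "com \<Rightarrow> name set" where
  "nwrites (NAssign x i e) = {x}"
| "nwrites (Seq c d) = nwrites c \<union> nwrites d"
| "nwrites (Cond g c d) = nwrites c \<union> nwrites d"
| "nwrites (While g c) = nwrites c"
| "nwrites (IndepTest x y) = {y}"
| "nwrites (Replacements x r y) = {y}"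
| "nwrites _ = {}"

fun rwrites :: "com \<Rightarrow> name set" where
  "rwrites (RAssign x i e) = {x}"
| "rwrites (Seq c d) = rwrites c \<union> rwrites d"
| "rwrites (Cond g c d) = rwrites c \<union> rwrites d"
| "rwrites (While g c) = rwrites c"
| "rwrites _ = {}"

fun component_free :: "com \<Rightarrow> bool" where
  "component_free (Seq c d) \<longleftrightarrow> component_free c \<and> component_free d"
| "component_free (Cond g c d) \<longleftrightarrow> component_free c \<and> component_free d"
| "component_free (While g c) \<longleftrightarrow> component_free c"
| "component_free CompStart \<longleftrightarrow> False"
| "component_free (CompAdd i) \<longleftrightarrow> False"
| "component_free _ \<longleftrightarrow> True"

definition changes_only :: "com \<Rightarrow> state \<Rightarrow> state \<Rightarrow> bool" where
  "changes_only c s s' \<longleftrightarrow> (\<forall>x. x \<notin> nwrites c \<longrightarrow> nmem s' x = nmem s x) \<and>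
     (\<forall>x. x \<notin> rwrites c \<longrightarrow> rmem s' x = rmem s x) \<and>
     (component_free c \<longrightarrow> cur s' = cur s \<and> labels s' = labels s)"

lemma nwrite_sel [simp]:
  "nmem (nwrite s x i v) = (nmem s)(x := (nmem s x)(i := v))"
  "rmem (nwrite s x i v) = rmem s" "cur (nwrite s x i v) = cur s" "labels (nwrite s x i v) = labels s"
  by (simp_all add: nwrite_def)

lemma rwrite_sel [simp]:
  "rmem (rwrite s x i v) = (rmem s)(x := (rmem s x)(i := v))"
  "nmem (rwrite s x i v) = nmem s" "cur (rwrite s x i v) = cur s" "labels (rwrite s x i v) = labels s"
  by (simp_all add: rwrite_def)

lemma comp_add_sel [simp]:
  "nmem (comp_add M s i) = nmem s" "rmem (comp_add M s i) = rmem s" "cur (comp_add M s i) = insert i (cur s)"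
  "j \<in> insert i (cur s) \<Longrightarrow> labels (comp_add M s i) j = component_label M (insert i (cur s)) j"
  by (auto simp: comp_add_def Let_def)

lemma write_replacements_sel [simp]:
  "nmem (write_replacements M s B l y) =
     (nmem s)(y := (\<lambda>j. if j \<in> B then replacement M B l j else nmem s y j))"
  "rmem (write_replacements M s B l y) = rmem s" "cur (write_replacements M s B l y) = cur s"
  "labels (write_replacements M s B l y) = labels s"
  by (simp_all add: write_replacements_def)

lemma marked_cong: "nmem s' x = nmem s x \<Longrightarrow> marked M s' x = marked M s x"
  by (simp add: marked_def)

lemma marked_sel [simp]:
  "marked M (nwrite s y i v) x = (if x = y then
     (if v = 0 then marked M s x - {i} else if i < ground_size M then insert i (marked M s x) else marked M s x)
     else marked M s x)"
  "marked M (rwrite s y i r) x = marked M s x"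
  "marked M (comp_add M' s i) x = marked M s x"
  "marked M (s\<lparr>cur := A\<rparr>) x = marked M s x"
  by (auto simp: marked_def)

lemma run_changes_only: "run M f G H c s t s' \<Longrightarrow> changes_only c s s'"
  by (induction rule: run.induct) (auto simp: changes_only_def)

abbreviation V :: "name \<Rightarrow> nexp" where "V x \<equiv> NRead x (NConst 0)"
abbreviation RV :: "name \<Rightarrow> rexp" where "RV x \<equiv> RRead x (NConst 0)"

abbreviation set_var :: "name \<Rightarrow> nexp \<Rightarrow> com" (infix "::=" 62) where "x ::= e \<equiv> NAssign x (NConst 0) e"
abbreviation set_rvar :: "name \<Rightarrow> rexp \<Rightarrow> com" (infix "::=r" 62) where "x ::=r e \<equiv> RAssign x (NConst 0) e"
abbreviation seq :: "com \<Rightarrow> com \<Rightarrow> com" (infixr ";;" 60) where "c ;; d \<equiv> Seq c d"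
abbreviation incr :: "name \<Rightarrow> com" where "incr x \<equiv> x ::= NAdd (V x) (NConst (Suc 0))"

definition For :: "name \<Rightarrow> name \<Rightarrow> com \<Rightarrow> com" where
  "For i n c = (i ::= NConst 0;; While (NLess (V i) (V n)) (c;; incr i))"

lemma writes_For [simp]:
  "nwrites (For i n c) = insert i (nwrites c)" "rwrites (For i n c) = rwrites c"
  "component_free (For i n c) = component_free c"
  by (auto simp: For_def)

lemma run_basic:
  "run M f G H Skip s u s' \<longleftrightarrow> u = 1 \<and> s' = s"
  "run M f G H (NAssign x i e) s u s' \<longleftrightarrow> u = 1 \<and> s' = nwrite s x (nval s i) (nval s e)"
  "run M f G H (RAssign x i r) s u s' \<longleftrightarrow> u = 1 \<and> s' = rwrite s x (nval s i) (rval s r)"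
  "run M f G H (IndepTest x y) s u s' \<longleftrightarrow> u = f (ground_size M) \<and>
     s' = nwrite s y 0 (of_bool (marked M s x \<in> indep_sets M))"
  "run M f G H CompStart s u s' \<longleftrightarrow> u = G (ground_size M) \<and> s' = s\<lparr>cur := {}\<rparr>"
  "run M f G H (CompAdd i) s u s' \<longleftrightarrow> u = 1 \<and> nval s i < ground_size M \<and> nval s i \<notin> cur s \<and>
     s' = comp_add M s (nval s i)"
  "run M f G H (Replacements x r y) s u s' \<longleftrightarrow> u = H (ground_size M) \<and>
     rval s r \<in> param_interval M \<and> opt_basis M (rval s r) (marked M s x) \<and>
     s' = write_replacements M s (marked M s x) (rval s r) y"
  by (safe elim!: run.cases intro!: run.intros)

locale machine =
  fixes M :: instance_data and f G H :: "nat \<Rightarrow> real"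
begin

text \<open>\<open>t\<close> is the time elapsed when the command starts; the postcondition refers to the
  time elapsed when it has terminated.\<close>

definition wp :: "com \<Rightarrow> (state \<Rightarrow> real \<Rightarrow> bool) \<Rightarrow> state \<Rightarrow> real \<Rightarrow> bool" where
  "wp c Q s t \<longleftrightarrow> (\<exists>u s'. run M f G H c s u s' \<and> Q s' (t + u))"

lemma wp_basic [simp]:
  "wp Skip Q s t \<longleftrightarrow> Q s (t + 1)"
  "wp (NAssign x i e) Q s t \<longleftrightarrow> Q (nwrite s x (nval s i) (nval s e)) (t + 1)"
  "wp (RAssign x i r) Q s t \<longleftrightarrow> Q (rwrite s x (nval s i) (rval s r)) (t + 1)"
  "wp (IndepTest x y) Q s t \<longleftrightarrow>
     Q (nwrite s y 0 (of_bool (marked M s x \<in> indep_sets M))) (t + f (ground_size M))"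
  "wp CompStart Q s t \<longleftrightarrow> Q (s\<lparr>cur := {}\<rparr>) (t + G (ground_size M))"
  "wp (CompAdd i) Q s t \<longleftrightarrow> nval s i < ground_size M \<and> nval s i \<notin> cur s \<and>
     Q (comp_add M s (nval s i)) (t + 1)"
  "wp (Replacements x r y) Q s t \<longleftrightarrow> rval s r \<in> param_interval M \<and> opt_basis M (rval s r) (marked M s x) \<and>
     Q (write_replacements M s (marked M s x) (rval s r) y) (t + H (ground_size M))"
  by (simp_all add: wp_def run_basic conj_assoc)

lemma wp_Seq [simp]: "wp (c;; d) Q = wp c (wp d Q)"
proof (intro ext iffI)
  fix s t
  assume "wp (c;; d) Q s t"
  then obtain u s' where "run M f G H (c;; d) s u s'" "Q s' (t + u)" unfolding wp_def by blast
  then show "wp c (wp d Q) s t" by cases (auto simp: wp_def add.assoc intro!: exI)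
next
  fix s t
  assume "wp c (wp d Q) s t"
  then obtain u s1 u' s' where "run M f G H c s u s1" "run M f G H d s1 u' s'" "Q s' (t + u + u')"
    unfolding wp_def by blast
  then show "wp (c;; d) Q s t" unfolding wp_def by (metis add.assoc run.Seq)
qed

lemma wp_Cond [simp]:
  "wp (Cond g c d) Q s t \<longleftrightarrow> (if bval s g then wp c Q s (t + 1) else wp d Q s (t + 1))"
proof (cases "bval s g")
  case True
  then have "run M f G H (Cond g c d) s u s' \<longleftrightarrow> (\<exists>v. u = 1 + v \<and> run M f G H c s v s')" for u s'
    by (subst run.simps) auto
  then show ?thesis using True unfolding wp_def by (auto simp: add.assoc)
next
  case False
  then have "run M f G H (Cond g c d) s u s' \<longleftrightarrow> (\<exists>v. u = 1 + v \<and> run M f G H d s v s')" for u s'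
    by (subst run.simps) auto
  then show ?thesis using False unfolding wp_def by (auto simp: add.assoc)
qed

lemma wp_conseq:
  assumes "wp c Q s t" "\<And>s' t'. changes_only c s s' \<Longrightarrow> Q s' t' \<Longrightarrow> Q' s' t'"
  shows "wp c Q' s t"
  using assms run_changes_only unfolding wp_def by blast

lemma changes_only_refl: "changes_only c s s"
  by (simp add: changes_only_def)

lemma changes_only_trans: "changes_only c s s' \<Longrightarrow> changes_only c s' s'' \<Longrightarrow> changes_only c s s''"
  by (auto simp: changes_only_def)

text \<open>The invariant is a relation between states and elapsed times, so it bounds the running time, too.\<close>

lemma wp_While:
  assumes "Inv s t"
    and step: "\<And>s' t'. changes_only c s s' \<Longrightarrow> Inv s' t' \<Longrightarrow> bval s' g \<Longrightarrow>
      wp c (\<lambda>s'' t''. Inv s'' t'' \<and> (\<mu> s'' :: nat) < \<mu> s') s' (t' + 1)"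
    and fin: "\<And>s' t'. changes_only c s s' \<Longrightarrow> Inv s' t' \<Longrightarrow> \<not> bval s' g \<Longrightarrow> Q s' (t' + 1)"
  shows "wp (While g c) Q s t"
proof -
  have "wp (While g c) Q s' t'" if "changes_only c s s'" "Inv s' t'" for s' :: state and t' :: real
    using that
  proof (induction "\<mu> s'" arbitrary: s' t' rule: less_induct)
    case less
    show ?case
    proof (cases "bval s' g")
      case True
      then obtain u s'' where u: "run M f G H c s' u s''" "Inv s'' (t' + 1 + u)" "\<mu> s'' < \<mu> s'"
        using step[OF less.prems] unfolding wp_def by blast
      have "wp (While g c) Q s'' (t' + 1 + u)"
        by (rule less.hyps[OF u(3) changes_only_trans[OF less.prems(1) run_changes_only[OF u(1)]] u(2)])
      then obtain v s3 where "run M f G H (While g c) s'' v s3" "Q s3 (t' + 1 + u + v)"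
        unfolding wp_def by blast
      then show ?thesis unfolding wp_def using WhileTrue[OF True u(1)] by (metis add.assoc)
    next
      case False
      then show ?thesis using fin[OF less.prems False] WhileFalse[OF False] unfolding wp_def by blast
    qed
  qed
  then show ?thesis using assms(1) changes_only_refl by blast
qed

text \<open>\<open>P j\<close> is to hold whenever the loop test is reached with counter \<open>j\<close>. Test and increment take
  one unit of time each.\<close>

lemma wp_For:
  assumes fresh: "i \<notin> nwrites c" "n \<notin> nwrites c" "i \<noteq> n"
    and init: "P 0 (nwrite s i 0 0) (t + 1)"
    and step: "\<And>j s' t'. j < nmem s n 0 \<Longrightarrow> nmem s' i 0 = j \<Longrightarrow> changes_only (For i n c) s s' \<Longrightarrow> P j s' t' \<Longrightarrow>
      wp c (\<lambda>s'' t''. P (Suc j) (nwrite s'' i 0 (Suc j)) (t'' + 1)) s' (t' + 1)"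
    and fin: "\<And>s' t'. changes_only (For i n c) s s' \<Longrightarrow> P (nmem s n 0) s' t' \<Longrightarrow> Q s' (t' + 1)"
  shows "wp (For i n c) Q s t"
  unfolding For_def
proof (simp, rule wp_While[where Inv = "\<lambda>s' t'. changes_only (For i n c) s s' \<and>
    nmem s' i 0 \<le> nmem s n 0 \<and> P (nmem s' i 0) s' t'" and \<mu> = "\<lambda>s'. nmem s n 0 - nmem s' i 0"])
  show "changes_only (For i n c) s (nwrite s i 0 0) \<and> nmem (nwrite s i 0 0) i 0 \<le> nmem s n 0 \<and>
    P (nmem (nwrite s i 0 0) i 0) (nwrite s i 0 0) (t + 1)"
    using init by (simp add: changes_only_def)
next
  fix s' t'
  assume inv: "changes_only (For i n c) s s' \<and> nmem s' i 0 \<le> nmem s n 0 \<and> P (nmem s' i 0) s' t'"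
    and g: "bval s' (NLess (V i) (V n))"
  have n: "nmem s' n = nmem s n" using inv fresh by (simp add: changes_only_def)
  let ?j = "nmem s' i 0"
  have j: "?j < nmem s n 0" using g n by simp
  let ?Q = "\<lambda>s'' t''. (changes_only (For i n c) s s'' \<and> nmem s'' i 0 \<le> nmem s n 0 \<and>
    P (nmem s'' i 0) s'' t'') \<and> nmem s n 0 - nmem s'' i 0 < nmem s n 0 - nmem s' i 0"
  show "wp (c;; incr i) ?Q s' (t' + 1)"
    unfolding wp_Seq
  proof (rule wp_conseq[OF step[OF j refl conjunct1[OF inv] conjunct2[OF conjunct2[OF inv]]]])
    fix s'' t'' assume c: "changes_only c s' s''" and P: "P (Suc ?j) (nwrite s'' i 0 (Suc ?j)) (t'' + 1)"
    have i: "nmem s'' i = nmem s' i" using c fresh by (simp add: changes_only_def)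
    have "changes_only (For i n c) s (nwrite s'' i 0 (Suc ?j))"
      using inv c by (auto simp: changes_only_def)
    then show "wp (incr i) ?Q s'' t''" using P j i by (simp add: diff_less_mono2)
  qed
next
  fix s' t'
  assume inv: "changes_only (For i n c) s s' \<and> nmem s' i 0 \<le> nmem s n 0 \<and> P (nmem s' i 0) s' t'"
    and g: "\<not> bval s' (NLess (V i) (V n))"
  have "nmem s' n = nmem s n" using inv fresh by (simp add: changes_only_def)
  then have "nmem s' i 0 = nmem s n 0" using g inv by simp
  then show "Q s' (t' + 1)" using fin inv by auto
qed

end

section \<open>Merge sort\<close>

fun merge_by :: "(nat \<Rightarrow> real) \<Rightarrow> nat list \<Rightarrow> nat list \<Rightarrow> nat list" where
  "merge_by k [] ys = ys"
| "merge_by k xs [] = xs"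
| "merge_by k (x # xs) (y # ys) =
     (if k y < k x then y # merge_by k (x # xs) ys else x # merge_by k xs (y # ys))"

lemma merge_by_Nil2 [simp]: "merge_by k xs [] = xs"
  by (cases xs) auto

lemma mset_merge_by [simp]: "mset (merge_by k xs ys) = mset xs + mset ys"
  by (induction k xs ys rule: merge_by.induct) auto

lemma set_merge_by [simp]: "set (merge_by k xs ys) = set xs \<union> set ys"
  by (induction k xs ys rule: merge_by.induct) auto

lemma sorted_merge_by:
  "sorted (map k xs) \<Longrightarrow> sorted (map k ys) \<Longrightarrow> sorted (map k (merge_by k xs ys))"
  by (induction k xs ys rule: merge_by.induct) force+

definition merge_block :: "name \<Rightarrow> name \<Rightarrow> com" where
  "merge_block arr key =
     While (NLess (V ''O'') (V ''QE''))
       (Cond (BAnd (NLess (V ''P'') (V ''PE'')) (BNot (BAnd (NLess (V ''Q'') (V ''QE''))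
            (RLess (RRead key (NRead arr (V ''Q''))) (RRead key (NRead arr (V ''P'')))))))
          (NAssign ''T'' (V ''O'') (NRead arr (V ''P''));; incr ''P'')
          (NAssign ''T'' (V ''O'') (NRead arr (V ''Q''));; incr ''Q'');;
        incr ''O'')"

text \<open>With truncated subtraction, \<open>i - (i - n)\<close> is the minimum of \<open>i\<close> and \<open>n\<close>.\<close>

abbreviation nmin :: "nexp \<Rightarrow> nexp \<Rightarrow> nexp" where "nmin i n \<equiv> NSub i (NSub i n)"

definition merge_pass :: "name \<Rightarrow> name \<Rightarrow> name \<Rightarrow> com" where
  "merge_pass arr key n =
     (''I'' ::= NConst 0;; ''O'' ::= NConst 0;;
      While (NLess (V ''I'') (V n))
       (''P'' ::= V ''I'';;
        ''PE'' ::= nmin (NAdd (V ''I'') (V ''W'')) (V n);;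
        ''Q'' ::= V ''PE'';;
        ''QE'' ::= nmin (NAdd (NAdd (V ''I'') (V ''W'')) (V ''W'')) (V n);;
        merge_block arr key;;
        ''I'' ::= V ''QE''))"

text \<open>A bottom-up merge sort, as index expressions can double a block width but not halve an interval. Blocks of width \<open>W\<close> are sorted before each pass.\<close>

definition sort_by :: "name \<Rightarrow> name \<Rightarrow> name \<Rightarrow> com" where
  "sort_by arr key n =
     (''W'' ::= NConst (Suc 0);;
      While (NLess (V ''W'') (V n))
       (merge_pass arr key n;;
        For ''I'' n (NAssign arr (V ''I'') (NRead ''T'' (V ''I'')));;
        ''W'' ::= NAdd (V ''W'') (V ''W'')))"

abbreviation sort_vars :: "name set" where
  "sort_vars \<equiv> {''I'', ''O'', ''P'', ''PE'', ''Q'', ''QE'', ''T'', ''W''}"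

lemma writes_sort [simp]:
  "nwrites (merge_block arr key) = {''O'', ''P'', ''Q'', ''T''}" "rwrites (merge_block arr key) = {}"
  "component_free (merge_block arr key)"
  "nwrites (merge_pass arr key n) = {''I'', ''O'', ''P'', ''PE'', ''Q'', ''QE'', ''T''}"
  "rwrites (merge_pass arr key n) = {}" "component_free (merge_pass arr key n)"
  "nwrites (sort_by arr key n) = insert arr sort_vars" "rwrites (sort_by arr key n) = {}"
  "component_free (sort_by arr key n)"
  by (auto simp: merge_block_def merge_pass_def sort_by_def)

context machine
begin

lemma wp_merge_block:
  assumes start: "nmem s ''O'' 0 = i" "nmem s ''P'' 0 = i" "nmem s ''PE'' 0 = p" "nmem s ''Q'' 0 = p"
      "nmem s ''QE'' 0 = q" "i \<le> p" "p \<le> q" and fresh: "arr \<notin> sort_vars"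
    and Q: "\<And>s' t'. changes_only (merge_block arr key) s s' \<Longrightarrow>
      map (nmem s' ''T'') [i..<q] =
        merge_by (rmem s key) (map (nmem s arr) [i..<p]) (map (nmem s arr) [p..<q]) \<Longrightarrow>
      nmem s' ''O'' 0 = q \<Longrightarrow>
      (\<And>j. j < i \<Longrightarrow> nmem s' ''T'' j = nmem s ''T'' j) \<Longrightarrow> t' \<le> t + 1 + 5 * (real q - real i) \<Longrightarrow> Q s' t'"
  shows "wp (merge_block arr key) Q s t"
proof -
  let ?body = "Cond (BAnd (NLess (V ''P'') (V ''PE'')) (BNot (BAnd (NLess (V ''Q'') (V ''QE''))
            (RLess (RRead key (NRead arr (V ''Q''))) (RRead key (NRead arr (V ''P'')))))))
          (NAssign ''T'' (V ''O'') (NRead arr (V ''P''));; incr ''P'')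
          (NAssign ''T'' (V ''O'') (NRead arr (V ''Q''));; incr ''Q'');; incr ''O''"
  let ?A = "nmem s arr" and ?k = "rmem s key"
  define goal where "goal = merge_by ?k (map ?A [i..<p]) (map ?A [p..<q])"
  define Inv where "Inv s' t' \<longleftrightarrow> (\<exists>o' P Q T. nmem s' ''O'' 0 = o' \<and> nmem s' ''P'' 0 = P \<and>
     nmem s' ''Q'' 0 = Q \<and> nmem s' ''T'' = T \<and> i \<le> o' \<and> o' + p = P + Q \<and> P \<le> p \<and> p \<le> Q \<and> Q \<le> q \<and>
     map T [i..<o'] @ merge_by ?k (map ?A [P..<p]) (map ?A [Q..<q]) = goal \<and>
     (\<forall>j<i. T j = nmem s ''T'' j) \<and> t' \<le> t + 5 * (real o' - real i))" for s' :: state and t' :: real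
  show ?thesis unfolding merge_block_def
  proof (rule wp_While[where Inv = Inv and \<mu> = "\<lambda>s'. q - nmem s' ''O'' 0"])
    show "Inv s t" using start unfolding Inv_def goal_def by simp
  next
    fix s' t' assume ch: "changes_only ?body s s'" and inv: "Inv s' t'" and g: "bval s' (NLess (V ''O'') (V ''QE''))"
    have fr: "nmem s' ''PE'' = nmem s ''PE''" "nmem s' ''QE'' = nmem s ''QE''" "nmem s' arr = ?A"
      "rmem s' = rmem s"
      using ch fresh by (auto simp: changes_only_def)
    obtain o' P R T where o': "nmem s' ''O'' 0 = o'" "nmem s' ''P'' 0 = P"
     "nmem s' ''Q'' 0 = R" "nmem s' ''T'' = T" "i \<le> o'" "o' + p = P + R" "P \<le> p" "p \<le> R" "R \<le> q"
     "map T [i..<o'] @ merge_by ?k (map ?A [P..<p]) (map ?A [R..<q]) = goal"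
     "\<forall>j<i. T j = nmem s ''T'' j" "t' \<le> t + 5 * (real o' - real i)"
      using inv unfolding Inv_def by blast
    have oq: "o' < q" using g fr start o' by simp
    have T: "map (T(o' := v)) [i..<Suc o'] = map T [i..<o'] @ [v]" for v
      using \<open>i \<le> o'\<close> by simp
    have P: "map ?A [P..<p] = ?A P # map ?A [Suc P..<p]" if "P < p"
      using that by (simp add: upt_conv_Cons)
    have R: "map ?A [R..<q] = ?A R # map ?A [Suc R..<q]" if "R < q"
      using that by (simp add: upt_conv_Cons)
    show "wp ?body (\<lambda>s'' t''. Inv s'' t'' \<and> q - nmem s'' ''O'' 0 < q - nmem s' ''O'' 0) s' (t' + 1)"
    proof (cases "P < p \<and> \<not> (R < q \<and> ?k (?A R) < ?k (?A P))")
      case True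
      then have "merge_by ?k (map ?A [P..<p]) (map ?A [R..<q]) =
        ?A P # merge_by ?k (map ?A [Suc P..<p]) (map ?A [R..<q])"
        using P R o'(9) by (cases "R < q") auto
      then show ?thesis using True o' oq T[of "?A P"] start fresh unfolding Inv_def
        by (auto simp: fr simp del: upt_Suc)
    next
      case False
      have "R < q"
      proof (rule ccontr)
        assume "\<not> R < q"
        then show False using False o'(6-9) oq by auto
      qed
      have "merge_by ?k (map ?A [P..<p]) (map ?A [R..<q]) =
        ?A R # merge_by ?k (map ?A [P..<p]) (map ?A [Suc R..<q])"
        using P R[OF \<open>R < q\<close>] False \<open>R < q\<close> o'(7) by (cases "P < p") auto
      then show ?thesis using False \<open>R < q\<close> o' oq T[of "?A R"] start fresh unfolding Inv_def
        by (auto simp: fr simp del: upt_Suc)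
    qed
  next
    fix s' t' assume ch: "changes_only ?body s s'" and inv: "Inv s' t'" and g: "\<not> bval s' (NLess (V ''O'') (V ''QE''))"
    have fr: "nmem s' ''QE'' = nmem s ''QE''" using ch fresh by (auto simp: changes_only_def)
    obtain o' P R T where o': "nmem s' ''O'' 0 = o'" "nmem s' ''P'' 0 = P"
     "nmem s' ''Q'' 0 = R" "nmem s' ''T'' = T" "i \<le> o'" "o' + p = P + R" "P \<le> p" "p \<le> R" "R \<le> q"
     "map T [i..<o'] @ merge_by ?k (map ?A [P..<p]) (map ?A [R..<q]) = goal"
     "\<forall>j<i. T j = nmem s ''T'' j" "t' \<le> t + 5 * (real o' - real i)"
      using inv unfolding Inv_def by blast
    have "q \<le> o'" using g fr start o' by simp
    then have "o' = q" "P = p" "R = q" using o' by linarith+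
    then show "Q s' (t' + 1)" using o' ch unfolding goal_def
      by (intro assms(9)) (auto simp: merge_block_def changes_only_def)
  qed
qed

definition blocks_sorted :: "nat \<Rightarrow> nat \<Rightarrow> (nat \<Rightarrow> real) \<Rightarrow> (nat \<Rightarrow> nat) \<Rightarrow> bool" where
  "blocks_sorted w n k A \<longleftrightarrow> (\<forall>i j. i < j \<and> j < n \<and> i div w = j div w \<longrightarrow> k (A i) \<le> k (A j))"

lemma sorted_map_upt:
  assumes "\<And>p q. i \<le> p \<Longrightarrow> p < q \<Longrightarrow> q < j \<Longrightarrow> k (A p) \<le> (k (A q) :: real)"
  shows "sorted (map k (map A [i..<j]))"
  unfolding sorted_iff_nth_mono_less using assms by auto

lemma sorted_map_uptD:
  assumes "sorted (map k (map A [i..<j]))" "i \<le> p" "p < q" "q < j"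
  shows "k (A p) \<le> (k (A q) :: real)"
proof -
  have "map k (map A [i..<j]) ! (p - i) \<le> map k (map A [i..<j]) ! (q - i)"
    using assms by (intro sorted_nth_mono) auto
  then show ?thesis using assms by (simp add: nth_append)
qed

text \<open>The last block may be incomplete, so a pass stands at position \<open>min (2 * w * c) N\<close> after \<open>c\<close> pairs of
  blocks.\<close>

lemma wp_merge_pass:
  assumes w: "nmem s ''W'' 0 = w" "0 < w" and n: "nmem s n 0 = N" and A: "nmem s arr = A"
    and fresh: "arr \<notin> sort_vars" "n \<notin> sort_vars"
    and sorted: "blocks_sorted w N (rmem s key) A"
    and Q: "\<And>s' t'. changes_only (merge_pass arr key n) s s' \<Longrightarrow>
      mset (map (nmem s' ''T'') [0..<N]) = mset (map A [0..<N]) \<Longrightarrow>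
      blocks_sorted (2 * w) N (rmem s key) (nmem s' ''T'') \<Longrightarrow> t' \<le> t + 3 + 12 * real N \<Longrightarrow> Q s' t'"
  shows "wp (merge_pass arr key n) Q s t"
proof -
  let ?k = "rmem s key"
  let ?body = "''P'' ::= V ''I'';; ''PE'' ::= nmin (NAdd (V ''I'') (V ''W'')) (V n);;
        ''Q'' ::= V ''PE'';; ''QE'' ::= nmin (NAdd (NAdd (V ''I'') (V ''W'')) (V ''W'')) (V n);;
        merge_block arr key;; ''I'' ::= V ''QE''"
  define Inv where "Inv s' t' \<longleftrightarrow> (\<exists>c i T. i = min (2 * w * c) N \<and> nmem s' ''I'' 0 = i \<and> nmem s' ''O'' 0 = i \<and>
    nmem s' ''T'' = T \<and> mset (map T [0..<i]) = mset (map A [0..<i]) \<and>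
    blocks_sorted (2 * w) i ?k T \<and> t' \<le> t + 2 + 12 * real i)" for s' :: state and t' :: real
  show ?thesis unfolding merge_pass_def
  proof (simp, rule wp_While[where Inv = Inv and \<mu> = "\<lambda>s'. N - nmem s' ''I'' 0"])
    show "Inv (nwrite (nwrite s ''I'' 0 0) ''O'' 0 0) (2 + t)"
      unfolding Inv_def by (auto simp: blocks_sorted_def intro: exI[of _ 0])
  next
    fix s' t' assume "changes_only ?body (nwrite (nwrite s ''I'' 0 0) ''O'' 0 0) s'" and inv: "Inv s' t'"
      and g: "bval s' (NLess (V ''I'') (V n))"
    then have fr: "nmem s' ''W'' = nmem s ''W''" "nmem s' n = nmem s n" "nmem s' arr = A" "rmem s' = rmem s"
      using fresh A by (auto simp: changes_only_def)
    obtain c i T where ci: "i = min (2 * w * c) N" "nmem s' ''I'' 0 = i" "nmem s' ''O'' 0 = i"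
      "nmem s' ''T'' = T" "mset (map T [0..<i]) = mset (map A [0..<i])"
      "blocks_sorted (2 * w) i ?k T" "t' \<le> t + 2 + 12 * real i"
      using inv unfolding Inv_def by blast
    have iN: "i < N" using g fr n ci by simp
    then have i: "i = 2 * w * c" using ci by linarith
    define p where "p = min (i + w) N"
    define q where "q = min (i + w + w) N"
    have ipq: "i \<le> p" "p \<le> q" "q \<le> N" "i < q" using iN w unfolding p_def q_def by auto
    have qc: "q = min (2 * w * Suc c) N" unfolding q_def i by (simp add: algebra_simps)
    have blk: "sorted (map ?k (map A [lo..<hi]))" if "lo = w * d" "hi \<le> w * Suc d" "hi \<le> N" for lo hi d
    proof (rule sorted_map_upt)
      fix x y assume xy: "lo \<le> x" "x < y" "y < hi"
      have "x div w = d" "y div w = d" using xy that w(2)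
        by (auto intro!: div_nat_eqI simp: algebra_simps)
      then show "?k (A x) \<le> ?k (A y)" using sorted xy that unfolding blocks_sorted_def by auto
    qed
    have s1: "sorted (map ?k (map A [i..<p]))"
      by (rule blk[of _ "2 * c"]) (auto simp: i p_def)
    have s2: "sorted (map ?k (map A [p..<q]))"
    proof (cases "i + w \<le> N")
      case True
      then show ?thesis by (intro blk[of _ "2 * c + 1"]) (auto simp: i p_def q_def algebra_simps)
    qed (auto simp: p_def q_def)
    have ne: "x \<noteq> arr" "x \<noteq> n" "arr \<noteq> x" "n \<noteq> x" if "x \<in> sort_vars" for x
      using that fresh by auto
    have m1: "x - (x - N) = min x N" for x :: nat by auto
    show "wp ?body (\<lambda>s'' t''. Inv s'' t'' \<and> N - nmem s'' ''I'' 0 < N - nmem s' ''I'' 0) s' (t' + 1)"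
    proof (simp add: fr ci(2-) w n m1 ne flip: p_def q_def,
        rule wp_merge_block[where i = i and p = p and q = q and arr = arr])
      fix s'' t'' 
      let ?s = "nwrite (nwrite (nwrite (nwrite s' ''P'' 0 i) ''PE'' 0 p) ''Q'' 0 p) ''QE'' 0 q"
      assume ch: "changes_only (merge_block arr key) ?s s''"
        and mm: "map (nmem s'' ''T'') [i..<q] =
            merge_by (rmem ?s key) (map (nmem ?s arr) [i..<p]) (map (nmem ?s arr) [p..<q])"
        and O: "nmem s'' ''O'' 0 = q" and low: "\<And>j. j < i \<Longrightarrow> nmem s'' ''T'' j = nmem ?s ''T'' j"
        and t'': "t'' \<le> 5 + t' + 1 + 5 * (real q - real i)"
      have QE: "nmem s'' ''QE'' 0 = q" using ch by (simp add: changes_only_def)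
      define T' where "T' = nmem s'' ''T''"
      have mm': "map T' [i..<q] = merge_by ?k (map A [i..<p]) (map A [p..<q])"
        using mm fresh unfolding T'_def by (auto simp: fr)
      have T'_low: "T' j = T j" if "j < i" for j using low[OF that] ci unfolding T'_def by simp
      have split: "[0..<q] = [0..<i] @ [i..<q]" using ipq upt_add_eq_append[of 0 i "q - i"] by simp
      have split2: "[i..<q] = [i..<p] @ [p..<q]" using ipq upt_add_eq_append[of i p "q - p"] by simp
      have "map T' [0..<i] = map T [0..<i]" using T'_low by auto
      then have "mset (map T' [0..<q]) = mset (map T [0..<i]) + mset (map T' [i..<q])" 
        unfolding split map_append mset_append by metis
      also have "\<dots> = mset (map A [0..<i]) + (mset (map A [i..<p]) + mset (map A [p..<q]))"
        by (simp only: mm' ci(5) mset_merge_by)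
      also have "\<dots> = mset (map A [0..<q])" unfolding split split2 map_append mset_append ..
      finally have ms: "mset (map T' [0..<q]) = mset (map A [0..<q])" .
      have srt: "sorted (map ?k (map T' [i..<q]))" unfolding mm' using sorted_merge_by[OF s1 s2] .
      have "blocks_sorted (2 * w) q ?k T'"
        unfolding blocks_sorted_def
      proof (intro allI impI)
        fix x y assume xy: "x < y \<and> y < q \<and> x div (2 * w) = y div (2 * w)"
        consider "y < i" | "x < i" "i \<le> y" | "i \<le> x" using xy by linarith
        then show "?k (T' x) \<le> ?k (T' y)"
        proof cases
          case 1
          then show ?thesis using ci(6) xy T'_low unfolding blocks_sorted_def by auto
        next
          case 2
          have "x div (2 * w) < c" using 2 w unfolding i by (simp add: less_mult_imp_div_less mult.commute)
          moreover have "c \<le> y div (2 * w)" using 2 w unfolding i by (simp add: less_eq_div_iff_mult_less_eq mult.commute)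
          ultimately show ?thesis using xy by simp
        next
          case 3
          then show ?thesis using sorted_map_uptD[OF srt] xy by blast
        qed
      qed
      moreover have "t'' + 1 \<le> t + 2 + 12 * real q"
      proof -
        have "real i + 1 \<le> real q" using ipq by linarith
        then have "5 * real i + 7 * (real i + 1) \<le> 5 * real i + 7 * real q" by simp
        moreover have "t'' + 1 \<le> (t + 2 + 12 * real i) + 7 + (5 * real q - 5 * real i)"
          using t'' ci(7) by (simp add: algebra_simps)
        ultimately show ?thesis by (simp add: algebra_simps)
      qed
      ultimately have "Inv (nwrite s'' ''I'' 0 q) (t'' + 1)"
        unfolding Inv_def using O ms
        by (intro exI[of _ "Suc c"] exI[of _ q] exI[of _ T'] conjI) (auto simp: T'_def qc[symmetric] simp del: mset_map mult_Suc_right)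
      then show "wp (''I'' ::= V ''QE'') (\<lambda>s'' t''. Inv s'' t'' \<and> N - nmem s'' ''I'' 0 < N - i) s'' t''"
        using QE ipq by auto
    qed (use fresh ipq ci in auto)
  next
    fix s' t' assume ch: "changes_only ?body (nwrite (nwrite s ''I'' 0 0) ''O'' 0 0) s'" and inv: "Inv s' t'"
      and g: "\<not> bval s' (NLess (V ''I'') (V n))"
    have fr: "nmem s' n = nmem s n" using ch fresh by (auto simp: changes_only_def)
    obtain c i T where ci: "i = min (2 * w * c) N" "nmem s' ''I'' 0 = i" "nmem s' ''O'' 0 = i"
      "nmem s' ''T'' = T" "mset (map T [0..<i]) = mset (map A [0..<i])"
      "blocks_sorted (2 * w) i ?k T" "t' \<le> t + 2 + 12 * real i"
      using inv unfolding Inv_def by blast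
    have "i = N" using g fr n ci by simp
    then show "Q s' (t' + 1)" using ci ch
      by (intro Q) (auto simp: changes_only_def merge_pass_def simp del: mset_map)
  qed
qed

text \<open>The number \<open>p\<close> of passes satisfies \<open>2 ^ (p - 1) < N\<close>, which bounds it by \<open>1 + log 2 N\<close>.\<close>

lemma wp_sort_by:
  assumes n: "nmem s n 0 = N" and fresh: "arr \<notin> sort_vars" "n \<notin> sort_vars" "arr \<noteq> n"
    and Q: "\<And>s' t'. changes_only (sort_by arr key n) s s' \<Longrightarrow>
      mset (map (nmem s' arr) [0..<N]) = mset (map (nmem s arr) [0..<N]) \<Longrightarrow>
      (\<And>i j. i < j \<Longrightarrow> j < N \<Longrightarrow> rmem s key (nmem s' arr i) \<le> rmem s key (nmem s' arr j)) \<Longrightarrow>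
      t' \<le> t + 2 + 24 * real N * (1 + log 2 (real N)) \<Longrightarrow> Q s' t'"
  shows "wp (sort_by arr key n) Q s t"
proof -
  let ?k = "rmem s key" and ?A = "nmem s arr"
  let ?copy = "For ''I'' n (NAssign arr (V ''I'') (NRead ''T'' (V ''I'')))"
  let ?body = "merge_pass arr key n;; ?copy;; ''W'' ::= NAdd (V ''W'') (V ''W'')"
  define Inv where "Inv s' t' \<longleftrightarrow> (\<exists>p A. nmem s' ''W'' 0 = 2 ^ p \<and> nmem s' arr = A \<and>
    mset (map A [0..<N]) = mset (map ?A [0..<N]) \<and> blocks_sorted (2 ^ p) N ?k A \<and>
    (p = 0 \<or> 2 ^ p < 2 * N) \<and> t' \<le> t + 1 + 24 * real N * real p)" for s' :: state and t' :: real
  show ?thesis unfolding sort_by_def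
  proof (simp, rule wp_While[where Inv = Inv and \<mu> = "\<lambda>s'. 2 * N - nmem s' ''W'' 0"])
    show "Inv (nwrite s ''W'' 0 (Suc 0)) (t + 1)"
      unfolding Inv_def using fresh by (intro exI[of _ 0]) (auto simp: blocks_sorted_def)
  next
    fix s' t' assume ch: "changes_only ?body (nwrite s ''W'' 0 (Suc 0)) s'" and inv: "Inv s' t'"
      and g: "bval s' (NLess (V ''W'') (V n))"
    have fr: "nmem s' n = nmem s n" "rmem s' = rmem s"
      using ch fresh by (auto simp: changes_only_def)
    obtain p A where pA: "nmem s' ''W'' 0 = 2 ^ p" "nmem s' arr = A"
      "mset (map A [0..<N]) = mset (map ?A [0..<N])" "blocks_sorted (2 ^ p) N ?k A"
      "p = 0 \<or> 2 ^ p < 2 * N" "t' \<le> t + 1 + 24 * real N * real p"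
      using inv unfolding Inv_def by blast
    have pN: "2 ^ p < N" using g pA fr n by simp
    show "wp ?body (\<lambda>s'' t''. Inv s'' t'' \<and> 2 * N - nmem s'' ''W'' 0 < 2 * N - nmem s' ''W'' 0) s' (t' + 1)"
    proof (simp, rule wp_merge_pass[where w = "2 ^ p" and A = A and N = N])
      fix s1 t1 assume ch1: "changes_only (merge_pass arr key n) s' s1"
        and ms: "mset (map (nmem s1 ''T'') [0..<N]) = mset (map A [0..<N])"
        and bl: "blocks_sorted (2 * 2 ^ p) N (rmem s' key) (nmem s1 ''T'')" and t1: "t1 \<le> t' + 1 + 3 + 12 * real N"
      have fr1: "nmem s1 n = nmem s n" "rmem s1 = rmem s" "nmem s1 ''W'' = nmem s' ''W''"
        using ch1 fresh fr by (auto simp: changes_only_def)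
      let ?Q = "wp (''W'' ::= NAdd (V ''W'') (V ''W''))
        (\<lambda>s'' t''. Inv s'' t'' \<and> 2 * N - nmem s'' ''W'' 0 < 2 * N - nmem s' ''W'' 0)"
      show "wp ?copy ?Q s1 t1"
      proof (rule wp_For[where P = "\<lambda>j s'' t''. (\<forall>i<j. nmem s'' arr i = nmem s1 ''T'' i) \<and>
          t'' \<le> t1 + 1 + 3 * real j"])
        fix s2 t2 assume ch2: "changes_only ?copy s1 s2"
          and P: "(\<forall>i<nmem s1 n 0. nmem s2 arr i = nmem s1 ''T'' i) \<and> t2 \<le> t1 + 1 + 3 * real (nmem s1 n 0)"
        have W: "nmem s2 ''W'' 0 = 2 ^ p" using ch2 fresh fr1 pA by (auto simp: changes_only_def)
        have eq: "map (nmem s2 arr) [0..<N] = map (nmem s1 ''T'') [0..<N]" using P fr1 n by simp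
        have "blocks_sorted (2 ^ Suc p) N ?k (nmem s2 arr)"
          using bl P fr fr1 n unfolding blocks_sorted_def by simp
        moreover have "mset (map (nmem s2 arr) [0..<N]) = mset (map ?A [0..<N])"
          unfolding eq ms pA(3) ..
        moreover have "t2 + 1 + 1 \<le> t + 1 + 24 * real N * real (Suc p)"
        proof -
          have "(1::nat) \<le> 2 ^ p" by simp
          then have "1 \<le> real N" using pN by linarith
          then show ?thesis using P t1 pA(6) fr1 n by (simp add: algebra_simps)
        qed
        ultimately have "Inv (nwrite s2 ''W'' 0 (2 ^ Suc p)) (t2 + 1 + 1)"
          unfolding Inv_def using pN fresh
          by (intro exI[of _ "Suc p"] exI[of _ "nmem s2 arr"]) (auto simp del: mset_map)
        moreover have "2 * N - 2 ^ Suc p < 2 * N - 2 ^ p" using pN by (intro diff_less_mono2) auto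
        ultimately show "?Q s2 (t2 + 1)" using W pA(1) by (simp add: mult_2 add.assoc)
      qed (use fresh in \<open>auto simp: less_Suc_eq changes_only_def\<close>)
    qed (use fresh pA fr n in \<open>auto simp: \<close>)
  next
    fix s' t' assume ch: "changes_only ?body (nwrite s ''W'' 0 (Suc 0)) s'" and inv: "Inv s' t'"
      and g: "\<not> bval s' (NLess (V ''W'') (V n))"
    have fr: "nmem s' n = nmem s n" "rmem s' = rmem s"
      using ch fresh by (auto simp: changes_only_def)
    obtain p A where pA: "nmem s' ''W'' 0 = 2 ^ p" "nmem s' arr = A"
      "mset (map A [0..<N]) = mset (map ?A [0..<N])" "blocks_sorted (2 ^ p) N ?k A"
      "p = 0 \<or> 2 ^ p < 2 * N" "t' \<le> t + 1 + 24 * real N * real p"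
      using inv unfolding Inv_def by blast
    have pN: "N \<le> 2 ^ p" using g pA fr n by simp
    have mono: "?k (A i) \<le> ?k (A j)" if "i < j" "j < N" for i j
      using pA(4) that pN unfolding blocks_sorted_def by auto
    have "real N * real p \<le> real N * (1 + log 2 (real N))"
    proof (cases "N = 0")
      case False
      have "real p \<le> 1 + log 2 (real N)"
      proof (cases "p = 0")
        case True
        then show ?thesis using False by simp
      next
        case p: False
        then have "real (2 ^ p) < real (2 * N)" using pA(5) by (metis of_nat_less_iff)
        then have "log 2 (2 ^ p) < log 2 (2 * real N)" using False by (subst log_less_cancel_iff) auto
        then show ?thesis using False by (simp add: log_mult)
      qed
      then show ?thesis by (intro mult_left_mono) auto
    qed simp
    then have "t' + 1 \<le> t + 2 + 24 * real N * (1 + log 2 (real N))" using pA(6) by simp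
    then show "Q s' (t' + 1)" using pA mono ch
      by (intro Q) (auto simp: changes_only_def sort_by_def simp del: mset_map)
  qed
qed

end


section \<open>Computing the candidate points\<close>

definition inside :: "rexp \<Rightarrow> bexp" where
  "inside r = BAnd
     (BNot (BAnd (NLess (NConst 0) (V ''lo_kind'')) (BNot (RLess (RV ''lo'') r))))
     (BNot (BAnd (NLess (NConst 0) (V ''hi_kind'')) (BNot (RLess r (RV ''hi'')))))"

text \<open>The elements that overtake \<open>e\<close> at some point are those of smaller slope. The same loop clears the marks that
  are left from the previous \<open>e\<close>.\<close>

definition lighter_later :: com where
  "lighter_later =
     (''cnt'' ::= NConst 0;;
      For ''f'' ''m''
       (NAssign ''xi'' (V ''f'') (NConst 0);; NAssign ''xj'' (V ''f'') (NConst 0);;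
        Cond (RLess (RRead ''b'' (V ''f'')) (RRead ''b'' (V ''e'')))
         (NAssign ''ids'' (V ''cnt'') (V ''f'');;
          RAssign ''key'' (V ''f'')
            (RDiv (RSub (RRead ''a'' (V ''f'')) (RRead ''a'' (V ''e'')))
                  (RSub (RRead ''b'' (V ''e'')) (RRead ''b'' (V ''f''))));;
          incr ''cnt'')
         Skip))"

definition record_candidate :: com where
  "record_candidate =
     Cond (inside (RRead ''key'' (V ''g'')))
       (RAssign ''val'' (V ''N'') (RRead ''key'' (V ''g''));; NAssign ''ce'' (V ''N'') (V ''e'');;
        NAssign ''cf'' (V ''N'') (V ''g'');; incr ''N'')
       Skip"

text \<open>After \<open>g\<close> has been added, the coloops that share its component are moved from \<open>col\<close> to \<open>xj\<close>. The list is
  filtered in place, which is sound as the writing position \<open>nn\<close> never passes the reading position.\<close>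

definition drop_coloops :: com where
  "drop_coloops =
     (''nn'' ::= NConst 0;;
      For ''j'' ''nc''
       (Cond (BAnd (BNot (NLess (CompLabel (NRead ''col'' (V ''j''))) (CompLabel (V ''g''))))
                   (BNot (NLess (CompLabel (V ''g'')) (CompLabel (NRead ''col'' (V ''j''))))))
         (NAssign ''xj'' (NRead ''col'' (V ''j'')) (NConst (Suc 0)))
         (NAssign ''col'' (V ''nn'') (NRead ''col'' (V ''j''));; incr ''nn''));;
      ''nc'' ::= V ''nn'')"

definition coloop_event :: com where
  "coloop_event = Cond (NLess (NConst 0) (V ''y'')) (record_candidate;; drop_coloops) Skip"

text \<open>\<open>xi\<close> marks a maximal independent subset of the elements added so far, \<open>col\<close> lists the coloops among them
  (all of which are marked), and \<open>xj\<close> marks the rest of the independent set. The new element \<open>g\<close> is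
  a candidate if it is independent of \<open>xi\<close>, or else if it is independent of \<open>xj\<close>, for then its circuit contains
  a coloop.\<close>

definition add_element :: com where
  "add_element =
     (''g'' ::= NRead ''ids'' (V ''i'');;
      CompAdd (V ''g'');;
      NAssign ''xi'' (V ''g'') (NConst (Suc 0));; IndepTest ''xi'' ''y'';;
      Cond (NLess (NConst 0) (V ''y''))
       (record_candidate;; NAssign ''col'' (V ''nc'') (V ''g'');; incr ''nc'')
       (NAssign ''xi'' (V ''g'') (NConst 0);;
        NAssign ''xj'' (V ''g'') (NConst (Suc 0));; IndepTest ''xj'' ''y'';;
        NAssign ''xj'' (V ''g'') (NConst 0);;
        coloop_event))"

definition generate_candidates :: com where
  "generate_candidates =
     For ''e'' ''m''
      (lighter_later;; sort_by ''ids'' ''key'' ''cnt'';; CompStart;; ''nc'' ::= NConst 0;;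
       For ''i'' ''cnt'' add_element)"

lemma writes_candidates [simp]:
  "nwrites lighter_later = {''cnt'', ''f'', ''xi'', ''xj'', ''ids''}" "rwrites lighter_later = {''key''}"
  "component_free lighter_later"
  "nwrites record_candidate = {''ce'', ''cf'', ''N''}" "rwrites record_candidate = {''val''}"
  "component_free record_candidate"
  "nwrites drop_coloops = {''nn'', ''j'', ''xj'', ''col'', ''nc''}" "rwrites drop_coloops = {}"
  "component_free drop_coloops"
  "nwrites coloop_event = {''ce'', ''cf'', ''N'', ''nn'', ''j'', ''xj'', ''col'', ''nc''}"
  "rwrites coloop_event = {''val''}" "component_free coloop_event"
  "nwrites add_element = {''g'', ''xi'', ''y'', ''xj'', ''ce'', ''cf'', ''N'', ''nn'', ''j'', ''col'', ''nc''}"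
  "rwrites add_element = {''val''}"
  "nwrites generate_candidates = {''e'', ''cnt'', ''f'', ''ids'', ''i'', ''g'', ''xi'', ''y'', ''xj'',
     ''ce'', ''cf'', ''N'', ''nn'', ''j'', ''col'', ''nc''} \<union> sort_vars"
  "rwrites generate_candidates = {''key'', ''val''}"
  by (auto simp: lighter_later_def record_candidate_def drop_coloops_def coloop_event_def add_element_def generate_candidates_def)

context matroid
begin

lemma coloops_subset_basis:
  assumes "J \<subseteq> S" "\<And>x. x \<in> S \<Longrightarrow> spans F J x"
  shows "coloops F S \<subseteq> J"
proof
  fix g assume g: "g \<in> coloops F S"
  show "g \<in> J"
  proof (rule ccontr)
    assume "g \<notin> J"
    then have "J \<subseteq> S - {g}" using assms(1) by auto
    then have "spans F (S - {g}) g" using spans_mono[OF assms(2)[of g]] g by (simp add: coloops_def)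
    then show False using g by (simp add: coloops_def)
  qed
qed

text \<open>The set \<open>J\<close> survives the deletion of an element outside \<open>J\<close>. An element of \<open>J\<close> is not a coloop, so its
  deletion does not change the closure of \<open>S\<close>.\<close>

lemma spanned_without_coloops:
  assumes "J \<subseteq> S - coloops F S" "spans F J f" "f \<notin> S"
  shows "spans F (S - {g}) f"
proof (cases "g \<in> J")
  case True
  then have "spans F (S - {g}) g" using assms(1) by (auto simp: coloops_def)
  moreover have "insert g (S - {g}) = S" using True assms(1) by auto
  moreover have "spans F S f" using assms(1) by (intro spans_mono[OF assms(2)]) auto
  ultimately show ?thesis using spans_insert_spanned[of "S - {g}" g f] by simp
next
  case False
  then show ?thesis using assms(1) by (intro spans_mono[OF assms(2)]) auto
qed

text \<open>The fundamental circuit of \<open>f\<close> is not contained in the non-coloops, so it contains a coloop, which is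
  spanned by the rest of that circuit.\<close>

lemma coloop_lost:
  assumes J: "J \<in> F" "J \<subseteq> S" and f: "spans F J f" "f \<notin> S" and nsp: "\<not> spans F (J - coloops F S) f"
  obtains g where "g \<in> coloops F S" "spans F (insert f S - {g}) g"
proof -
  let ?C = "{y \<in> J. insert f (J - {y}) \<in> F}"
  have "spans F ?C f" by (rule spans_exchangeable[OF J(1) f(1)])
  then have "\<not> ?C \<subseteq> J - coloops F S" using nsp spans_mono[of F ?C f] by blast
  then obtain g where g: "g \<in> J" "insert f (J - {g}) \<in> F" "g \<in> coloops F S" by blast
  have "\<not> spans F (J - {g}) f"
    using indep_remove_insert[OF J(1) g(1), of f] g(2) f(2) J(2) by auto
  then have "spans F (insert f (J - {g})) g"
    using spans_exchange[of g "J - {g}" f] f(1) g(1) by (simp add: insert_absorb)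
  moreover have "insert f (J - {g}) \<subseteq> insert f S - {g}" using J(2) f(2) g(1) by auto
  ultimately have "spans F (insert f S - {g}) g" by (rule spans_mono)
  then show thesis using that g(3) by blast
qed

end

locale interdiction_machine =
  interdiction_instance m F a b M + machine M f G H
  for m :: nat and F :: "nat set set" and a b :: "nat \<Rightarrow> rat" and M :: instance_data
    and f G H :: "nat \<Rightarrow> real" +
  fixes I :: "real set"
  assumes param_interval_M: "param_interval M = I" and interval: "is_interval I" "I \<noteq> {}"
    and distinct_points: "distinct_equality_points {..<m} a b I"
    and m_pos: "0 < m" and costs: "1 \<le> f m" "1 \<le> G m" "1 \<le> H m"
begin

abbreviation k :: nat where "k \<equiv> matroid_rank F"
abbreviation cross :: "nat \<Rightarrow> nat \<Rightarrow> real" where "cross \<equiv> crossing a b"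
abbreviation cand :: "nat \<Rightarrow> nat \<Rightarrow> bool" where "cand \<equiv> candidate {..<m} F a b"

text \<open>The interior points of \<open>I\<close>, in terms of what the input contains.\<close>

definition strictly_inside :: "real \<Rightarrow> bool" where
  "strictly_inside x \<longleftrightarrow> (bdd_below I \<longrightarrow> Inf I < x) \<and> (bdd_above I \<longrightarrow> x < Sup I)"

lemma strictly_inside_mem: "strictly_inside x \<Longrightarrow> x \<in> I"
proof -
  assume x: "strictly_inside x"
  have "\<exists>y\<in>I. y < x"
    using x interval(2) cInf_lessD[of I x] unfolding strictly_inside_def bdd_below_def by (metis not_le)
  moreover have "\<exists>z\<in>I. x < z"
    using x interval(2) less_cSupD[of I x] unfolding strictly_inside_def bdd_above_def by (metis not_le)
  ultimately show ?thesis using interval(1) by (meson less_imp_le mem_is_interval_1_I)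
qed

definition inputs :: "state \<Rightarrow> bool" where
  "inputs s \<longleftrightarrow> nmem s ''m'' 0 = m \<and> (\<forall>i<m. rmem s ''a'' i = of_rat (a i) \<and> rmem s ''b'' i = of_rat (b i)) \<and>
     (0 < nmem s ''lo_kind'' 0 \<longleftrightarrow> bdd_below I) \<and> (bdd_below I \<longrightarrow> rmem s ''lo'' 0 = Inf I) \<and>
     (0 < nmem s ''hi_kind'' 0 \<longleftrightarrow> bdd_above I) \<and> (bdd_above I \<longrightarrow> rmem s ''hi'' 0 = Sup I)"

lemma inputs_cong:
  "inputs s \<Longrightarrow> (\<And>x. x \<in> {''m'', ''lo_kind'', ''hi_kind''} \<Longrightarrow> nmem s' x = nmem s x) \<Longrightarrow>
    (\<And>x. x \<in> {''a'', ''b'', ''lo'', ''hi''} \<Longrightarrow> rmem s' x = rmem s x) \<Longrightarrow> inputs s'"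
  unfolding inputs_def by simp

lemma inputs_changes_only:
  "inputs s \<Longrightarrow> changes_only c s s' \<Longrightarrow> nwrites c \<inter> {''m'', ''lo_kind'', ''hi_kind''} = {} \<Longrightarrow>
    rwrites c \<inter> {''a'', ''b'', ''lo'', ''hi''} = {} \<Longrightarrow> inputs s'"
  by (erule inputs_cong) (auto simp: changes_only_def)

lemma inputs_write [simp]:
  "x \<notin> {''m'', ''lo_kind'', ''hi_kind''} \<Longrightarrow> inputs (nwrite s x i v) = inputs s"
  "x \<notin> {''a'', ''b'', ''lo'', ''hi''} \<Longrightarrow> inputs (rwrite s x i r) = inputs s"
  "inputs (comp_add M' s i) = inputs s" "inputs (s\<lparr>cur := A\<rparr>) = inputs s"
  by (rule iffI; erule inputs_cong; auto)+

lemma bval_inside: "inputs s \<Longrightarrow> bval s (inside r) \<longleftrightarrow> strictly_inside (rval s r)"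
  unfolding inside_def strictly_inside_def inputs_def by auto

lemma wp_lighter_later:
  assumes inp: "inputs s" and e: "nmem s ''e'' 0 = e" "e < m"
    and Q: "\<And>s' t'. changes_only lighter_later s s' \<Longrightarrow>
      map (nmem s' ''ids'') [0..<nmem s' ''cnt'' 0] = filter (\<lambda>g. b g < b e) [0..<m] \<Longrightarrow>
      (\<And>g. g < m \<Longrightarrow> b g < b e \<Longrightarrow> rmem s' ''key'' g = cross e g) \<Longrightarrow>
      marked M s' ''xi'' = {} \<Longrightarrow> marked M s' ''xj'' = {} \<Longrightarrow> t' \<le> t + 3 + 8 * real m \<Longrightarrow> Q s' t'"
  shows "wp lighter_later Q s t"
proof -
  let ?body = "NAssign ''xi'' (V ''f'') (NConst 0);; NAssign ''xj'' (V ''f'') (NConst 0);;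
        Cond (RLess (RRead ''b'' (V ''f'')) (RRead ''b'' (V ''e'')))
         (NAssign ''ids'' (V ''cnt'') (V ''f'');;
          RAssign ''key'' (V ''f'')
            (RDiv (RSub (RRead ''a'' (V ''f'')) (RRead ''a'' (V ''e'')))
                  (RSub (RRead ''b'' (V ''e'')) (RRead ''b'' (V ''f''))));;
          incr ''cnt'') Skip"
  let ?s0 = "nwrite s ''cnt'' (nval s (NConst 0)) (nval s (NConst 0))"
  let ?fl = "\<lambda>j. filter (\<lambda>g. b g < b e) [0..<j]"
  define P where "P j s' t' \<longleftrightarrow> map (nmem s' ''ids'') [0..<nmem s' ''cnt'' 0] = ?fl j \<and>
      (\<forall>g<j. b g < b e \<longrightarrow> rmem s' ''key'' g = cross e g) \<and>
      (\<forall>g<j. nmem s' ''xi'' g = 0 \<and> nmem s' ''xj'' g = 0) \<and> t' \<le> t + 2 + 8 * real j"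
    for j :: nat and s' :: state and t' :: real
  show ?thesis unfolding lighter_later_def wp_Seq wp_basic
  proof (rule wp_For[where P = P])
    show "P 0 (nwrite ?s0 ''f'' 0 0) (t + 1 + 1)"
      unfolding P_def by simp
  next
    fix j s' t'
    assume j: "j < nmem ?s0 ''m'' 0"
      and fj: "nmem s' ''f'' 0 = j"
      and ch: "changes_only (For ''f'' ''m'' ?body) ?s0 s'"
      and P: "P j s' t'"
    have fr: "nmem s' ''e'' 0 = e" "rmem s' ''a'' = rmem s ''a''" "rmem s' ''b'' = rmem s ''b''"
      using ch e by (simp_all add: changes_only_def)
    have jm: "j < m" using j inp by (simp add: inputs_def)
    have ab: "rmem s ''a'' j = of_rat (a j)" "rmem s ''b'' j = of_rat (b j)"
      "rmem s ''a'' e = of_rat (a e)" "rmem s ''b'' e = of_rat (b e)"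
      using inp jm e(2) by (auto simp: inputs_def)
    show "wp ?body
        (\<lambda>s'' t''. P (Suc j) (nwrite s'' ''f'' 0 (Suc j)) (t'' + 1)) s' (t' + 1)"
      using P unfolding P_def
      by (auto simp: fr fj ab of_rat_less crossing_def less_Suc_eq)
  next
    fix s' t'
    assume ch: "changes_only (For ''f'' ''m'' ?body) ?s0 s'"
      and P: "P (nmem ?s0 ''m'' 0) s' t'"
    have "P m s' t'" using P inp by (simp add: inputs_def)
    moreover have "changes_only lighter_later s s'" using ch by (auto simp: changes_only_def)
    ultimately show "Q s' (t' + 1)" unfolding P_def
      by (intro Q) (auto simp: marked_def ground_size_M)
  qed simp_all
qed

definition recs :: "state \<Rightarrow> (nat \<times> nat) list \<Rightarrow> bool" where
  "recs s L \<longleftrightarrow> nmem s ''N'' 0 = length L \<and>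
     (\<forall>i<length L. nmem s ''ce'' i = fst (L ! i) \<and> nmem s ''cf'' i = snd (L ! i) \<and>
        rmem s ''val'' i = cross (fst (L ! i)) (snd (L ! i)))"

lemma recs_cong:
  "recs s L \<Longrightarrow> nmem s' ''N'' = nmem s ''N'' \<Longrightarrow> nmem s' ''ce'' = nmem s ''ce'' \<Longrightarrow>
    nmem s' ''cf'' = nmem s ''cf'' \<Longrightarrow> rmem s' ''val'' = rmem s ''val'' \<Longrightarrow> recs s' L"
  unfolding recs_def by simp

lemma wp_record_candidate:
  assumes inp: "inputs s" and rec: "recs s L"
    and g: "nmem s ''e'' 0 = e" "nmem s ''g'' 0 = g" "rmem s ''key'' g = cross e g"
    and Q: "\<And>s' t'. changes_only record_candidate s s' \<Longrightarrow>
      recs s' (if strictly_inside (cross e g) then L @ [(e, g)] else L) \<Longrightarrow> t' \<le> t + 5 \<Longrightarrow> Q s' t'"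
  shows "wp record_candidate Q s t"
proof (cases "strictly_inside (cross e g)")
  case True
  have "recs (nwrite (nwrite (nwrite (rwrite s ''val'' (nmem s ''N'' 0) (cross e g))
      ''ce'' (nmem s ''N'' 0) e) ''cf'' (nmem s ''N'' 0) g) ''N'' 0 (Suc (nmem s ''N'' 0))) (L @ [(e, g)])"
    using rec unfolding recs_def by (auto simp: less_Suc_eq nth_append)
  then show ?thesis using True unfolding record_candidate_def
    by (auto simp: bval_inside inp g changes_only_def record_candidate_def intro!: Q)
next
  case False
  then show ?thesis unfolding record_candidate_def
    by (auto simp: bval_inside inp g rec changes_only_def intro!: Q)
qed

lemma wp_drop_coloops:
  assumes col: "map (nmem s ''col'') [0..<nmem s ''nc'' 0] = C" "set C \<subseteq> {..<m}" and g: "nmem s ''g'' 0 = g"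
    and Q: "\<And>s' t'. changes_only drop_coloops s s' \<Longrightarrow>
      map (nmem s' ''col'') [0..<nmem s' ''nc'' 0] = filter (\<lambda>h. labels s h \<noteq> labels s g) C \<Longrightarrow>
      marked M s' ''xj'' = marked M s ''xj'' \<union> {h \<in> set C. labels s h = labels s g} \<Longrightarrow>
      t' \<le> t + 4 + 5 * real (length C) \<Longrightarrow> Q s' t'"
  shows "wp drop_coloops Q s t"
proof -
  have nc: "nmem s ''nc'' 0 = length C" using col by auto
  have C: "nmem s ''col'' j = C ! j" if "j < length C" for j
    using that nc unfolding col(1)[symmetric] by simp
  let ?p = "\<lambda>h. labels s h \<noteq> labels s g"
  let ?body = "Cond (BAnd (BNot (NLess (CompLabel (NRead ''col'' (V ''j''))) (CompLabel (V ''g''))))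
                   (BNot (NLess (CompLabel (V ''g'')) (CompLabel (NRead ''col'' (V ''j''))))))
         (NAssign ''xj'' (NRead ''col'' (V ''j'')) (NConst (Suc 0)))
         (NAssign ''col'' (V ''nn'') (NRead ''col'' (V ''j''));; incr ''nn'')"
  let ?s0 = "nwrite s ''nn'' (nval s (NConst 0)) (nval s (NConst 0))"
  define P where "P j s' t' \<longleftrightarrow> (\<exists>n. nmem s' ''nn'' 0 = n \<and> n \<le> j \<and>
      map (nmem s' ''col'') [0..<n] = filter ?p (take j C) \<and>
      (\<forall>q\<ge>j. nmem s' ''col'' q = nmem s ''col'' q) \<and>
      marked M s' ''xj'' = marked M s ''xj'' \<union> {h \<in> set (take j C). \<not> ?p h} \<and>
      t' \<le> t + 2 + 5 * real j)"
    for j :: nat and s' :: state and t' :: real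
  show ?thesis unfolding drop_coloops_def wp_Seq wp_basic
  proof (rule wp_For[where P = P])
    show "P 0 (nwrite ?s0 ''j'' 0 0) (t + 1 + 1)" unfolding P_def by auto
  next
    fix j s' t'
    assume j: "j < nmem ?s0 ''nc'' 0" and jj: "nmem s' ''j'' 0 = j"
      and ch: "changes_only (For ''j'' ''nc'' ?body) ?s0 s'" and P: "P j s' t'"
    have fr: "labels s' = labels s" "nmem s' ''g'' 0 = g" using ch g by (auto simp: changes_only_def)
    have jC: "j < length C" using j nc by simp
    have Cj: "C ! j < m" using col(2) jC nth_mem by blast
    have tk: "take (Suc j) C = take j C @ [C ! j]" using jC by (rule take_Suc_conv_app_nth)
    obtain n where n: "nmem s' ''nn'' 0 = n" "n \<le> j" 
      "map (nmem s' ''col'') [0..<n] = filter ?p (take j C)"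
      "\<forall>q\<ge>j. nmem s' ''col'' q = nmem s ''col'' q"
      "marked M s' ''xj'' = marked M s ''xj'' \<union> {h \<in> set (take j C). \<not> ?p h}"
      "t' \<le> t + 2 + 5 * real j" using P unfolding P_def by blast
    have cj: "nmem s' ''col'' j = C ! j" using n(4) C[OF jC] by simp
    have upd: "map (A(n := v)) [0..<Suc n] = map A [0..<n] @ [v]" for A :: "nat \<Rightarrow> nat" and v by simp
    show "wp ?body (\<lambda>s'' t''. P (Suc j) (nwrite s'' ''j'' 0 (Suc j)) (t'' + 1)) s' (t' + 1)"
    proof (cases "?p (C ! j)")
      case True
      let ?s' = "nwrite (nwrite (nwrite s' ''col'' n (C ! j)) ''nn'' 0 (Suc n)) ''j'' 0 (Suc j)"
      have "P (Suc j) ?s' (t' + 5)" unfolding P_def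
        using n True upd[of "nmem s' ''col''" "C ! j"] by (intro exI[of _ "Suc n"]) (auto simp: tk)
      then show ?thesis using True by (auto simp: jj cj fr n(1) neq_iff add.commute)
    next
      case False
      let ?s' = "nwrite (nwrite s' ''xj'' (C ! j) (Suc 0)) ''j'' 0 (Suc j)"
      have "P (Suc j) ?s' (t' + 4)" unfolding P_def
        using n False Cj by (intro exI[of _ n]) (auto simp: tk ground_size_M)
      then show ?thesis using False by (auto simp: jj cj fr n(1) add.commute)
    qed
  next
    fix s' t' assume ch: "changes_only (For ''j'' ''nc'' ?body) ?s0 s'" and P: "P (nmem ?s0 ''nc'' 0) s' t'"
    have "P (length C) s' t'" using P nc by simp
    then obtain n where n: "nmem s' ''nn'' 0 = n"
      "map (nmem s' ''col'') [0..<n] = filter ?p C"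
      "marked M s' ''xj'' = marked M s ''xj'' \<union> {h \<in> set C. \<not> ?p h}"
      "t' \<le> t + 2 + 5 * real (length C)" unfolding P_def by auto
    have "Q (nwrite s' ''nc'' 0 n) (t' + 2)"
    proof (rule Q)
      show "changes_only drop_coloops s (nwrite s' ''nc'' 0 n)" using ch by (auto simp: changes_only_def)
      show "marked M (nwrite s' ''nc'' 0 n) ''xj'' = marked M s ''xj'' \<union> {h \<in> set C. labels s h = labels s g}"
        using n(3) by simp
    qed (use n in auto)
    then show "Q (nwrite s' ''nc'' (nval s' (NConst 0)) (nval s' (V ''nn''))) (t' + 1 + 1)"
      using n(1) by (simp add: add.commute)
  qed simp_all
qed

text \<open>The state of the walk after the elements of \<open>S\<close> have been added and \<open>z\<close> candidates have been met. A
  candidate enlarges the independent set and becomes a coloop itself, or it removes a coloop. So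
  \<open>z + length C\<close> grows only with the independent set, and by at most two for each of its elements.\<close>

definition walk_inv :: "nat set \<Rightarrow> nat list \<Rightarrow> nat \<Rightarrow> state \<Rightarrow> bool" where
  "walk_inv S C z s \<longleftrightarrow> cur s = S \<and>
     marked M s ''xi'' \<in> F \<and> marked M s ''xi'' \<subseteq> S \<and> (\<forall>x\<in>S. spans F (marked M s ''xi'') x) \<and>
     map (nmem s ''col'') [0..<nmem s ''nc'' 0] = C \<and> distinct C \<and> set C = coloops F S \<and>
     marked M s ''xj'' = marked M s ''xi'' - coloops F S \<and> z + length C \<le> 2 * card (marked M s ''xi'')"

text \<open>If \<open>g\<close> is independent of the non-coloops, it must be recorded; if not, no deletion of an element can unspan it. A
  removal of coloops takes time \<open>O(k)\<close> and is paid for by the increase of \<open>z\<close>.\<close>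

lemma wp_add_element:
  assumes inp: "inputs s" and rec: "recs s L" and inv: "walk_inv S C z s"
    and e: "nmem s ''e'' 0 = e" and g: "nmem s ''ids'' (nmem s ''i'' 0) = g" "g < m" "g \<notin> S" "S \<subseteq> {..<m}"
    and key: "rmem s ''key'' g = cross e g"
    and Q: "\<And>s' t' L' C' z'. changes_only add_element s s' \<Longrightarrow> recs s' (L @ L') \<Longrightarrow>
      L' = [] \<or> L' = [(e, g)] \<and> strictly_inside (cross e g) \<Longrightarrow>
      ((\<exists>h. \<not> spans F (S - {h}) g) \<Longrightarrow> strictly_inside (cross e g) \<Longrightarrow> L' = [(e, g)]) \<Longrightarrow>
      walk_inv (insert g S) C' z' s' \<Longrightarrow> length L' + z \<le> z' \<Longrightarrow>
      t' \<le> t + 25 + 2 * f m + (real z' - real z) * (20 + 5 * real k) \<Longrightarrow> Q s' t'"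
  shows "wp add_element Q s t"
proof -
  let ?X = "marked M s ''xi''" and ?col = "coloops F S" and ?S = "insert g S"
  let ?J = "?X - ?col"
  define nc where "nc = nmem s ''nc'' 0"
  have X: "?X \<in> F" "?X \<subseteq> S" "\<And>x. x \<in> S \<Longrightarrow> spans F ?X x" and cur: "cur s = S"
    and C: "map (nmem s ''col'') [0..<nc] = C" "distinct C" "set C = ?col" "length C = nc"
    and J: "marked M s ''xj'' = ?J" and z: "z + length C \<le> 2 * card ?X"
    using inv unfolding walk_inv_def nc_def by auto
  have gX: "g \<notin> ?X" "g \<notin> ?J" using X(2) g by auto
  have JF: "?J \<in> F" using indep_subset[OF X(1)] by blast
  have colX: "?col \<subseteq> ?X" by (rule coloops_subset_basis[OF X(2,3)])
  have Ck: "length C \<le> k"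
    using distinct_card[OF C(2)] C(3) card_mono[OF indep_finite[OF X(1)] colX] card_le_rank[OF X(1)] by simp
  have gm: "g < ground_size M" using g(2) ground_size_M by simp
  let ?L' = "if strictly_inside (cross e g) then [(e, g)] else []"
  have L': "(if strictly_inside (cross e g) then L @ [(e, g)] else L) = L @ ?L'" by simp
  show ?thesis
  proof (cases "insert g ?X \<in> F")
    case True
    then have nsp: "\<not> spans F ?X g" using spans_indep[OF X(1)] gX by blast
    then have nspS: "\<not> spans F S g" using spans_basis[OF X(1,2,3)] by blast
    have col': "coloops F ?S = insert g ?col" by (rule coloops_insert_unspanned[OF g(3) nspS])
    define s1 where "s1 = nwrite (nwrite (comp_add M (nwrite s ''g'' 0 g) g) ''xi'' g (Suc 0)) ''y'' 0 (Suc 0)"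
    have main: "wp record_candidate (wp (NAssign ''col'' (V ''nc'') (V ''g'')) (wp (incr ''nc'') Q)) s1 t1"
      if t1: "t1 \<le> t + 4 + f m" for t1
    proof (rule wp_record_candidate[where L = L and e = e and g = g])
      show "inputs s1" "nmem s1 ''e'' 0 = e" "nmem s1 ''g'' 0 = g" "rmem s1 ''key'' g = cross e g"
        using inp e key unfolding s1_def by simp_all
      show "recs s1 L" by (rule recs_cong[OF rec]) (simp_all add: s1_def)
      fix s2 t2 assume ch: "changes_only record_candidate s1 s2"
        and r: "recs s2 (if strictly_inside (cross e g) then L @ [(e, g)] else L)" and t2: "t2 \<le> t1 + 5"
      have fr: "nmem s2 ''nc'' 0 = nc" "nmem s2 ''g'' 0 = g" "nmem s2 ''col'' = nmem s ''col''"
          "cur s2 = ?S" "nmem s2 ''xi'' = nmem s1 ''xi''" "nmem s2 ''xj'' = nmem s ''xj''"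
        using ch cur unfolding nc_def s1_def by (simp_all add: changes_only_def)
      have mk: "marked M s2 ''xi'' = insert g ?X" "marked M s2 ''xj'' = ?J"
        using marked_cong[OF fr(5)] marked_cong[OF fr(6)] J gm by (simp_all add: s1_def)
      let ?s = "nwrite (nwrite s2 ''col'' nc g) ''nc'' 0 (Suc nc)"
      have "Q ?s (t2 + 2)"
      proof (rule Q[where L' = ?L' and C' = "C @ [g]" and z' = "Suc z"])
        show "changes_only add_element s ?s" using ch unfolding changes_only_def s1_def by (simp add: add_element_def)
        show "recs ?s (L @ ?L')" using r unfolding L'[symmetric] by (rule recs_cong) simp_all
        show "walk_inv ?S (C @ [g]) (Suc z) ?s" unfolding walk_inv_def
        proof (intro conjI ballI)
          show "cur ?s = ?S" "marked M ?s ''xi'' \<in> F" "marked M ?s ''xi'' \<subseteq> ?S"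
            using fr mk X(2) True by auto
          show "spans F (marked M ?s ''xi'') x" if "x \<in> ?S" for x
            using that spans_mono[OF X(3)[of x], of "insert g ?X"] spans_self[of g "insert g ?X" F] mk by auto
          show "map (nmem ?s ''col'') [0..<nmem ?s ''nc'' 0] = C @ [g]"
            using C(1) fr by simp
          show "distinct (C @ [g])" "set (C @ [g]) = coloops F ?S"
            using C col' g(3) by (auto simp: coloops_def)
          show "marked M ?s ''xj'' = marked M ?s ''xi'' - coloops F ?S" using mk gX unfolding col' by auto
          show "Suc z + length (C @ [g]) \<le> 2 * card (marked M ?s ''xi'')"
            using z mk gX indep_finite[OF X(1)] by simp
        qed
        show "t2 + 2 \<le> t + 25 + 2 * f m + (real (Suc z) - real z) * (20 + 5 * real k)"
          using t1 t2 costs by simp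
      qed auto
      then show "wp (NAssign ''col'' (V ''nc'') (V ''g'')) (wp (incr ''nc'') Q) s2 t2"
        by (simp add: fr add.commute)
    qed
    show ?thesis unfolding add_element_def
      using main[unfolded s1_def] True by (simp add: g cur gm ground_size_M indep_sets_M)
  next
    case False
    then have spX: "spans F ?X g" using spans_indep[OF X(1)] by blast
    have spS: "spans F S g" by (rule spans_mono[OF spX X(2)])
    have spans': "spans F ?X x" if "x \<in> ?S" for x using that X(3) spX by auto
    define s1 where "s1 = nwrite (nwrite (nwrite (nwrite (nwrite (nwrite (comp_add M (nwrite s ''g'' 0 g) g)
      ''xi'' g (Suc 0)) ''y'' 0 0) ''xi'' g 0) ''xj'' g (Suc 0)) ''y'' 0 (of_bool (insert g ?J \<in> F))) ''xj'' g 0"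
    have fr: "inputs s1" "nmem s1 ''e'' 0 = e" "nmem s1 ''g'' 0 = g" "rmem s1 ''key'' g = cross e g"
        "nmem s1 ''nc'' 0 = nc" "nmem s1 ''col'' = nmem s ''col''" "cur s1 = ?S"
        "marked M s1 ''xi'' = ?X" "marked M s1 ''xj'' = ?J"
      using inp e key gX gm cur J unfolding s1_def by (simp_all add: nc_def)
    have lab: "labels s1 h = component_label M ?S h" if "h \<in> ?S" for h
      using that cur unfolding s1_def by simp
    have rs1: "recs s1 L" by (rule recs_cong[OF rec]) (simp_all add: s1_def)
    have ch1: "changes_only add_element s s1" unfolding changes_only_def s1_def by (simp add: add_element_def)
    have main: "wp coloop_event Q s1 t1"
      if t1: "t1 \<le> t + 7 + 2 * f m" for t1
    proof (cases "insert g ?J \<in> F")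
      case nJ: False
      then have spJ: "spans F ?J g" using spans_indep[OF JF] by blast
      have JS: "?J \<subseteq> S - ?col" using X(2) by auto
      have col': "coloops F ?S = ?col" by (rule coloops_insert_spanned_by_others[OF g(3) JS spJ])
      have "Q s1 (t1 + 2)"
      proof (rule Q[where L' = "[]" and C' = C and z' = z])
        show "recs s1 (L @ [])" using rs1 by simp
        show "walk_inv ?S C z s1" unfolding walk_inv_def
          using fr X C z spans' col' by auto
        show "[] = [(e, g)]" if "\<exists>h. \<not> spans F (S - {h}) g"
          using that spanned_without_coloops[OF JS spJ g(3)] by blast
        show "t1 + 2 \<le> t + 25 + 2 * f m + (real z - real z) * (20 + 5 * real k)"
          using t1 by simp
      qed (use ch1 in auto)
      then show ?thesis using nJ by (simp add: coloop_event_def s1_def add.commute)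
    next
      case JF': True
      then have nspJ: "\<not> spans F ?J g" using spans_indep[OF JF] gX(2) by blast
      obtain h where h: "h \<in> ?col" "spans F (?S - {h}) h"
        using coloop_lost[OF X(1,2) spX g(3) nspJ] by blast
      have "wp record_candidate (wp drop_coloops Q) s1 (t1 + 1)"
      proof (rule wp_record_candidate[OF fr(1) rs1 fr(2,3,4)])
        fix s2 t2 assume ch2: "changes_only record_candidate s1 s2"
          and r: "recs s2 (if strictly_inside (cross e g) then L @ [(e, g)] else L)" and t2: "t2 \<le> t1 + 1 + 5"
        have fr2: "nmem s2 ''col'' = nmem s1 ''col''" "nmem s2 ''nc'' = nmem s1 ''nc''" "nmem s2 ''g'' = nmem s1 ''g''"
          "labels s2 = labels s1" "cur s2 = cur s1" "nmem s2 ''xi'' = nmem s1 ''xi''" "nmem s2 ''xj'' = nmem s1 ''xj''"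
          using ch2 by (simp_all add: changes_only_def)
        show "wp drop_coloops Q s2 t2"
        proof (rule wp_drop_coloops[where C = C and g = g])
          show "map (nmem s2 ''col'') [0..<nmem s2 ''nc'' 0] = C" "nmem s2 ''g'' 0 = g"
            using fr2 fr C(1) by simp_all
          show "set C \<subseteq> {..<m}" using C(3) g(4) by (auto simp: coloops_def)
          fix s3 t3
          let ?C = "filter (\<lambda>h. labels s2 h \<noteq> labels s2 g) C"
          assume ch3: "changes_only drop_coloops s2 s3"
            and C3: "map (nmem s3 ''col'') [0..<nmem s3 ''nc'' 0] = ?C"
            and xj: "marked M s3 ''xj'' = marked M s2 ''xj'' \<union> {h \<in> set C. labels s2 h = labels s2 g}"
            and t3: "t3 \<le> t2 + 4 + 5 * real (length C)"
          have fr3: "marked M s3 ''xi'' = ?X" "marked M s2 ''xj'' = ?J" "cur s3 = ?S"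
            using marked_cong[OF fr2(6)] marked_cong[OF fr2(7)] marked_cong[of s3 "''xi''" s2] ch3 fr2 fr
            by (auto simp: changes_only_def)
          have eq: "labels s2 h = labels s2 g \<longleftrightarrow> spans F (?S - {h}) h" if "h \<in> ?col" for h
          proof -
            have "matroid {..<ground_size M} (indep_sets M)"
              using matroid_axioms ground_size_M indep_sets_M by simp
            moreover have "h \<in> ?S" "g \<in> ?S" using that by (auto simp: coloops_def)
            ultimately show ?thesis
              using component_label_coloop[of M g S h] g that spS lab fr2(4) ground_size_M indep_sets_M by auto
          qed
          have col': "coloops F ?S = {h \<in> ?col. labels s2 h \<noteq> labels s2 g}"
            unfolding coloops_insert_spanned[OF g(3) spS] using eq by blast
          have "h \<in> set C" "labels s2 h = labels s2 g" using h eq C(3) by auto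
          then have len: "length ?C < length C" using length_filter_less[of h C "\<lambda>h. labels s2 h \<noteq> labels s2 g"] by simp
          show "Q s3 t3"
          proof (rule Q[where L' = ?L' and C' = ?C and z' = "Suc z"])
            show "changes_only add_element s s3"
              using ch1 ch2 ch3 unfolding changes_only_def by (simp add: add_element_def)
            have "recs s2 (L @ ?L')" using r unfolding L'[symmetric] .
            then show "recs s3 (L @ ?L')" using ch3 by (elim recs_cong) (simp_all add: changes_only_def)
            show "walk_inv ?S ?C (Suc z) s3" unfolding walk_inv_def
              using fr3 X spans' C3 C(2,3) col' xj z len colX by auto
            have "real (length C) \<le> real k" using Ck by simp
            then show "t3 \<le> t + 25 + 2 * f m + (real (Suc z) - real z) * (20 + 5 * real k)"
              using t1 t2 t3 by (simp add: algebra_simps)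
          qed auto
        qed
      qed
      then show ?thesis using JF' by (simp add: coloop_event_def s1_def)
    qed
    show ?thesis unfolding add_element_def
      using main[unfolded s1_def] False J gX by (simp add: g cur gm ground_size_M indep_sets_M)
  qed
qed


lemma recs_write [simp]:
  "x \<notin> {''N'', ''ce'', ''cf''} \<Longrightarrow> recs (nwrite s x i v) L = recs s L"
  "x \<noteq> ''val'' \<Longrightarrow> recs (rwrite s x i r) L = recs s L"
  "recs (s\<lparr>cur := A\<rparr>) L = recs s L"
  by (rule iffI; erule recs_cong; auto)+

lemma recs_changes_only:
  "recs s L \<Longrightarrow> changes_only c s s' \<Longrightarrow> nwrites c \<inter> {''N'', ''ce'', ''cf''} = {} \<Longrightarrow> ''val'' \<notin> rwrites c \<Longrightarrow> recs s' L"
  by (erule recs_cong) (auto simp: changes_only_def)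

lemma walk_inv_write [simp]:
  "x \<notin> {''xi'', ''xj'', ''col'', ''nc''} \<Longrightarrow> walk_inv S C z (nwrite s x i v) = walk_inv S C z s"
  unfolding walk_inv_def by auto

lemma wp_walk:
  assumes inp: "inputs s" and rec: "recs s L" and e: "nmem s ''e'' 0 = e"
    and fl: "nmem s ''cnt'' 0 = length fl" "\<And>i. i < length fl \<Longrightarrow> nmem s ''ids'' i = fl ! i"
      "distinct fl" "set fl \<subseteq> {..<m}" "\<And>g. g \<in> set fl \<Longrightarrow> rmem s ''key'' g = cross e g"
    and init: "cur s = {}" "nmem s ''nc'' 0 = 0" "marked M s ''xi'' = {}" "marked M s ''xj'' = {}"
    and Q: "\<And>s' t' gs. changes_only (For ''i'' ''cnt'' add_element) s s' \<Longrightarrow> recs s' (L @ map (Pair e) gs) \<Longrightarrow>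
      distinct gs \<Longrightarrow> set gs \<subseteq> set fl \<Longrightarrow> (\<And>g. g \<in> set gs \<Longrightarrow> strictly_inside (cross e g)) \<Longrightarrow>
      (\<And>q h. q < length fl \<Longrightarrow> \<not> spans F (set (take q fl) - {h}) (fl ! q) \<Longrightarrow> strictly_inside (cross e (fl ! q)) \<Longrightarrow>
        fl ! q \<in> set gs) \<Longrightarrow>
      length gs \<le> 2 * k \<Longrightarrow>
      t' \<le> t + 2 + real (length fl) * (27 + 2 * f m) + 2 * real k * (20 + 5 * real k) \<Longrightarrow> Q s' t'"
  shows "wp (For ''i'' ''cnt'' add_element) Q s t"
proof -
  define P where "P j s' t' \<longleftrightarrow> (\<exists>gs C z. recs s' (L @ map (Pair e) gs) \<and> distinct gs \<and> set gs \<subseteq> set (take j fl) \<and>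
      (\<forall>g\<in>set gs. strictly_inside (cross e g)) \<and>
      (\<forall>q h. q < j \<longrightarrow> \<not> spans F (set (take q fl) - {h}) (fl ! q) \<longrightarrow> strictly_inside (cross e (fl ! q)) \<longrightarrow> fl ! q \<in> set gs) \<and>
      walk_inv (set (take j fl)) C z s' \<and> length gs \<le> z \<and>
      t' \<le> t + 1 + real j * (27 + 2 * f m) + real z * (20 + 5 * real k))"
    for j :: nat and s' :: state and t' :: real
  show ?thesis
  proof (rule wp_For[where P = P])
    have "walk_inv {} [] 0 s" unfolding walk_inv_def
      using init indep_empty by (simp add: coloops_def)
    then show "P 0 (nwrite s ''i'' 0 0) (t + 1)" unfolding P_def using rec by (intro exI[of _ "[]"] exI[of _ 0]) simp
  next
    fix j s' t'
    assume j: "j < nmem s ''cnt'' 0" and i: "nmem s' ''i'' 0 = j"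
      and ch: "changes_only (For ''i'' ''cnt'' add_element) s s'" and P: "P j s' t'"
    obtain gs C z where inv: "recs s' (L @ map (Pair e) gs)" "distinct gs" "set gs \<subseteq> set (take j fl)"
      "\<And>g. g \<in> set gs \<Longrightarrow> strictly_inside (cross e g)"
      "\<And>q h. q < j \<Longrightarrow> \<not> spans F (set (take q fl) - {h}) (fl ! q) \<Longrightarrow> strictly_inside (cross e (fl ! q)) \<Longrightarrow> fl ! q \<in> set gs"
      "walk_inv (set (take j fl)) C z s'" "length gs \<le> z"
      "t' \<le> t + 1 + real j * (27 + 2 * f m) + real z * (20 + 5 * real k)"
      using P unfolding P_def by blast
    have jl: "j < length fl" using j fl(1) by simp
    have tk: "set (take (Suc j) fl) = insert (fl ! j) (set (take j fl))" using jl by (simp add: take_Suc_conv_app_nth)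
    have gj: "fl ! j \<in> set fl" "fl ! j < m" using nth_mem[OF jl] fl(4) by auto
    have new: "fl ! j \<notin> set (take j fl)" using jl fl(3) by (auto simp: in_set_conv_nth nth_eq_iff_index_eq)
    have fr: "inputs s'" "nmem s' ''e'' 0 = e" "nmem s' ''ids'' = nmem s ''ids''" "rmem s' ''key'' = rmem s ''key''"
      using inputs_changes_only[OF inp ch] ch e by (simp_all add: changes_only_def)
    show "wp add_element (\<lambda>s'' t''. P (Suc j) (nwrite s'' ''i'' 0 (Suc j)) (t'' + 1)) s' (t' + 1)"
    proof (rule wp_add_element[OF fr(1) inv(1,6) fr(2), where g = "fl ! j"])
      show "nmem s' ''ids'' (nmem s' ''i'' 0) = fl ! j" "rmem s' ''key'' (fl ! j) = cross e (fl ! j)"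
        using fr i fl(2)[OF jl] fl(5)[OF gj(1)] by simp_all
      show "fl ! j < m" "fl ! j \<notin> set (take j fl)" by fact+
      show "set (take j fl) \<subseteq> {..<m}" using fl(4) set_take_subset by fast
      fix s'' t'' L' C' z'
      assume "recs s'' ((L @ map (Pair e) gs) @ L')"
        and L': "L' = [] \<or> L' = [(e, fl ! j)] \<and> strictly_inside (cross e (fl ! j))"
        and new': "(\<exists>h. \<not> spans F (set (take j fl) - {h}) (fl ! j)) \<Longrightarrow> strictly_inside (cross e (fl ! j)) \<Longrightarrow> L' = [(e, fl ! j)]"
        and "walk_inv (insert (fl ! j) (set (take j fl))) C' z' s''" and z': "length L' + z \<le> z'"
        and t'': "t'' \<le> t' + 1 + 25 + 2 * f m + (real z' - real z) * (20 + 5 * real k)"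
      then have w: "recs s'' (L @ map (Pair e) (gs @ map snd L'))" "walk_inv (set (take (Suc j) fl)) C' z' s''"
        using tk by auto
      have tt: "t'' + 1 \<le> t + 1 + real (Suc j) * (27 + 2 * f m) + real z' * (20 + 5 * real k)"
        using t'' inv(8) by (simp add: algebra_simps)
      show "P (Suc j) (nwrite s'' ''i'' 0 (Suc j)) (t'' + 1)"
        unfolding P_def
      proof (rule exI[of _ "gs @ map snd L'"], rule exI[of _ C'], rule exI[of _ z'], intro conjI allI impI ballI)
        show "recs (nwrite s'' ''i'' 0 (Suc j)) (L @ map (Pair e) (gs @ map snd L'))"
          "walk_inv (set (take (Suc j) fl)) C' z' (nwrite s'' ''i'' 0 (Suc j))" using w by simp_all
        show "distinct (gs @ map snd L')" using inv(2,3) new L' by auto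
        show "set (gs @ map snd L') \<subseteq> set (take (Suc j) fl)" using inv(3) L' unfolding tk by auto
        show "strictly_inside (cross e g)" if "g \<in> set (gs @ map snd L')" for g using that inv(4) L' by auto
        show "fl ! q \<in> set (gs @ map snd L')"
          if "q < Suc j" "\<not> spans F (set (take q fl) - {h}) (fl ! q)" "strictly_inside (cross e (fl ! q))" for q h
        proof (cases "q = j")
          case True
          then have "L' = [(e, fl ! j)]" using that new' by blast
          then show ?thesis using True by simp
        next
          case False
          then show ?thesis using that inv(5)[of q h] by simp
        qed
        show "length (gs @ map snd L') \<le> z'" using inv(7) z' by simp
      qed (rule tt)
    qed
  next
    fix s' t' assume ch: "changes_only (For ''i'' ''cnt'' add_element) s s'" and "P (nmem s ''cnt'' 0) s' t'"
    then have "P (length fl) s' t'" using fl by simp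
    then obtain gs C z where inv: "recs s' (L @ map (Pair e) gs)" "distinct gs" "set gs \<subseteq> set fl"
      "\<And>g. g \<in> set gs \<Longrightarrow> strictly_inside (cross e g)"
      "\<And>q h. q < length fl \<Longrightarrow> \<not> spans F (set (take q fl) - {h}) (fl ! q) \<Longrightarrow> strictly_inside (cross e (fl ! q)) \<Longrightarrow> fl ! q \<in> set gs"
      "walk_inv (set fl) C z s'" "length gs \<le> z"
      "t' \<le> t + 1 + real (length fl) * (27 + 2 * f m) + real z * (20 + 5 * real k)"
      unfolding P_def take_all[OF order_refl] by blast
    have zk: "z \<le> 2 * k"
      using inv(6) card_le_rank[of "marked M s' ''xi''"] unfolding walk_inv_def by linarith
    have "real z * (20 + 5 * real k) \<le> 2 * real k * (20 + 5 * real k)"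
      using zk by (intro mult_right_mono) auto
    then have "t' + 1 \<le> t + 2 + real (length fl) * (27 + 2 * f m) + 2 * real k * (20 + 5 * real k)"
      using inv(8) by linarith
    then show "Q s' (t' + 1)" using inv(7) zk by (intro Q[OF ch inv(1-5)]) auto
  qed simp_all
qed

definition candidates_of :: com where
  "candidates_of = (lighter_later;; sort_by ''ids'' ''key'' ''cnt'';; CompStart;; ''nc'' ::= NConst 0;;
       For ''i'' ''cnt'' add_element)"

definition candidates_time :: real where
  "candidates_time = G m + 10 + 60 * real m * (1 + log 2 (real m)) + 2 * real m * f m + 2 * real k * (20 + 5 * real k)"

lemma n_log_n_mono:
  assumes "n \<le> n'" "0 < n'"
  shows "real n * (1 + log 2 (real n)) \<le> real n' * (1 + log 2 (real n'))"
proof (cases "n = 0")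
  case False
  then show ?thesis using assms by (intro mult_mono add_left_mono log_mono) auto
qed (use assms in simp)

text \<open>As no two crossings with \<open>e\<close> coincide inside \<open>I\<close>, the elements that are sorted before a
  candidate \<open>g\<close> have overtaken \<open>e\<close> strictly before \<open>g\<close> does. Hence they do not span it after
  a suitable deletion, and the walk records \<open>g\<close>.\<close>

lemma wp_candidates_of:
  assumes inp: "inputs s" and rec: "recs s L" and e: "nmem s ''e'' 0 = e" "e < m"
    and Q: "\<And>s' t' gs. changes_only candidates_of s s' \<Longrightarrow> recs s' (L @ map (Pair e) gs) \<Longrightarrow> distinct gs \<Longrightarrow>
      (\<And>g. g \<in> set gs \<Longrightarrow> g < m \<and> b g < b e \<and> strictly_inside (cross e g)) \<Longrightarrow>
      (\<And>g. cand e g \<Longrightarrow> strictly_inside (cross e g) \<Longrightarrow> g \<in> set gs) \<Longrightarrow>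
      length gs \<le> 2 * k \<Longrightarrow> t' \<le> t + candidates_time \<Longrightarrow> Q s' t'"
  shows "wp candidates_of Q s t"
  unfolding candidates_of_def wp_Seq
proof (rule wp_lighter_later[OF inp e])
  fix s1 t1
  assume ch1: "changes_only lighter_later s s1"
    and ids: "map (nmem s1 ''ids'') [0..<nmem s1 ''cnt'' 0] = filter (\<lambda>g. b g < b e) [0..<m]"
    and key: "\<And>g. g < m \<Longrightarrow> b g < b e \<Longrightarrow> rmem s1 ''key'' g = cross e g"
    and mk: "marked M s1 ''xi'' = {}" "marked M s1 ''xj'' = {}" and t1: "t1 \<le> t + 3 + 8 * real m"
  define n where "n = nmem s1 ''cnt'' 0"
  have "length (map (nmem s1 ''ids'') [0..<nmem s1 ''cnt'' 0]) = length (filter (\<lambda>g. b g < b e) [0..<m])"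
    by (simp only: ids)
  then have "n = length (filter (\<lambda>g. b g < b e) [0..<m])" unfolding n_def by simp
  also have "\<dots> \<le> length [0..<m]" by (rule length_filter_le)
  finally have nm: "n \<le> m" by simp
  show "wp (sort_by ''ids'' ''key'' ''cnt'') (wp CompStart (wp (''nc'' ::= NConst 0) (wp (For ''i'' ''cnt'' add_element) Q))) s1 t1"
  proof (rule wp_sort_by[OF n_def[symmetric]])
    fix s2 t2
    assume ch2: "changes_only (sort_by ''ids'' ''key'' ''cnt'') s1 s2"
      and ms: "mset (map (nmem s2 ''ids'') [0..<n]) = mset (map (nmem s1 ''ids'') [0..<n])"
      and srt: "\<And>i j. i < j \<Longrightarrow> j < n \<Longrightarrow> rmem s1 ''key'' (nmem s2 ''ids'' i) \<le> rmem s1 ''key'' (nmem s2 ''ids'' j)"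
      and t2: "t2 \<le> t1 + 2 + 24 * real n * (1 + log 2 (real n))"
    define fl where "fl = map (nmem s2 ''ids'') [0..<n]"
    have fl: "mset fl = mset (filter (\<lambda>g. b g < b e) [0..<m])" unfolding fl_def ms using ids n_def by simp
    have dist: "distinct fl" using mset_eq_imp_distinct_iff[OF fl] by simp
    have setfl: "set fl = {g. g < m \<and> b g < b e}" using mset_eq_setD[OF fl] by auto
    have len: "length fl = n" unfolding fl_def by simp
    have flj: "fl ! j = nmem s2 ''ids'' j" if "j < n" for j using that unfolding fl_def by simp
    have keyfl: "rmem s1 ''key'' g = cross e g" if "g \<in> set fl" for g using that key setfl by auto
    let ?s = "nwrite (s2\<lparr>cur := {}\<rparr>) ''nc'' 0 0"
    have fr: "nmem s2 ''e'' = nmem s ''e''" "nmem s2 ''cnt'' = nmem s1 ''cnt''" "rmem s2 ''key'' = rmem s1 ''key''"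
        "nmem s2 ''xi'' = nmem s1 ''xi''" "nmem s2 ''xj'' = nmem s1 ''xj''"
      using ch1 ch2 by (simp_all add: changes_only_def)
    have inp2: "inputs s2"
      using inputs_changes_only[OF inputs_changes_only[OF inp ch1] ch2] by simp
    have rec2: "recs s2 L" using recs_changes_only[OF recs_changes_only[OF rec ch1] ch2] by simp
    have "wp (For ''i'' ''cnt'' add_element) Q ?s (t2 + G m + 1)"
    proof (rule wp_walk[where L = L and e = e and fl = fl])
      show "inputs ?s" "recs ?s L" "nmem ?s ''e'' 0 = e" "nmem ?s ''cnt'' 0 = length fl" "cur ?s = {}" "nmem ?s ''nc'' 0 = 0"
        using inp2 rec2 fr e len n_def by simp_all
      show "marked M ?s ''xi'' = {}" "marked M ?s ''xj'' = {}"
        using marked_cong[OF fr(4)] marked_cong[OF fr(5)] mk by simp_all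
      show "nmem ?s ''ids'' i = fl ! i" if "i < length fl" for i using that flj len by simp
      show "rmem ?s ''key'' g = cross e g" if "g \<in> set fl" for g using keyfl[OF that] fr by simp
      show "set fl \<subseteq> {..<m}" using setfl by auto
      fix s3 t3 gs
      assume ch3: "changes_only (For ''i'' ''cnt'' add_element) ?s s3"
        and rec3: "recs s3 (L @ map (Pair e) gs)" and gs: "distinct gs" "set gs \<subseteq> set fl"
          "\<And>g. g \<in> set gs \<Longrightarrow> strictly_inside (cross e g)"
        and compl: "\<And>q h. q < length fl \<Longrightarrow> \<not> spans F (set (take q fl) - {h}) (fl ! q) \<Longrightarrow>
          strictly_inside (cross e (fl ! q)) \<Longrightarrow> fl ! q \<in> set gs"
        and lg: "length gs \<le> 2 * k"
        and t3: "t3 \<le> t2 + G m + 1 + 2 + real (length fl) * (27 + 2 * f m) + 2 * real k * (20 + 5 * real k)"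
      show "Q s3 t3"
      proof (rule Q[OF _ rec3 gs(1)])
        show "changes_only candidates_of s s3"
          using ch1 ch2 ch3 unfolding changes_only_def by (simp add: candidates_of_def)
        show "g < m \<and> b g < b e \<and> strictly_inside (cross e g)" if "g \<in> set gs" for g using that gs setfl by auto
        show "length gs \<le> 2 * k" by fact
        show "g \<in> set gs" if g: "cand e g" "strictly_inside (cross e g)" for g
        proof -
          have gm: "g < m" "b g < b e" using g(1) by (auto simp: candidate_def)
          then have "g \<in> set fl" using setfl by simp
          then obtain q where q: "q < n" "g = fl ! q" using len by (metis in_set_conv_nth)
          have "set (take q fl) \<subseteq> earlier {..<m} a b e (cross e g)"
          proof
            fix h assume "h \<in> set (take q fl)"
            then obtain q' where q': "q' < q" "h = fl ! q'" using q len by (auto simp: in_set_conv_nth)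
            have h: "h < m" "b h < b e" using q q' setfl len nth_mem[of q' fl] by auto
            have "cross e h \<le> cross e g"
              using srt[of q' q] q q' flj keyfl[of h] keyfl[of g] nth_mem[of q' fl] nth_mem[of q fl] len by simp
            moreover have "cross e h \<noteq> cross e g"
            proof
              assume eq: "cross e h = cross e g"
              have "equality_point a b e h (cross e g)" "equality_point a b e g (cross e g)"
                using h gm weight_crossing(3)[where a = a and b = b, OF h(2)]
                  weight_crossing(3)[where a = a and b = b, OF gm(2)] eq unfolding equality_point_def by auto
              then have "{e, h} = {e, g}"
                using distinct_points[unfolded distinct_equality_points_def, rule_format, of "cross e g" e h e g]
                  strictly_inside_mem[OF g(2)] h(1) gm(1) e(2) by simp
              then have "fl ! q' = fl ! q" using q(2) q'(2) by (auto simp: doubleton_eq_iff)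
              then have "q' = q" using nth_eq_iff_index_eq[OF dist, of q' q] q(1) q'(1) len by simp
              then show False using q'(1) by simp
            qed
            ultimately show "h \<in> earlier {..<m} a b e (cross e g)" using h by (simp add: earlier_def)
          qed
          moreover obtain h where "\<not> spans F (earlier {..<m} a b e (cross e g) - {h}) g"
            using g(1) unfolding candidate_def by blast
          ultimately have "\<not> spans F (set (take q fl) - {h}) (fl ! q)"
            using spans_mono[of F "set (take q fl) - {h}" g "earlier {..<m} a b e (cross e g) - {h}"] q(2) by blast
          then show ?thesis using compl q g(2) len by blast
        qed
        have "real n * (1 + log 2 (real n)) \<le> real m * (1 + log 2 (real m))" by (rule n_log_n_mono[OF nm m_pos])
        moreover have "real n * (27 + 2 * f m) \<le> real m * (27 + 2 * f m)" using nm costs by (intro mult_right_mono) auto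
        moreover have "0 \<le> real m * log 2 (real m)" using m_pos by simp
        ultimately show "t3 \<le> t + candidates_time"
          using t1 t2 t3 unfolding candidates_time_def len by (simp add: algebra_simps)
      qed
    qed (use dist in auto)
    then show "wp CompStart (wp (''nc'' ::= NConst 0) (wp (For ''i'' ''cnt'' add_element) Q)) s2 t2"
      by (simp add: ground_size_M)
  qed simp_all
qed

text \<open>The pairs \<open>(e, g)\<close> in \<open>L\<close> are the swaps that may happen at an interior point of \<open>I\<close>.\<close>

definition all_candidates :: "(nat \<times> nat) list \<Rightarrow> bool" where
  "all_candidates L \<longleftrightarrow> distinct L \<and> length L \<le> 2 * k * m \<and>
     (\<forall>(e, g)\<in>set L. e < m \<and> g < m \<and> b g < b e \<and> strictly_inside (cross e g)) \<and>
     (\<forall>e g. cand e g \<and> strictly_inside (cross e g) \<longrightarrow> (e, g) \<in> set L)"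

lemma wp_generate_candidates:
  assumes inp: "inputs s" and N: "nmem s ''N'' 0 = 0"
    and Q: "\<And>s' t' L. changes_only generate_candidates s s' \<Longrightarrow> recs s' L \<Longrightarrow> all_candidates L \<Longrightarrow>
      t' \<le> t + 2 + real m * (candidates_time + 2) \<Longrightarrow> Q s' t'"
  shows "wp generate_candidates Q s t"
proof -
  define P where "P j s' t' \<longleftrightarrow> (\<exists>L. recs s' L \<and> distinct L \<and> length L \<le> 2 * k * j \<and>
     (\<forall>(e, g)\<in>set L. e < j \<and> g < m \<and> b g < b e \<and> strictly_inside (cross e g)) \<and>
     (\<forall>e g. e < j \<and> cand e g \<and> strictly_inside (cross e g) \<longrightarrow> (e, g) \<in> set L) \<and>
     t' \<le> t + 1 + real j * (candidates_time + 2))" for j :: nat and s' :: state and t' :: real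
  have m: "nmem s ''m'' 0 = m" using inp by (simp add: inputs_def)
  show ?thesis unfolding generate_candidates_def candidates_of_def[symmetric]
  proof (rule wp_For[where P = P])
    show "P 0 (nwrite s ''e'' 0 0) (t + 1)" unfolding P_def
      using N by (intro exI[of _ "[]"]) (simp add: recs_def)
  next
    fix j s' t' assume j: "j < nmem s ''m'' 0" and e: "nmem s' ''e'' 0 = j"
      and ch: "changes_only (For ''e'' ''m'' candidates_of) s s'" and P: "P j s' t'"
    obtain L where L: "recs s' L" "distinct L" "length L \<le> 2 * k * j"
      "\<forall>(e, g)\<in>set L. e < j \<and> g < m \<and> b g < b e \<and> strictly_inside (cross e g)"
      "\<And>e g. e < j \<Longrightarrow> cand e g \<Longrightarrow> strictly_inside (cross e g) \<Longrightarrow> (e, g) \<in> set L"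
      "t' \<le> t + 1 + real j * (candidates_time + 2)" using P unfolding P_def by blast
    have "inputs s'" using inputs_changes_only[OF inp ch] by (simp add: candidates_of_def)
    then show "wp candidates_of (\<lambda>s'' t''. P (Suc j) (nwrite s'' ''e'' 0 (Suc j)) (t'' + 1)) s' (t' + 1)"
    proof (rule wp_candidates_of[OF _ L(1) e])
      show "j < m" using j m by simp
      fix s'' t'' gs
      assume r: "recs s'' (L @ map (Pair j) gs)" and gs: "distinct gs"
          "\<And>g. g \<in> set gs \<Longrightarrow> g < m \<and> b g < b j \<and> strictly_inside (cross j g)"
          "\<And>g. cand j g \<Longrightarrow> strictly_inside (cross j g) \<Longrightarrow> g \<in> set gs" "length gs \<le> 2 * k"
        and t'': "t'' \<le> t' + 1 + candidates_time"
      show "P (Suc j) (nwrite s'' ''e'' 0 (Suc j)) (t'' + 1)" unfolding P_def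
      proof (intro exI[of _ "L @ map (Pair j) gs"] conjI allI impI)
        show "recs (nwrite s'' ''e'' 0 (Suc j)) (L @ map (Pair j) gs)" using r by simp
        show "distinct (L @ map (Pair j) gs)"
          using L(2,4) gs(1) by (auto simp: distinct_map inj_on_def)
        show "length (L @ map (Pair j) gs) \<le> 2 * k * Suc j" using L(3) gs(4) by simp
        show "\<forall>(e, g)\<in>set (L @ map (Pair j) gs). e < Suc j \<and> g < m \<and> b g < b e \<and> strictly_inside (cross e g)"
          using L(4) gs(2) by fastforce
        show "(e, g) \<in> set (L @ map (Pair j) gs)" if "e < Suc j \<and> cand e g \<and> strictly_inside (cross e g)" for e g
          using that L(5)[of e g] gs(3)[of g] by (cases "e = j") auto
        show "t'' + 1 \<le> t + 1 + real (Suc j) * (candidates_time + 2)"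
          using t'' L(6) by (simp add: algebra_simps)
      qed
    qed
  next
    fix s' t' assume ch: "changes_only (For ''e'' ''m'' candidates_of) s s'" and "P (nmem s ''m'' 0) s' t'"
    then have "P m s' t'" using m by simp
    then obtain L where L: "recs s' L" "distinct L" "length L \<le> 2 * k * m"
      "\<forall>(e, g)\<in>set L. e < m \<and> g < m \<and> b g < b e \<and> strictly_inside (cross e g)"
      "\<forall>e g. e < m \<and> cand e g \<and> strictly_inside (cross e g) \<longrightarrow> (e, g) \<in> set L"
      "t' \<le> t + 1 + real m * (candidates_time + 2)" unfolding P_def by blast
    have "e < m" if "cand e g" for e g using that by (simp add: candidate_def)
    then have "all_candidates L" unfolding all_candidates_def using L by blast
    then show "Q s' (t' + 1)" using L(1,6) ch
      by (intro Q) (auto simp: generate_candidates_def candidates_of_def)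
  qed (simp_all add: candidates_of_def)
qed

end


section \<open>The regions between consecutive candidate points\<close>

definition sort_cuts :: com where
  "sort_cuts =
     (For ''i'' ''N'' (NAssign ''ord'' (V ''i'') (V ''i''));;
      sort_by ''ord'' ''val'' ''N'';;
      RAssign ''cut'' (NConst 0) (RV ''lo'');; NAssign ''cutf'' (NConst 0) (V ''lo_kind'');;
      For ''i'' ''N''
       (RAssign ''cut'' (NAdd (V ''i'') (NConst (Suc 0))) (RRead ''val'' (NRead ''ord'' (V ''i'')));;
        NAssign ''cutf'' (NAdd (V ''i'') (NConst (Suc 0))) (NConst (Suc 0)));;
      RAssign ''cut'' (NAdd (V ''N'') (NConst (Suc 0))) (RV ''hi'');;
      NAssign ''cutf'' (NAdd (V ''N'') (NConst (Suc 0))) (V ''hi_kind''))"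

abbreviation next_r :: nexp where "next_r \<equiv> NAdd (V ''r'') (NConst (Suc 0))"

text \<open>A sample point of the region: the midpoint, or a point at distance \<open>1\<close> from the only finite end, or \<open>0\<close>
  if there is none.\<close>

definition set_mu :: com where
  "set_mu =
     Cond (NLess (NConst 0) (NRead ''cutf'' (V ''r'')))
      (Cond (NLess (NConst 0) (NRead ''cutf'' next_r))
        (''mu'' ::=r RDiv (RAdd (RRead ''cut'' (V ''r'')) (RRead ''cut'' next_r)) (RConst 2))
        (''mu'' ::=r RAdd (RRead ''cut'' (V ''r'')) (RConst 1)))
      (Cond (NLess (NConst 0) (NRead ''cutf'' next_r))
        (''mu'' ::=r RSub (RRead ''cut'' next_r) (RConst 1))
        (''mu'' ::=r RConst 0))"

definition w_at_mu :: "nexp \<Rightarrow> rexp" where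
  "w_at_mu i = RAdd (RRead ''a'' i) (RMul (RV ''mu'') (RRead ''b'' i))"

definition lightest_left :: com where
  "lightest_left =
     (''best'' ::= V ''m'';;
      For ''j'' ''m''
       (Cond (BAnd (BNot (NLess (NConst 0) (NRead ''done'' (V ''j''))))
                (BNot (BAnd (NLess (V ''best'') (V ''m''))
                  (BNot (RLess (w_at_mu (V ''j'')) (w_at_mu (V ''best'')))))))
         (''best'' ::= V ''j'') Skip))"

definition greedy :: com where
  "greedy =
     For ''i'' ''m''
      (lightest_left;;
       NAssign ''done'' (V ''best'') (NConst (Suc 0));; NAssign ''inB'' (V ''best'') (NConst (Suc 0));;
       IndepTest ''inB'' ''y'';;
       Cond (NLess (NConst 0) (V ''y''))
        (NAssign ''bl'' (V ''k'') (V ''best'');; NAssign ''pos'' (V ''best'') (V ''k'');; incr ''k'')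
        (NAssign ''inB'' (V ''best'') (NConst 0)))"

text \<open>At the right end of region \<open>r\<close>, the candidate recorded there is exchanged if this yields a basis.\<close>

definition swap :: com where
  "swap =
     (''g'' ::= NRead ''ce'' (NRead ''ord'' (V ''r''));; ''f'' ::= NRead ''cf'' (NRead ''ord'' (V ''r''));;
      Cond (BAnd (NLess (NConst 0) (NRead ''inB'' (V ''g''))) (BNot (NLess (NConst 0) (NRead ''inB'' (V ''f'')))))
       (NAssign ''inB'' (V ''g'') (NConst 0);; NAssign ''inB'' (V ''f'') (NConst (Suc 0));;
        IndepTest ''inB'' ''y'';;
        Cond (NLess (NConst 0) (V ''y''))
         (NAssign ''pos'' (V ''f'') (NRead ''pos'' (V ''g''));; NAssign ''bl'' (NRead ''pos'' (V ''f'')) (V ''f''))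
         (NAssign ''inB'' (V ''g'') (NConst (Suc 0));; NAssign ''inB'' (V ''f'') (NConst 0)))
       Skip)"

lemma writes_regions [simp]:
  "nwrites sort_cuts = {''i'', ''ord'', ''cutf''} \<union> sort_vars" "rwrites sort_cuts = {''cut''}"
  "nwrites set_mu = {}" "rwrites set_mu = {''mu''}"
  "nwrites lightest_left = {''best'', ''j''}" "rwrites lightest_left = {}"
  "nwrites greedy = {''i'', ''best'', ''j'', ''done'', ''inB'', ''y'', ''bl'', ''pos'', ''k''}" "rwrites greedy = {}"
  "nwrites swap = {''g'', ''f'', ''inB'', ''y'', ''pos'', ''bl''}" "rwrites swap = {}"
  by (auto simp: sort_cuts_def set_mu_def lightest_left_def greedy_def swap_def)

context interdiction_machine
begin

text \<open>The regions are separated by the candidate points, in increasing order. Region \<open>r\<close> extends from \<open>cu r\<close> to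
  \<open>cu (Suc r)\<close>; the first and the last cut are the ends of \<open>I\<close>, and a flag \<open>cf r = 0\<close> marks an infinite
  end.\<close>

definition cut_points :: "(nat \<Rightarrow> real) \<Rightarrow> (nat \<Rightarrow> nat) \<Rightarrow> (nat \<times> nat) list \<Rightarrow> bool" where
  "cut_points cu cf D \<longleftrightarrow> all_candidates D \<and>
     (\<forall>i<length D. cu (Suc i) = cross (fst (D ! i)) (snd (D ! i)) \<and> 0 < cf (Suc i)) \<and>
     (\<forall>i j. i < j \<and> j < length D \<longrightarrow> cu (Suc i) < cu (Suc j)) \<and>
     (0 < cf 0 \<longleftrightarrow> bdd_below I) \<and> (bdd_below I \<longrightarrow> cu 0 = Inf I) \<and>
     (0 < cf (Suc (length D)) \<longleftrightarrow> bdd_above I) \<and> (bdd_above I \<longrightarrow> cu (Suc (length D)) = Sup I)"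

definition open_region :: "(nat \<Rightarrow> real) \<Rightarrow> (nat \<Rightarrow> nat) \<Rightarrow> nat \<Rightarrow> real \<Rightarrow> bool" where
  "open_region cu cf r x \<longleftrightarrow> (0 < cf r \<longrightarrow> cu r < x) \<and> (0 < cf (Suc r) \<longrightarrow> x < cu (Suc r))"

definition closed_region :: "(nat \<Rightarrow> real) \<Rightarrow> (nat \<Rightarrow> nat) \<Rightarrow> nat \<Rightarrow> real \<Rightarrow> bool" where
  "closed_region cu cf r x \<longleftrightarrow> (0 < cf r \<longrightarrow> cu r \<le> x) \<and> (0 < cf (Suc r) \<longrightarrow> x \<le> cu (Suc r))"

definition mu :: "(nat \<Rightarrow> real) \<Rightarrow> (nat \<Rightarrow> nat) \<Rightarrow> nat \<Rightarrow> real" where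
  "mu cu cf r = (if 0 < cf r then if 0 < cf (Suc r) then (cu r + cu (Suc r)) / 2 else cu r + 1
     else if 0 < cf (Suc r) then cu (Suc r) - 1 else 0)"

lemma wp_set_mu [simp]:
  "wp set_mu Q s t \<longleftrightarrow> Q (rwrite s ''mu'' 0 (mu (rmem s ''cut'') (nmem s ''cutf'') (nmem s ''r'' 0))) (t + 3)"
  unfolding set_mu_def mu_def by (simp add: add.commute)

context
  fixes cu cf D
  assumes cuts: "cut_points cu cf D"
begin

lemma cut_inside: "i < length D \<Longrightarrow> strictly_inside (cu (Suc i))"
  using cuts nth_mem[of i D] unfolding cut_points_def all_candidates_def by (cases "D ! i") auto

lemma cut_less: "i < j \<Longrightarrow> j < length D \<Longrightarrow> cu (Suc i) < cu (Suc j)"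
  using cuts[unfolded cut_points_def, THEN conjunct2, THEN conjunct2, THEN conjunct1] by blast

lemma cut_flag: "i < length D \<Longrightarrow> 0 < cf (Suc i)"
  using cuts by (simp add: cut_points_def)

lemma cut_value: "i < length D \<Longrightarrow> cu (Suc i) = cross (fst (D ! i)) (snd (D ! i))"
  using cuts by (simp add: cut_points_def)

lemma cut_ends:
  "0 < cf 0 \<longleftrightarrow> bdd_below I" "bdd_below I \<Longrightarrow> cu 0 = Inf I"
  "0 < cf (Suc (length D)) \<longleftrightarrow> bdd_above I" "bdd_above I \<Longrightarrow> cu (Suc (length D)) = Sup I"
  using cuts by (simp_all add: cut_points_def)

lemma open_region_inside:
  assumes r: "r \<le> length D" and x: "open_region cu cf r x"
  shows "strictly_inside x"
  unfolding strictly_inside_def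
proof (intro conjI impI)
  assume bd: "bdd_below I"
  show "Inf I < x"
  proof (cases r)
    case 0
    then show ?thesis using x cut_ends bd unfolding open_region_def by auto
  next
    case (Suc i)
    then have "strictly_inside (cu r)" "cu r < x" using cut_inside[of i] cut_flag[of i] r x
      unfolding open_region_def by auto
    then show ?thesis using bd unfolding strictly_inside_def by auto
  qed
next
  assume bd: "bdd_above I"
  show "x < Sup I"
  proof (cases "r = length D")
    case True
    then show ?thesis using x cut_ends bd unfolding open_region_def by auto
  next
    case False
    then have "strictly_inside (cu (Suc r))" "x < cu (Suc r)" using cut_inside[of r] cut_flag[of r] r x
      unfolding open_region_def by auto
    then show ?thesis using bd unfolding strictly_inside_def by auto
  qed
qed

lemma no_candidate_in_region:
  assumes r: "r \<le> length D" and e: "cand e g"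
  shows "\<not> open_region cu cf r (cross e g)"
proof
  assume o: "open_region cu cf r (cross e g)"
  have "\<forall>e g. cand e g \<and> strictly_inside (cross e g) \<longrightarrow> (e, g) \<in> set D"
    using cuts by (simp add: cut_points_def all_candidates_def)
  then have "(e, g) \<in> set D" using e open_region_inside[OF r o] by simp
  then obtain i where i: "i < length D" "D ! i = (e, g)" by (auto simp: in_set_conv_nth)
  then have c: "cross e g = cu (Suc i)" using cut_value[of i] by simp
  show False
  proof (cases "i < r")
    case True
    then obtain q where q: "r = Suc q" by (cases r) auto
    then have "cu (Suc i) \<le> cu r" using True cut_less[of i q] r by (cases "i = q") auto
    then show False using o c q cut_flag[of q] r unfolding open_region_def by auto
  next
    case False
    then have "cu (Suc r) \<le> cu (Suc i)" using cut_less[of r i] i by (cases "i = r") auto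
    then show False using o c cut_flag[of r] False i unfolding open_region_def by auto
  qed
qed

lemma cut_order:
  assumes r: "r \<le> length D" and f: "0 < cf r" "0 < cf (Suc r)"
  shows "cu r \<le> cu (Suc r)" and "length D \<noteq> 0 \<Longrightarrow> cu r < cu (Suc r)"
proof -
  have "cu r < cu (Suc r) \<or> length D = 0 \<and> cu r \<le> cu (Suc r)"
  proof (cases r)
    case 0
    then have L: "bdd_below I" "cu r = Inf I" using cut_ends f by auto
    show ?thesis
    proof (cases "length D = 0")
      case True
      then have R: "bdd_above I" "cu (Suc r) = Sup I" using cut_ends f 0 by auto
      have "Inf I \<le> Sup I" by (rule cInf_le_cSup[OF interval(2) R(1) L(1)])
      then show ?thesis using L(2) R(2) True by simp
    next
      case False
      then have "strictly_inside (cu (Suc r))" using cut_inside[of 0] 0 by auto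
      then show ?thesis using L unfolding strictly_inside_def by auto
    qed
  next
    case (Suc i)
    then have ins: "strictly_inside (cu r)" using cut_inside[of i] r by auto
    show ?thesis
    proof (cases "r = length D")
      case True
      then have "bdd_above I" "cu (Suc r) = Sup I" using cut_ends f by simp_all
      then show ?thesis using ins unfolding strictly_inside_def by auto
    next
      case False
      then show ?thesis using cut_less[of i r] Suc r by auto
    qed
  qed
  then show "cu r \<le> cu (Suc r)" "length D \<noteq> 0 \<Longrightarrow> cu r < cu (Suc r)" by auto
qed

text \<open>The sample point lies inside the region, unless \<open>I\<close> consists of one point.\<close>

lemma mu_region:
  assumes r: "r \<le> length D"
  shows "open_region cu cf r (mu cu cf r) \<or>
    length D = 0 \<and> 0 < cf r \<and> 0 < cf (Suc r) \<and> cu r = mu cu cf r \<and> cu (Suc r) = mu cu cf r"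
proof (cases "0 < cf r \<and> 0 < cf (Suc r)")
  case True
  then show ?thesis using cut_order[OF r] unfolding open_region_def mu_def by (auto simp: field_simps)
qed (auto simp: open_region_def mu_def)

lemma mu_mem:
  assumes r: "r \<le> length D"
  shows "mu cu cf r \<in> I"
  using mu_region[OF r]
proof
  assume "open_region cu cf r (mu cu cf r)"
  then show ?thesis using open_region_inside[OF r] strictly_inside_mem by blast
next
  assume *: "length D = 0 \<and> 0 < cf r \<and> 0 < cf (Suc r) \<and> cu r = mu cu cf r \<and> cu (Suc r) = mu cu cf r"
  then have "bdd_below I" "bdd_above I" "Inf I = mu cu cf r" "Sup I = mu cu cf r"
    using cut_ends r by auto
  moreover obtain x where "x \<in> I" using interval(2) by blast
  ultimately show ?thesis using cInf_lower[of x I] cSup_upper[of x I] by (metis order_antisym)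
qed

lemma mu_between:
  assumes r: "r \<le> length D" and l: "closed_region cu cf r l" and c: "c \<in> {mu cu cf r..<l} \<union> {l<..mu cu cf r}"
  shows "open_region cu cf r c"
  using mu_region[OF r] l c unfolding open_region_def closed_region_def by auto

text \<open>From the sample point to any point of the closed region, no candidate point is met on the way, so
  whatever is optimal at the sample point is so on the closed region.\<close>

lemma region_no_crossing:
  assumes "r \<le> length D" "closed_region cu cf r l" "cand e g"
  shows "cross e g \<notin> {mu cu cf r..<l} \<union> {l<..mu cu cf r}"
  using no_candidate_in_region[OF assms(1,3)] mu_between[OF assms(1,2)] by blast

lemma opt_basis_next_region:
  assumes r: "r < length D" and B: "opt_basis M (mu cu cf r) B" and D': "opt_basis M (mu cu cf (Suc r)) B'"
    and D: "D ! r = (e, g)"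
  shows "B' = (if e \<in> B \<and> g \<notin> B \<and> insert g (B - {e}) \<in> F then insert g (B - {e}) else B)"
proof (rule opt_basis_swap)
  let ?p = "cu (Suc r)"
  have f: "0 < cf (Suc r)" by (rule cut_flag[OF r])
  have r': "r \<le> length D" "Suc r \<le> length D" using r by auto
  have c1: "closed_region cu cf r ?p"
    unfolding closed_region_def using cut_order(1)[of r] r f by auto
  have c2: "closed_region cu cf (Suc r) ?p"
    unfolding closed_region_def using cut_order(1)[of "Suc r"] r f by auto
  show "opt_basis M (mu cu cf r) B" "opt_basis M (mu cu cf (Suc r)) B'" by fact+
  show "min_weight_basis F a b ?p B" by (rule region_values(1)[OF B region_no_crossing[OF r'(1) c1]])
  show "min_weight_basis F a b ?p B'" by (rule region_values(1)[OF D' region_no_crossing[OF r'(2) c2]])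
  show "mu cu cf r < ?p" using mu_region[of r] r f unfolding open_region_def by auto
  show "?p < mu cu cf (Suc r)" using mu_region[of "Suc r"] r f unfolding open_region_def by auto
  have eg: "(e, g) \<in> set D" using D r nth_mem by metis
  moreover have "\<forall>(e, g)\<in>set D. e < m \<and> g < m \<and> b g < b e \<and> strictly_inside (cross e g)"
    using cuts by (simp add: cut_points_def all_candidates_def)
  ultimately have eg': "e < m" "g < m" "b g < b e" "strictly_inside (cross e g)" by auto
  show "b g < b e" "g < m" by fact+
  show cr: "cross e g = ?p" using cut_value[OF r] D by simp
  fix x y assume xy: "x < m" "y < m" "b x \<noteq> b y" "weight a b x ?p = weight a b y ?p"
  have "equality_point a b x y ?p" using xy unfolding equality_point_def by auto
  moreover have "equality_point a b e g ?p"
    using eg' cr weight_crossing(3)[where a = a and b = b, OF eg'(3)] unfolding equality_point_def by auto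
  ultimately show "{x, y} = {e, g}"
    using distinct_points[unfolded distinct_equality_points_def, rule_format, of ?p x y e g]
      xy(1,2) eg'(1,2) strictly_inside_mem[OF eg'(4)] cr by simp
qed

end

text \<open>\<open>D\<close> lists the candidates in increasing order of their points; \<open>ord\<close> points to their records.\<close>

definition cuts_state :: "state \<Rightarrow> (nat \<times> nat) list \<Rightarrow> bool" where
  "cuts_state s D \<longleftrightarrow> cut_points (rmem s ''cut'') (nmem s ''cutf'') D \<and> nmem s ''N'' 0 = length D \<and>
     (\<forall>i<length D. nmem s ''ce'' (nmem s ''ord'' i) = fst (D ! i) \<and> nmem s ''cf'' (nmem s ''ord'' i) = snd (D ! i))"

lemma wp_sort_cuts:
  assumes inp: "inputs s" and rec: "recs s L" and L: "all_candidates L"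
    and Q: "\<And>s' t' D. changes_only sort_cuts s s' \<Longrightarrow> cuts_state s' D \<Longrightarrow> length D = length L \<Longrightarrow>
      t' \<le> t + 20 + 7 * real (length L) + 24 * real (length L) * (1 + log 2 (real (length L))) \<Longrightarrow> Q s' t'"
  shows "wp sort_cuts Q s t"
proof -
  define n where "n = length L"
  have N: "nmem s ''N'' 0 = n" using rec unfolding recs_def n_def by simp
  let ?id = "NAssign ''ord'' (V ''i'') (V ''i'')"
  let ?fill = "RAssign ''cut'' (NAdd (V ''i'') (NConst (Suc 0))) (RRead ''val'' (NRead ''ord'' (V ''i'')));;
        NAssign ''cutf'' (NAdd (V ''i'') (NConst (Suc 0))) (NConst (Suc 0))"
  let ?c3 = "RAssign ''cut'' (NAdd (V ''N'') (NConst (Suc 0))) (RV ''hi'')"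
  let ?c4 = "NAssign ''cutf'' (NAdd (V ''N'') (NConst (Suc 0))) (V ''hi_kind'')"
  let ?c2 = "wp (For ''i'' ''N'' ?fill) (wp ?c3 (wp ?c4 Q))"
  let ?c1 = "wp (RAssign ''cut'' (NConst 0) (RV ''lo'')) (wp (NAssign ''cutf'' (NConst 0) (V ''lo_kind'')) ?c2)"
  show ?thesis unfolding sort_cuts_def wp_Seq[of "For ''i'' ''N'' ?id"] wp_Seq[of "sort_by ''ord'' ''val'' ''N''"]
    wp_Seq[of "RAssign ''cut'' (NConst 0) (RV ''lo'')"] wp_Seq[of "NAssign ''cutf'' (NConst 0) (V ''lo_kind'')"]
    wp_Seq[of "For ''i'' ''N'' ?fill"] wp_Seq[of ?c3]
  proof (rule wp_For[where P = "\<lambda>j s' t'. (\<forall>i<j. nmem s' ''ord'' i = i) \<and> t' \<le> t + 1 + 3 * real j"])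
    fix s1 t1 assume ch1: "changes_only (For ''i'' ''N'' ?id) s s1"
      and "(\<forall>i<nmem s ''N'' 0. nmem s1 ''ord'' i = i) \<and> t1 \<le> t + 1 + 3 * real (nmem s ''N'' 0)"
    then have P1: "\<And>i. i < n \<Longrightarrow> nmem s1 ''ord'' i = i" "t1 \<le> t + 1 + 3 * real n" using N by auto
    have N1: "nmem s1 ''N'' 0 = n" using ch1 N by (simp add: changes_only_def)
    show "wp (sort_by ''ord'' ''val'' ''N'') ?c1 s1 (t1 + 1)"
    proof (rule wp_sort_by[OF N1])
      fix s2 t2 assume ch2: "changes_only (sort_by ''ord'' ''val'' ''N'') s1 s2"
        and ms: "mset (map (nmem s2 ''ord'') [0..<n]) = mset (map (nmem s1 ''ord'') [0..<n])"
        and srt: "\<And>i j. i < j \<Longrightarrow> j < n \<Longrightarrow> rmem s1 ''val'' (nmem s2 ''ord'' i) \<le> rmem s1 ''val'' (nmem s2 ''ord'' j)"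
        and t2: "t2 \<le> t1 + 1 + 2 + 24 * real n * (1 + log 2 (real n))"
      define od where "od = nmem s2 ''ord''"
      have "map (nmem s1 ''ord'') [0..<n] = [0..<n]" using P1(1) by (intro map_idI) auto
      then have ms': "mset (map od [0..<n]) = mset [0..<n]" using ms unfolding od_def by simp
      have dist_od: "distinct (map od [0..<n])" using mset_eq_imp_distinct_iff[OF ms'] by simp
      have set_od: "od ` {0..<n} = {0..<n}" using mset_eq_setD[OF ms'] by simp
      define D where "D = map (\<lambda>i. L ! od i) [0..<n]"
      have lenD: "length D = n" unfolding D_def by simp
      have odn: "od i < n" if "i < n" for i using set_od that by (metis atLeastLessThan_iff imageI le0)
      have Dn: "D ! i = L ! od i" if "i < n" for i using that unfolding D_def by simp
      have "map ((!) L) (map od [0..<n]) = D" unfolding D_def by simp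
      then have msD: "mset D = mset L"
        using ms' by (metis map_nth mset_map n_def)
      have aD: "all_candidates D"
        using L mset_eq_setD[OF msD] mset_eq_length[OF msD] mset_eq_imp_distinct_iff[OF msD]
        unfolding all_candidates_def by simp
      have fr: "nmem s2 ''ce'' = nmem s ''ce''" "nmem s2 ''cf'' = nmem s ''cf''" "rmem s2 ''val'' = rmem s ''val''"
          "nmem s2 ''N'' 0 = n" "rmem s1 ''val'' = rmem s ''val''"
        using ch1 ch2 N by (simp_all add: changes_only_def)
      have inp2: "inputs s2" using inputs_changes_only[OF inputs_changes_only[OF inp ch1] ch2] by simp
      have val: "rmem s ''val'' (od i) = cross (fst (D ! i)) (snd (D ! i))"
          "nmem s ''ce'' (od i) = fst (D ! i)" "nmem s ''cf'' (od i) = snd (D ! i)" if "i < n" for i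
        using rec odn[OF that] Dn[OF that] unfolding recs_def n_def by auto
      have less: "rmem s ''val'' (od i) < rmem s ''val'' (od j)" if ij: "i < j" "j < n" for i j
      proof -
        have le: "rmem s ''val'' (od i) \<le> rmem s ''val'' (od j)" using srt[OF ij] fr unfolding od_def by simp
        obtain e g e' g' where D: "D ! i = (e, g)" "D ! j = (e', g')" by (cases "D ! i"; cases "D ! j")
        have in_D: "(e, g) \<in> set D" "(e', g') \<in> set D"
          using D ij lenD nth_mem[of i D] nth_mem[of j D] by auto
        have eg: "e < m" "g < m" "b g < b e" "strictly_inside (cross e g)"
            "e' < m" "g' < m" "b g' < b e'"
          using aD in_D unfolding all_candidates_def by auto
        have "cross e g \<noteq> cross e' g'"
        proof
          assume eq: "cross e g = cross e' g'"
          have "equality_point a b e g (cross e g)" "equality_point a b e' g' (cross e g)"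
            using eg eq weight_crossing(3)[where a = a and b = b, OF eg(3)]
              weight_crossing(3)[where a = a and b = b, OF eg(7)] unfolding equality_point_def by auto
          then have "{e, g} = {e', g'}"
            using distinct_points[unfolded distinct_equality_points_def, rule_format, of "cross e g" e g e' g']
              strictly_inside_mem[OF eg(4)] eg(1,2,5,6) by simp
          then have "D ! i = D ! j" using D eg by (auto simp: doubleton_eq_iff)
          then show False using aD ij lenD nth_eq_iff_index_eq[of D i j] unfolding all_candidates_def by simp
        qed
        then show ?thesis using le val ij D by fastforce
      qed
      let ?s = "nwrite (rwrite s2 ''cut'' 0 (rmem s2 ''lo'' 0)) ''cutf'' 0 (nmem s2 ''lo_kind'' 0)"
      have "?c2 ?s (t2 + 2)"
      proof (rule wp_For[where P = "\<lambda>j s' t'. (\<forall>i<j. rmem s' ''cut'' (Suc i) = rmem s ''val'' (od i) \<and>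
          nmem s' ''cutf'' (Suc i) = Suc 0) \<and> rmem s' ''cut'' 0 = rmem s2 ''lo'' 0 \<and>
          nmem s' ''cutf'' 0 = nmem s2 ''lo_kind'' 0 \<and> t' \<le> t2 + 3 + 4 * real j"])
        fix j s' t' assume j: "nmem s' ''i'' 0 = j" and ch: "changes_only (For ''i'' ''N'' ?fill) ?s s'"
          and P: "(\<forall>i<j. rmem s' ''cut'' (Suc i) = rmem s ''val'' (od i) \<and>
          nmem s' ''cutf'' (Suc i) = Suc 0) \<and> rmem s' ''cut'' 0 = rmem s2 ''lo'' 0 \<and>
          nmem s' ''cutf'' 0 = nmem s2 ''lo_kind'' 0 \<and> t' \<le> t2 + 3 + 4 * real j"
        have "rmem s' ''val'' = rmem s ''val''" "nmem s' ''ord'' = od"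
          using ch fr unfolding od_def by (simp_all add: changes_only_def)
        then show "wp ?fill (\<lambda>s'' t''. (\<forall>i<Suc j. rmem (nwrite s'' ''i'' 0 (Suc j)) ''cut'' (Suc i) = rmem s ''val'' (od i) \<and>
          nmem (nwrite s'' ''i'' 0 (Suc j)) ''cutf'' (Suc i) = Suc 0) \<and>
          rmem (nwrite s'' ''i'' 0 (Suc j)) ''cut'' 0 = rmem s2 ''lo'' 0 \<and>
          nmem (nwrite s'' ''i'' 0 (Suc j)) ''cutf'' 0 = nmem s2 ''lo_kind'' 0 \<and> t'' + 1 \<le> t2 + 3 + 4 * real (Suc j)) s' (t' + 1)"
          using P j by (auto simp: less_Suc_eq)
      next
        fix s3 t3 assume ch: "changes_only (For ''i'' ''N'' ?fill) ?s s3"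
          and "(\<forall>i<nmem ?s ''N'' 0. rmem s3 ''cut'' (Suc i) = rmem s ''val'' (od i) \<and>
          nmem s3 ''cutf'' (Suc i) = Suc 0) \<and> rmem s3 ''cut'' 0 = rmem s2 ''lo'' 0 \<and>
          nmem s3 ''cutf'' 0 = nmem s2 ''lo_kind'' 0 \<and> t3 \<le> t2 + 3 + 4 * real (nmem ?s ''N'' 0)"
        then have P: "\<And>i. i < n \<Longrightarrow> rmem s3 ''cut'' (Suc i) = rmem s ''val'' (od i)"
            "\<And>i. i < n \<Longrightarrow> nmem s3 ''cutf'' (Suc i) = Suc 0"
            "rmem s3 ''cut'' 0 = rmem s2 ''lo'' 0"
            "nmem s3 ''cutf'' 0 = nmem s2 ''lo_kind'' 0" "t3 \<le> t2 + 3 + 4 * real n"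
          using fr by auto
        have fr3: "nmem s3 ''N'' 0 = n" "nmem s3 ''hi_kind'' = nmem s2 ''hi_kind''" "rmem s3 ''hi'' = rmem s2 ''hi''"
            "nmem s3 ''ce'' = nmem s ''ce''" "nmem s3 ''cf'' = nmem s ''cf''" "nmem s3 ''ord'' = od"
          using ch fr unfolding od_def by (simp_all add: changes_only_def)
        let ?s' = "nwrite (rwrite s3 ''cut'' (Suc n) (rmem s2 ''hi'' 0)) ''cutf'' (Suc n) (nmem s2 ''hi_kind'' 0)"
        have "Q ?s' (t3 + 3)"
        proof (rule Q[where D = D])
          show "changes_only sort_cuts s ?s'"
            using ch1 ch2 ch unfolding changes_only_def by (simp add: sort_cuts_def)
          show "length D = length L" using lenD n_def by simp
          show "t3 + 3 \<le> t + 20 + 7 * real (length L) + 24 * real (length L) * (1 + log 2 (real (length L)))"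
            using P1(2) t2 P(5) unfolding n_def by simp
          show "cuts_state ?s' D" unfolding cuts_state_def cut_points_def lenD
            using P val less fr3 aD inp2 unfolding inputs_def by (simp add: less_SucI)
        qed
        then show "wp ?c3 (wp ?c4 Q) s3 (t3 + 1)" by (simp add: fr3 add.commute)
      qed (use fr in simp_all)
      then show "?c1 s2 t2" by (simp add: add.commute)
    qed simp_all
  qed (auto simp: less_Suc_eq)
qed

text \<open>The basis is both marked and listed. The inverse \<open>pos\<close> of the list allows an exchange in constant time.\<close>

definition basis_state :: "state \<Rightarrow> nat set \<Rightarrow> bool" where
  "basis_state s B \<longleftrightarrow> marked M s ''inB'' = B \<and> nmem s ''k'' 0 = card B \<and>
     (\<forall>j<card B. nmem s ''bl'' j \<in> B \<and> nmem s ''pos'' (nmem s ''bl'' j) = j) \<and> (\<forall>e\<in>B. nmem s ''pos'' e < card B \<and> nmem s ''bl'' (nmem s ''pos'' e) = e)"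

text \<open>Elements are scanned in increasing order and replaced only by strictly lighter ones, so ties are
  resolved by the fixed ordering.\<close>

lemma wp_lightest_left:
  assumes inp: "inputs s" and X: "X \<noteq> {}" "X = {j. j < m \<and> nmem s ''done'' j = 0}"
    and Q: "\<And>s' t' x. changes_only lightest_left s s' \<Longrightarrow> nmem s' ''best'' 0 = x \<Longrightarrow> x \<in> X \<Longrightarrow>
      (\<And>y. y \<in> X \<Longrightarrow> y \<noteq> x \<Longrightarrow> precedes a b (rmem s ''mu'' 0) x y) \<Longrightarrow> t' \<le> t + 3 + 5 * real m \<Longrightarrow> Q s' t'"
  shows "wp lightest_left Q s t"
proof -
  let ?mu = "rmem s ''mu'' 0"
  let ?body = "Cond (BAnd (BNot (NLess (NConst 0) (NRead ''done'' (V ''j''))))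
                (BNot (BAnd (NLess (V ''best'') (V ''m''))
                  (BNot (RLess (w_at_mu (V ''j'')) (w_at_mu (V ''best'')))))))
         (''best'' ::= V ''j'') Skip"
  let ?s = "nwrite s ''best'' 0 m"
  have m: "nmem s ''m'' 0 = m" using inp by (simp add: inputs_def)
  define P where "P j s' t' \<longleftrightarrow> (\<exists>x. nmem s' ''best'' 0 = x \<and>
     (if x < m then x \<in> X \<and> x < j \<and> (\<forall>y\<in>X. y < j \<longrightarrow> y \<noteq> x \<longrightarrow> precedes a b ?mu x y) else \<forall>y\<in>X. \<not> y < j) \<and>
     t' \<le> t + 2 + 5 * real j)" for j :: nat and s' :: state and t' :: real
  have "wp (For ''j'' ''m'' ?body) Q ?s (t + 1)"
  proof (rule wp_For[where P = P])
    show "P 0 (nwrite ?s ''j'' 0 0) (t + 1 + 1)" unfolding P_def by simp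
  next
    fix j s' t' assume j: "j < nmem ?s ''m'' 0" "nmem s' ''j'' 0 = j"
      and ch: "changes_only (For ''j'' ''m'' ?body) ?s s'" and P: "P j s' t'"
    have jm: "j < m" using j m by simp
    have inp': "inputs s'" using inputs_changes_only[OF _ ch] inp by simp
    have fr: "nmem s' ''done'' = nmem s ''done''" "rmem s' ''mu'' = rmem s ''mu''" "nmem s' ''m'' 0 = m"
      using ch m by (simp_all add: changes_only_def)
    have w: "rval s' (w_at_mu i) = weight a b (nval s' i) ?mu" if "nval s' i < m" for i
      using inp' that fr unfolding w_at_mu_def weight_def inputs_def by simp
    obtain x where x: "nmem s' ''best'' 0 = x"
      "if x < m then x \<in> X \<and> x < j \<and> (\<forall>y\<in>X. y < j \<longrightarrow> y \<noteq> x \<longrightarrow> precedes a b ?mu x y) else \<forall>y\<in>X. \<not> y < j"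
      "t' \<le> t + 2 + 5 * real j" using P unfolding P_def by blast
    have jX: "j \<in> X \<longleftrightarrow> nmem s' ''done'' j = 0" using X(2) jm fr by simp
    consider (none) "j \<notin> X" | (first) "j \<in> X" "\<not> x < m"
      | (better) "j \<in> X" "x < m" "weight a b j ?mu < weight a b x ?mu"
      | (worse) "j \<in> X" "x < m" "weight a b x ?mu \<le> weight a b j ?mu" by fastforce
    then show "wp ?body (\<lambda>s'' t''. P (Suc j) (nwrite s'' ''j'' 0 (Suc j)) (t'' + 1)) s' (t' + 1)"
    proof cases
      case none
      then have "P (Suc j) (nwrite s' ''j'' 0 (Suc j)) (t' + 4)"
        using x unfolding P_def by (auto simp: less_Suc_eq split: if_splits)
      then show ?thesis using none jX j by (simp add: add.commute)
    next
      case first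
      then have "P (Suc j) (nwrite (nwrite s' ''best'' 0 j) ''j'' 0 (Suc j)) (t' + 4)"
        using x jm unfolding P_def by (auto simp: less_Suc_eq)
      then show ?thesis using first jX j x fr by (simp add: add.commute)
    next
      case better
      have "P (Suc j) (nwrite (nwrite s' ''best'' 0 j) ''j'' 0 (Suc j)) (t' + 4)"
        using x jm better unfolding P_def by (auto simp: less_Suc_eq precedes_def)
      then show ?thesis using better jX j x fr w jm by (simp add: add.commute)
    next
      case worse
      then have "precedes a b ?mu x j" using x(2) unfolding precedes_def by auto
      then have "P (Suc j) (nwrite s' ''j'' 0 (Suc j)) (t' + 4)"
        using x worse unfolding P_def by (auto simp: less_Suc_eq)
      then show ?thesis using worse jX j x fr w jm by (simp add: add.commute)
    qed
  next
    fix s' t' assume ch: "changes_only (For ''j'' ''m'' ?body) ?s s'" and "P (nmem ?s ''m'' 0) s' t'"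
    then have "P m s' t'" using m by simp
    then obtain x where x: "nmem s' ''best'' 0 = x"
      "if x < m then x \<in> X \<and> x < m \<and> (\<forall>y\<in>X. y < m \<longrightarrow> y \<noteq> x \<longrightarrow> precedes a b ?mu x y) else \<forall>y\<in>X. \<not> y < m"
      "t' \<le> t + 2 + 5 * real m" unfolding P_def by blast
    obtain y where y: "y \<in> X" using X(1) by blast
    then have "y < m" unfolding X(2) by simp
    then have "x < m" using x(2) y by (auto split: if_splits)
    show "Q s' (t' + 1)"
    proof (rule Q[OF _ x(1)])
      show "changes_only lightest_left s s'"
        using ch unfolding changes_only_def by (simp add: lightest_left_def)
      show "x \<in> X" "t' + 1 \<le> t + 3 + 5 * real m" using x \<open>x < m\<close> by auto
      show "precedes a b ?mu x y" if "y \<in> X" "y \<noteq> x" for y using x(2) \<open>x < m\<close> that X(2) by auto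
    qed
  qed simp_all
  then show ?thesis unfolding lightest_left_def using m by simp
qed

text \<open>The processed elements \<open>X\<close> precede all others, so the basis elements that precede a rejected element are already
  present when it is rejected.\<close>

lemma wp_greedy:
  assumes inp: "inputs s" and init: "nmem s ''k'' 0 = 0" "marked M s ''inB'' = {}" "marked M s ''done'' = {}"
    and Q: "\<And>s' t' B. changes_only greedy s s' \<Longrightarrow> basis_state s' B \<Longrightarrow> opt_basis M (rmem s ''mu'' 0) B \<Longrightarrow>
      t' \<le> t + 2 + real m * (20 + f m + 5 * real m) \<Longrightarrow> Q s' t'"
  shows "wp greedy Q s t"
proof -
  let ?mu = "rmem s ''mu'' 0"
  let ?ifc = "Cond (NLess (NConst 0) (V ''y''))
        (NAssign ''bl'' (V ''k'') (V ''best'');; NAssign ''pos'' (V ''best'') (V ''k'');; incr ''k'')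
        (NAssign ''inB'' (V ''best'') (NConst 0))"
  let ?body = "lightest_left;; NAssign ''done'' (V ''best'') (NConst (Suc 0));; NAssign ''inB'' (V ''best'') (NConst (Suc 0));;
       IndepTest ''inB'' ''y'';; ?ifc"
  have m: "nmem s ''m'' 0 = m" using inp by (simp add: inputs_def)
  define P where "P j s' t' \<longleftrightarrow> (\<exists>B X. basis_state s' B \<and> B \<in> F \<and> marked M s' ''done'' = X \<and> card X = j \<and> B \<subseteq> X \<and>
      (\<forall>x\<in>X. \<forall>y\<in>{..<m} - X. precedes a b ?mu x y) \<and>
      (\<forall>x\<in>X - B. insert x {y \<in> B. precedes a b ?mu y x} \<notin> F) \<and>
      t' \<le> t + 1 + real j * (20 + f m + 5 * real m))" for j :: nat and s' :: state and t' :: real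
  show ?thesis unfolding greedy_def
  proof (rule wp_For[where P = P])
    show "P 0 (nwrite s ''i'' 0 0) (t + 1)"
      unfolding P_def basis_state_def using init indep_empty by auto
  next
    fix j s' t' assume j: "j < nmem s ''m'' 0" "nmem s' ''i'' 0 = j"
      and ch: "changes_only (For ''i'' ''m'' ?body) s s'" and P: "P j s' t'"
    have jm: "j < m" using j m by simp
    have inp': "inputs s'" using inputs_changes_only[OF inp ch] by simp
    have mu': "rmem s' ''mu'' = rmem s ''mu''" using ch by (simp add: changes_only_def)
    obtain B X where BX: "basis_state s' B" "B \<in> F" "marked M s' ''done'' = X" "card X = j" "B \<subseteq> X"
      "\<And>x y. x \<in> X \<Longrightarrow> y < m \<Longrightarrow> y \<notin> X \<Longrightarrow> precedes a b ?mu x y"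
      "\<And>x. x \<in> X \<Longrightarrow> x \<notin> B \<Longrightarrow> insert x {y \<in> B. precedes a b ?mu y x} \<notin> F"
      "t' \<le> t + 1 + real j * (20 + f m + 5 * real m)"
      using P unfolding P_def by auto
    have Xm: "X \<subseteq> {..<m}" "finite X"
      using BX(3) ground_size_M unfolding marked_def by auto
    let ?Y = "{i. i < m \<and> nmem s' ''done'' i = 0}"
    have Y: "?Y = {..<m} - X" using BX(3) ground_size_M unfolding marked_def by auto
    have "?Y \<noteq> {}"
    proof
      assume "?Y = {}"
      then have "X = {..<m}" using Y Xm by auto
      then show False using BX(4) jm by simp
    qed
    then show "wp ?body (\<lambda>s'' t''. P (Suc j) (nwrite s'' ''i'' 0 (Suc j)) (t'' + 1)) s' (t' + 1)"
      unfolding wp_Seq[of lightest_left]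
    proof (rule wp_lightest_left[OF inp' _ refl])
      fix s1 t1 x
      assume ch1: "changes_only lightest_left s' s1" and best: "nmem s1 ''best'' 0 = x" and x: "x \<in> ?Y"
        and least: "\<And>y. y \<in> ?Y \<Longrightarrow> y \<noteq> x \<Longrightarrow> precedes a b (rmem s' ''mu'' 0) x y"
        and t1: "t1 \<le> t' + 1 + 3 + 5 * real m"
      have xX: "x < m" "x \<notin> X" using x Y by auto
      have xB: "x \<notin> B" using xX BX(5) by auto
      have fr: "nmem s1 ''inB'' = nmem s' ''inB''" "nmem s1 ''done'' = nmem s' ''done''" "nmem s1 ''k'' 0 = card B"
          "nmem s1 ''bl'' = nmem s' ''bl''" "nmem s1 ''pos'' = nmem s' ''pos''"
        using ch1 BX(1) unfolding basis_state_def by (simp_all add: changes_only_def)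
      have mk: "marked M s1 ''inB'' = B" "marked M s1 ''done'' = X"
        using marked_cong[OF fr(1)] marked_cong[OF fr(2)] BX(1,3) unfolding basis_state_def by simp_all
      have card': "card (insert x X) = Suc j" using xX(2) Xm(2) BX(4) by simp
      have prec': "precedes a b ?mu z y" if "z \<in> insert x X" "y < m" "y \<notin> insert x X" for z y
        using that BX(6)[of z y] least[of y] Y mu' by auto
      have not_prec: "\<not> precedes a b ?mu x z" if "z \<in> X" for z
        using BX(6)[OF that xX] unfolding precedes_def by auto
      have finB: "finite B" by (rule indep_finite[OF BX(2)])
      have time: "t1 + 3 + f m + 5 \<le> t + 1 + real (Suc j) * (20 + f m + 5 * real m)"
        using t1 BX(8) by (simp add: algebra_simps)
      let ?s = "nwrite (nwrite (nwrite s1 ''done'' x (Suc 0)) ''inB'' x (Suc 0)) ''y'' 0 (of_bool (insert x B \<in> F))"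
      have "wp ?ifc (\<lambda>s'' t''. P (Suc j) (nwrite s'' ''i'' 0 (Suc j)) (t'' + 1)) ?s (t1 + 2 + f m)"
      proof (cases "insert x B \<in> F")
        case True
        let ?s' = "nwrite (nwrite (nwrite (nwrite ?s ''bl'' (card B) x) ''pos'' x (card B)) ''k'' 0 (Suc (card B))) ''i'' 0 (Suc j)"
        have "basis_state ?s' (insert x B)" unfolding basis_state_def
          using BX(1) fr mk xB finB xX unfolding basis_state_def by (auto simp: less_Suc_eq ground_size_M)
        moreover have "marked M ?s' ''done'' = insert x X" using mk xX by (simp add: ground_size_M)
        moreover have "insert z {y \<in> insert x B. precedes a b ?mu y z} \<notin> F" if z: "z \<in> insert x X - insert x B" for z
        proof -
          have "{y \<in> insert x B. precedes a b ?mu y z} = {y \<in> B. precedes a b ?mu y z}"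
            using not_prec[of z] z by auto
          then show ?thesis using BX(7)[of z] z by auto
        qed
        ultimately have "P (Suc j) ?s' (t1 + 2 + f m + 5)" unfolding P_def
          using True card' prec' BX(5) time by (intro exI[of _ "insert x B"] exI[of _ "insert x X"]) auto
        then show ?thesis using True best fr(3) by (simp add: add.commute)
      next
        case False
        let ?s' = "nwrite (nwrite ?s ''inB'' x 0) ''i'' 0 (Suc j)"
        have "basis_state ?s' B" unfolding basis_state_def
          using BX(1) fr mk xB xX unfolding basis_state_def by (auto simp: ground_size_M)
        moreover have "marked M ?s' ''done'' = insert x X" using mk xX by (simp add: ground_size_M)
        moreover have "insert z {y \<in> B. precedes a b ?mu y z} \<notin> F" if z: "z \<in> insert x X - B" for z
        proof (cases "z = x")
          case True
          have "{y \<in> B. precedes a b ?mu y x} = B" using BX(5,6) xX by auto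
          then show ?thesis using False True by simp
        next
          case False
          then show ?thesis using BX(7)[of z] z by auto
        qed
        ultimately have "P (Suc j) ?s' (t1 + 2 + f m + 3)" unfolding P_def
          using BX(2,5) card' prec' time by (intro exI[of _ B] exI[of _ "insert x X"]) auto
        then show ?thesis using False best by (simp add: add.commute)
      qed
      then show "wp (NAssign ''done'' (V ''best'') (NConst (Suc 0));; NAssign ''inB'' (V ''best'') (NConst (Suc 0));;
         IndepTest ''inB'' ''y'';; ?ifc) (\<lambda>s'' t''. P (Suc j) (nwrite s'' ''i'' 0 (Suc j)) (t'' + 1)) s1 t1"
        using best mk xX by (simp add: ground_size_M indep_sets_M add.commute add.left_commute del: wp_Cond)
    qed
  next
    fix s' t' assume ch: "changes_only (For ''i'' ''m'' ?body) s s'" and "P (nmem s ''m'' 0) s' t'"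
    then have "P m s' t'" using m by simp
    then obtain B X where BX: "basis_state s' B" "B \<in> F" "marked M s' ''done'' = X" "card X = m"
      "\<forall>x\<in>X - B. insert x {y \<in> B. precedes a b ?mu y x} \<notin> F"
      "t' \<le> t + 1 + real m * (20 + f m + 5 * real m)" unfolding P_def by blast
    have "X \<subseteq> {..<m}" using BX(3) ground_size_M unfolding marked_def by auto
    then have "X = {..<m}" using BX(4) card_subset_eq[of "{..<m}" X] by simp
    then have "opt_basis M ?mu B" using BX(2,5) by (intro greedy_opt_basis) auto
    then show "Q s' (t' + 1)" using BX ch by (intro Q) (auto simp: greedy_def)
  qed simp_all
qed

lemma wp_swap:
  assumes B: "basis_state s B" and r: "nmem s ''ce'' (nmem s ''ord'' (nmem s ''r'' 0)) = e"
      "nmem s ''cf'' (nmem s ''ord'' (nmem s ''r'' 0)) = g" "e < m" "g < m"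
    and Q: "\<And>s' t'. changes_only swap s s' \<Longrightarrow>
      basis_state s' (if e \<in> B \<and> g \<notin> B \<and> insert g (B - {e}) \<in> F then insert g (B - {e}) else B) \<Longrightarrow>
      t' \<le> t + 10 + f m \<Longrightarrow> Q s' t'"
  shows "wp swap Q s t"
proof -
  let ?B = "insert g (B - {e})"
  have mk: "marked M s ''inB'' = B" using B by (simp add: basis_state_def)
  have iff: "0 < nmem s ''inB'' e \<longleftrightarrow> e \<in> B" "0 < nmem s ''inB'' g \<longleftrightarrow> g \<in> B"
    using r unfolding mk[symmetric] marked_def ground_size_M by auto
  let ?s = "nwrite (nwrite s ''g'' 0 e) ''f'' 0 g"
  have gf: "changes_only swap s ?s" "basis_state ?s B"
    using B unfolding changes_only_def basis_state_def by (simp_all add: swap_def)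
  show ?thesis
  proof (cases "e \<in> B \<and> g \<notin> B")
    case False
    then have "Q ?s (t + 4)" using gf costs by (intro Q) auto
    then show ?thesis using False iff r unfolding swap_def by (auto simp: add.commute)
  next
    case eg: True
    then have ne: "e \<noteq> g" by auto
    have mk': "marked M (nwrite (nwrite ?s ''inB'' e 0) ''inB'' g (Suc 0)) ''inB'' = ?B"
      using mk r eg by (simp add: ground_size_M)
    show ?thesis
    proof (cases "?B \<in> F")
      case True
      define p where "p = nmem s ''pos'' e"
      let ?s' = "nwrite (nwrite (nwrite (nwrite (nwrite ?s ''inB'' e 0) ''inB'' g (Suc 0)) ''y'' 0 (Suc 0))
        ''pos'' g p) ''bl'' p g"
      have finB: "finite B" using mk unfolding marked_def by auto
      have card: "card ?B = card B" using eg finB card_Suc_Diff1[of B e] by simp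
      have p: "p < card B" "nmem s ''bl'' p = e" using B eg unfolding basis_state_def p_def by auto
      have pos: "nmem s ''pos'' z < card B" "nmem s ''bl'' (nmem s ''pos'' z) = z" if "z \<in> B" for z
        using B that unfolding basis_state_def by auto
      have bl: "nmem s ''bl'' j \<in> B" "nmem s ''pos'' (nmem s ''bl'' j) = j" if "j < card B" for j using B that unfolding basis_state_def by auto
      have bl_e: "nmem s ''bl'' j \<noteq> e" if "j < card B" "j \<noteq> p" for j
        using bl(2)[OF that(1)] that(2) unfolding p_def by auto
      have pos_p: "nmem s ''pos'' z \<noteq> p" if "z \<in> B" "z \<noteq> e" for z
        using pos(2)[OF that(1)] p(2) that(2) by auto
      have "nmem s ''k'' 0 = card B" using B by (simp add: basis_state_def)
      moreover have "marked M ?s' ''inB'' = ?B" using mk' by simp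
      moreover have "nmem ?s' ''bl'' j \<in> ?B \<and> nmem ?s' ''pos'' (nmem ?s' ''bl'' j) = j" if "j < card B" for j
        using bl[OF that] bl_e[OF that] eg by (cases "j = p") auto
      moreover have "nmem ?s' ''pos'' z < card B \<and> nmem ?s' ''bl'' (nmem ?s' ''pos'' z) = z" if "z \<in> ?B" for z
        using that pos pos_p p eg by (cases "z = g") auto
      ultimately have "basis_state ?s' ?B" unfolding basis_state_def card by simp
      moreover have "changes_only swap s ?s'" unfolding changes_only_def by (simp add: swap_def)
      ultimately have "Q ?s' u" if "u \<le> t + 10 + f m" for u using True eg that by (intro Q) auto
      then show ?thesis using True eg iff r ne mk unfolding swap_def
        by (simp add: ground_size_M indep_sets_M p_def)
    next
      case False
      let ?s' = "nwrite (nwrite (nwrite (nwrite (nwrite ?s ''inB'' e 0) ''inB'' g (Suc 0)) ''y'' 0 0)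
        ''inB'' e (Suc 0)) ''inB'' g 0"
      have "insert e ?B - {g} = B" using eg by auto
      then have "marked M ?s' ''inB'' = B" using mk mk' r by (simp add: ground_size_M)
      then have "basis_state ?s' B" using B unfolding basis_state_def by simp
      moreover have "changes_only swap s ?s'" unfolding changes_only_def by (simp add: swap_def)
      ultimately have "Q ?s' u" if "u \<le> t + 10 + f m" for u using False eg that by (intro Q) auto
      then show ?thesis using False eg iff r ne mk unfolding swap_def
        by (simp add: ground_size_M indep_sets_M)
    qed
  qed
qed

end


section \<open>Upper envelopes of lines\<close>

definition line :: "(nat \<Rightarrow> real) \<Rightarrow> (nat \<Rightarrow> real) \<Rightarrow> nat \<Rightarrow> real \<Rightarrow> real" where
  "line c d j x = c j + x * d j"

text \<open>The lines \<open>K 0, \<dots>, K (p - 1)\<close> have increasing slopes; for \<open>i > 0\<close>, the line \<open>K i\<close> takes over from its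
  predecessor at \<open>st i\<close>, and these points increase, too.\<close>

definition upper_stack ::
    "(nat \<Rightarrow> real) \<Rightarrow> (nat \<Rightarrow> real) \<Rightarrow> nat set \<Rightarrow> nat \<Rightarrow> (nat \<Rightarrow> nat) \<Rightarrow> (nat \<Rightarrow> real) \<Rightarrow> bool" where
  "upper_stack c d T p K st \<longleftrightarrow> (\<forall>i<p. K i \<in> T) \<and>
     (\<forall>i. Suc i < p \<longrightarrow> d (K i) < d (K (Suc i)) \<and> line c d (K i) (st (Suc i)) = line c d (K (Suc i)) (st (Suc i))) \<and>
     (\<forall>i. Suc (Suc i) < p \<longrightarrow> st (Suc i) < st (Suc (Suc i)))"

lemma line_le_right:
  "line c d i s \<le> line c d j s \<Longrightarrow> d i \<le> d j \<Longrightarrow> s \<le> x \<Longrightarrow> line c d i x \<le> line c d j x"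
proof -
  assume *: "line c d i s \<le> line c d j s" "d i \<le> d j" "s \<le> x"
  have "(x - s) * d i \<le> (x - s) * d j" using * by (intro mult_left_mono) auto
  then show ?thesis using *(1) unfolding line_def by (simp add: algebra_simps)
qed

lemma line_le_left:
  "line c d i s \<le> line c d j s \<Longrightarrow> d j \<le> d i \<Longrightarrow> x \<le> s \<Longrightarrow> line c d i x \<le> line c d j x"
proof -
  assume *: "line c d i s \<le> line c d j s" "d j \<le> d i" "x \<le> s"
  have "(s - x) * d j \<le> (s - x) * d i" using * by (intro mult_left_mono) auto
  then show ?thesis using *(1) unfolding line_def by (simp add: algebra_simps)
qed

lemma upper_stack_starts_mono:
  assumes "upper_stack c d T p K st" "0 < i" "i \<le> j" "j < p"
  shows "st i \<le> st j"
  using assms(3,4)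
proof (induction j rule: dec_induct)
  case (step j)
  then obtain q where "j = Suc q" using assms(2) by (cases j) auto
  then have "st j < st (Suc j)" using assms(1) step unfolding upper_stack_def by auto
  then show ?case using step by simp
qed simp

text \<open>From one line to the next towards \<open>i\<close>, the value at \<open>x\<close> does not decrease, since \<open>x\<close> lies on the side of the
  takeover point on which the line closer to \<open>i\<close> is higher.\<close>

lemma upper_stack_piece:
  assumes S: "upper_stack c d T p K st" and ij: "i < p" "j < p"
    and x: "0 < i \<Longrightarrow> st i \<le> x" "Suc i < p \<Longrightarrow> x \<le> st (Suc i)"
  shows "line c d (K j) x \<le> line c d (K i) x"
proof (cases "j \<le> i")
  case True
  then show ?thesis
  proof (induction j rule: inc_induct)
    case (step q)
    have q: "Suc q < p" "d (K q) < d (K (Suc q))"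
      "line c d (K q) (st (Suc q)) = line c d (K (Suc q)) (st (Suc q))"
      using S step ij unfolding upper_stack_def by auto
    have "st (Suc q) \<le> x" using upper_stack_starts_mono[OF S, of "Suc q" i] step ij x(1) by simp
    then have "line c d (K q) x \<le> line c d (K (Suc q)) x"
      by (rule line_le_right[OF eq_refl[OF q(3)] less_imp_le[OF q(2)]])
    then show ?case using step by simp
  qed simp
next
  case False
  then have "i \<le> j" by simp
  then show ?thesis using ij(2)
  proof (induction j rule: dec_induct)
    case (step q)
    have q: "d (K q) < d (K (Suc q))" "line c d (K q) (st (Suc q)) = line c d (K (Suc q)) (st (Suc q))"
      using S step unfolding upper_stack_def by auto
    have xs: "x \<le> st (Suc q)"
      using upper_stack_starts_mono[OF S, of "Suc i" "Suc q"] step x(2) by simp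
    have "line c d (K (Suc q)) x \<le> line c d (K q) x"
      by (rule line_le_left[OF eq_refl[OF q(2)[symmetric]] less_imp_le[OF q(1)] xs])
    then show ?case using step by simp
  qed simp
qed

text \<open>While \<open>g\<close> is being inserted, a line that has been removed is at each point below \<open>g\<close> or below a
  line that is still on the stack.\<close>

definition covered ::
    "(nat \<Rightarrow> real) \<Rightarrow> (nat \<Rightarrow> real) \<Rightarrow> nat set \<Rightarrow> nat \<Rightarrow> (nat \<Rightarrow> nat) \<Rightarrow> nat \<Rightarrow> bool" where
  "covered c d T p K g \<longleftrightarrow>
     (\<forall>j\<in>T. \<forall>x. (\<exists>i<p. line c d j x \<le> line c d (K i) x) \<or> line c d j x \<le> line c d g x)"

definition covered_by ::
    "(nat \<Rightarrow> real) \<Rightarrow> (nat \<Rightarrow> real) \<Rightarrow> nat set \<Rightarrow> nat \<Rightarrow> (nat \<Rightarrow> nat) \<Rightarrow> bool" where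
  "covered_by c d T p K \<longleftrightarrow> (\<forall>j\<in>T. \<forall>x. \<exists>i<p. line c d j x \<le> line c d (K i) x)"

definition steeper_or_higher :: "(nat \<Rightarrow> real) \<Rightarrow> (nat \<Rightarrow> real) \<Rightarrow> nat \<Rightarrow> nat \<Rightarrow> bool" where
  "steeper_or_higher c d i g \<longleftrightarrow> d i < d g \<or> d i = d g \<and> c i < c g"

text \<open>The top line is removed if \<open>g\<close> is not below it where it takes over: from there on, \<open>g\<close> is at
  least as high, and before, the line below it on the stack is.\<close>

definition pops :: "(nat \<Rightarrow> real) \<Rightarrow> (nat \<Rightarrow> real) \<Rightarrow> nat \<Rightarrow> (nat \<Rightarrow> nat) \<Rightarrow> (nat \<Rightarrow> real) \<Rightarrow> nat \<Rightarrow> bool" where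
  "pops c d p K st g \<longleftrightarrow> 0 < p \<and> (if p = 1 then \<not> d (K 0) < d g
     else \<not> line c d g (st (p - 1)) < line c d (K (p - 1)) (st (p - 1)))"

lemma pop_stack:
  assumes S: "upper_stack c d T p K st" and C: "covered c d T p K g"
    and g: "steeper_or_higher c d (K (p - 1)) g" and pop: "pops c d p K st g"
  shows "upper_stack c d T (p - 1) K st" "covered c d T (p - 1) K g"
    "p - 1 \<noteq> 0 \<Longrightarrow> steeper_or_higher c d (K (p - 1 - 1)) g"
proof -
  show "upper_stack c d T (p - 1) K st" using S unfolding upper_stack_def by auto
  have p: "0 < p" using pop by (simp add: pops_def)
  have dg: "d (K (p - 1)) \<le> d g" using g unfolding steeper_or_higher_def by auto
  have below: "(\<exists>i<p - 1. line c d (K (p - 1)) x \<le> line c d (K i) x) \<or> line c d (K (p - 1)) x \<le> line c d g x" for x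
  proof (cases "p = 1")
    case True
    then have "d (K 0) = d g" "c (K 0) < c g" using pop g unfolding pops_def steeper_or_higher_def by auto
    then show ?thesis using True by (simp add: line_def)
  next
    case False
    then obtain q where q: "p = Suc (Suc q)" using p by (metis One_nat_def not0_implies_Suc not_gr0)
    let ?s = "st (Suc q)"
    show ?thesis
    proof (cases "?s \<le> x")
      case True
      have "line c d (K (p - 1)) ?s \<le> line c d g ?s" using pop q unfolding pops_def by auto
      then show ?thesis using line_le_right[OF _ dg True] by blast
    next
      case x: False
      have Kq: "d (K q) < d (K (Suc q))" "line c d (K (Suc q)) ?s \<le> line c d (K q) ?s"
        using S q unfolding upper_stack_def by auto
      have "x \<le> ?s" using x by simp
      then have "line c d (K (Suc q)) x \<le> line c d (K q) x" by (rule line_le_left[OF Kq(2) less_imp_le[OF Kq(1)]])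
      then show ?thesis using q by auto
    qed
  qed
  show "covered c d T (p - 1) K g" unfolding covered_def
  proof (intro ballI allI)
    fix j x assume "j \<in> T"
    then consider i where "i < p" "line c d j x \<le> line c d (K i) x" | "line c d j x \<le> line c d g x"
      using C unfolding covered_def by blast
    then show "(\<exists>i<p - 1. line c d j x \<le> line c d (K i) x) \<or> line c d j x \<le> line c d g x"
    proof cases
      case 1
      show ?thesis
      proof (cases "i = p - 1")
        case True
        then show ?thesis using 1 below[of x] by (meson order_trans)
      next
        case False
        then show ?thesis using 1 p by (intro disjI1 exI[of _ i]) auto
      qed
    qed simp
  qed
  show "steeper_or_higher c d (K (p - 1 - 1)) g" if "p - 1 \<noteq> 0"
  proof -
    have "p = Suc (Suc (p - 2))" using that by simp
    then obtain q where q: "p = Suc (Suc q)" by blast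
    then have "d (K q) < d (K (Suc q))" using S unfolding upper_stack_def by auto
    then show ?thesis using dg q unfolding steeper_or_higher_def by auto
  qed
qed

definition takeover :: "(nat \<Rightarrow> real) \<Rightarrow> (nat \<Rightarrow> real) \<Rightarrow> nat \<Rightarrow> nat \<Rightarrow> real" where
  "takeover c d i g = (c i - c g) / (d g - d i)"

text \<open>When no more line is removed, \<open>g\<close> is strictly steeper than the top line and still below it at its start, so it
  takes over later.\<close>

lemma push_stack:
  assumes S: "upper_stack c d T p K st" and C: "covered c d T p K g"
    and g: "p \<noteq> 0 \<Longrightarrow> steeper_or_higher c d (K (p - 1)) g" and pop: "\<not> pops c d p K st g"
    and K': "K' = K(p := g)" and st': "\<And>i. i < p \<Longrightarrow> st' i = st i" "p \<noteq> 0 \<Longrightarrow> st' p = takeover c d (K (p - 1)) g"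
  shows "upper_stack c d (insert g T) (Suc p) K' st'" "covered_by c d (insert g T) (Suc p) K'"
proof -
  have dlt: "d (K (p - 1)) < d g" if "p \<noteq> 0"
  proof (rule ccontr)
    assume n: "\<not> ?thesis"
    then have eq: "d (K (p - 1)) = d g" "c (K (p - 1)) < c g" using g[OF that] unfolding steeper_or_higher_def by auto
    then have "line c d (K (p - 1)) x < line c d g x" for x unfolding line_def by simp
    then have "\<not> line c d g x < line c d (K (p - 1)) x" for x by (metis less_asym)
    then show False using pop that n unfolding pops_def by (auto split: if_splits)
  qed
  have eq: "line c d (K (p - 1)) (st' p) = line c d g (st' p)" if "p \<noteq> 0"
    using dlt[OF that] st'(2)[OF that] unfolding line_def takeover_def by (simp add: field_simps)
  have gt: "st q < st' p" if q: "p = Suc q" "0 < q" for q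
  proof (rule ccontr)
    assume "\<not> ?thesis"
    then have le: "st' p \<le> st q" by simp
    have "line c d (K q) (st' p) \<le> line c d g (st' p)" using eq q by simp
    then have "line c d (K q) (st q) \<le> line c d g (st q)"
      using line_le_right[of c d "K q" "st' p" g "st q"] le dlt q by simp
    then show False using pop q unfolding pops_def by auto
  qed
  show "upper_stack c d (insert g T) (Suc p) K' st'" unfolding upper_stack_def K'
  proof (intro conjI allI impI)
    show "(K(p := g)) i \<in> insert g T" if "i < Suc p" for i
      using that S unfolding upper_stack_def by (auto simp: less_Suc_eq)
    fix i assume i: "Suc i < Suc p"
    have "d ((K(p := g)) i) < d ((K(p := g)) (Suc i)) \<and>
       line c d ((K(p := g)) i) (st' (Suc i)) = line c d ((K(p := g)) (Suc i)) (st' (Suc i))"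
    proof (cases "Suc i = p")
      case True
      then show ?thesis using dlt eq by auto
    next
      case False
      then show ?thesis using i S st'(1)[of "Suc i"] unfolding upper_stack_def by auto
    qed
    then show "d ((K(p := g)) i) < d ((K(p := g)) (Suc i))"
      "line c d ((K(p := g)) i) (st' (Suc i)) = line c d ((K(p := g)) (Suc i)) (st' (Suc i))" by auto
  next
    fix i assume i: "Suc (Suc i) < Suc p"
    show "st' (Suc i) < st' (Suc (Suc i))"
    proof (cases "Suc (Suc i) = p")
      case True
      then show ?thesis using gt[of "Suc i"] st'(1)[of "Suc i"] by simp
    next
      case False
      then show ?thesis using i S st'(1)[of "Suc i"] st'(1)[of "Suc (Suc i)"] unfolding upper_stack_def by auto
    qed
  qed
  show "covered_by c d (insert g T) (Suc p) K'" unfolding covered_by_def K'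
  proof (intro ballI allI)
    fix j x assume "j \<in> insert g T"
    then consider "line c d j x \<le> line c d g x" | i where "i < p" "line c d j x \<le> line c d (K i) x"
      using C unfolding covered_def by blast
    then show "\<exists>i<Suc p. line c d j x \<le> line c d ((K(p := g)) i) x"
    proof cases
      case 1
      then show ?thesis by (intro exI[of _ p]) simp
    next
      case 2
      then show ?thesis by (intro exI[of _ i]) auto
    qed
  qed
qed

section \<open>The values on one region\<close>

text \<open>The line \<open>j\<close> is the weight of the basis in which the \<open>j\<close>th element has been replaced.\<close>

definition basis_lines :: com where
  "basis_lines =
     (''A'' ::=r RConst 0;; ''S'' ::=r RConst 0;;
      For ''j'' ''k''
       (''A'' ::=r RAdd (RV ''A'') (RRead ''a'' (NRead ''bl'' (V ''j'')));;
        ''S'' ::=r RAdd (RV ''S'') (RRead ''b'' (NRead ''bl'' (V ''j''))));;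
      For ''j'' ''k''
       (RAssign ''li'' (V ''j'') (RAdd (RSub (RV ''A'') (RRead ''a'' (NRead ''bl'' (V ''j''))))
          (RRead ''a'' (NRead ''rep'' (NRead ''bl'' (V ''j'')))));;
        RAssign ''ls'' (V ''j'') (RAdd (RSub (RV ''S'') (RRead ''b'' (NRead ''bl'' (V ''j''))))
          (RRead ''b'' (NRead ''rep'' (NRead ''bl'' (V ''j'')))));;
        NAssign ''lord'' (V ''j'') (V ''j'')))"

abbreviation top :: nexp where "top \<equiv> NRead ''stk'' (NSub (V ''p'') (NConst (Suc 0)))"
abbreviation st_top :: rexp where "st_top \<equiv> RRead ''st'' (NSub (V ''p'') (NConst (Suc 0)))"
abbreviation line_at :: "nexp \<Rightarrow> rexp \<Rightarrow> rexp" where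
  "line_at i x \<equiv> RAdd (RRead ''li'' i) (RMul x (RRead ''ls'' i))"

definition pop_test :: bexp where
  "pop_test = BAnd (NLess (NConst 0) (V ''p''))
     (BNot (BAnd
       (BNot (BAnd (BNot (NLess (NConst (Suc 0)) (V ''p'')))
          (BNot (RLess (RRead ''ls'' top) (RRead ''ls'' (V ''g''))))))
       (BNot (BAnd (NLess (NConst (Suc 0)) (V ''p''))
          (BNot (RLess (line_at (V ''g'') st_top) (line_at top st_top)))))))"

definition dominated_test :: bexp where
  "dominated_test = BAnd (NLess (NConst 0) (V ''p''))
     (BAnd (BNot (RLess (RRead ''ls'' top) (RRead ''ls'' (V ''g''))))
           (BNot (RLess (RRead ''li'' top) (RRead ''li'' (V ''g'')))))"

text \<open>Lines arrive in order of increasing slope. A line that is parallel to the top line and not higher is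
  dropped, so that the slopes on the stack differ and the division is by a positive number.\<close>

definition insert_line :: com where
  "insert_line =
     (''g'' ::= NRead ''lord'' (V ''i'');;
      Cond dominated_test Skip
       (While pop_test (''p'' ::= NSub (V ''p'') (NConst (Suc 0)));;
        Cond (NLess (NConst 0) (V ''p''))
         (RAssign ''st'' (V ''p'') (RDiv (RSub (RRead ''li'' top) (RRead ''li'' (V ''g'')))
            (RSub (RRead ''ls'' (V ''g'')) (RRead ''ls'' top))))
         Skip;;
        NAssign ''stk'' (V ''p'') (V ''g'');; incr ''p''))"

definition envelope :: com where
  "envelope = (''p'' ::= NConst 0;; For ''i'' ''k'' insert_line)"

definition write_piece :: "nexp \<Rightarrow> com" where
  "write_piece i =
     (NAssign ''vital'' (V ''n'') (NRead ''bl'' (NRead ''stk'' i));;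
      RAssign ''icpt'' (V ''n'') (RRead ''li'' (NRead ''stk'' i));;
      RAssign ''slope'' (V ''n'') (RRead ''ls'' (NRead ''stk'' i)))"

abbreviation next_i :: nexp where "next_i \<equiv> NAdd (V ''i'') (NConst (Suc 0))"

text \<open>The envelope is computed on the whole real line. Of its breakpoints, only those inside the region are emitted;
  a piece that ends before the region begins is overwritten by the next one.\<close>

definition emit_piece :: com where
  "emit_piece =
     Cond (BNot (BAnd (NLess (NConst 0) (NRead ''cutf'' next_r))
            (BNot (RLess (RRead ''st'' next_i) (RRead ''cut'' next_r)))))
      (Cond (BNot (BAnd (NLess (NConst 0) (NRead ''cutf'' (V ''r'')))
              (BNot (RLess (RRead ''cut'' (V ''r'')) (RRead ''st'' next_i)))))
        (RAssign ''bp'' (V ''n'') (RRead ''st'' next_i);; incr ''n'') Skip;;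
       write_piece next_i)
      Skip"

definition emit :: com where
  "emit = (write_piece (NConst 0);; ''p'' ::= NSub (V ''p'') (NConst (Suc 0));; For ''i'' ''p'' emit_piece)"

lemma writes_envelope [simp]:
  "nwrites basis_lines = {''j'', ''lord''}" "rwrites basis_lines = {''A'', ''S'', ''li'', ''ls''}"
  "nwrites insert_line = {''g'', ''p'', ''stk''}" "rwrites insert_line = {''st''}"
  "nwrites envelope = {''p'', ''i'', ''g'', ''stk''}" "rwrites envelope = {''st''}"
  "nwrites (write_piece i) = {''vital''}" "rwrites (write_piece i) = {''icpt'', ''slope''}"
  "nwrites emit_piece = {''n'', ''vital''}" "rwrites emit_piece = {''bp'', ''icpt'', ''slope''}"
  "nwrites emit = {''vital'', ''p'', ''i'', ''n''}" "rwrites emit = {''bp'', ''icpt'', ''slope''}"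
  by (auto simp: basis_lines_def insert_line_def envelope_def write_piece_def emit_piece_def emit_def)

context interdiction_machine
begin

lemma wp_basis_lines:
  assumes inp: "inputs s" and B: "basis_state s B" "B \<subseteq> {..<m}"
    and rep: "\<And>e. e \<in> B \<Longrightarrow> nmem s ''rep'' e < m"
    and Q: "\<And>s' t'. changes_only basis_lines s s' \<Longrightarrow>
      (\<And>j l. j < card B \<Longrightarrow> line (rmem s' ''li'') (rmem s' ''ls'') j l =
         set_weight a b B l - weight a b (nmem s ''bl'' j) l + weight a b (nmem s ''rep'' (nmem s ''bl'' j)) l) \<Longrightarrow>
      (\<And>j. j < card B \<Longrightarrow> nmem s' ''lord'' j = j) \<Longrightarrow> t' \<le> t + 6 + 9 * real (card B) \<Longrightarrow> Q s' t'"
  shows "wp basis_lines Q s t"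
proof -
  define bl where "bl = nmem s ''bl''"
  define rp where "rp = nmem s ''rep''"
  let ?n = "card B"
  have k: "nmem s ''k'' 0 = ?n" using B by (simp add: basis_state_def)
  have blB: "bl j \<in> B" if "j < ?n" for j using B that by (simp add: basis_state_def bl_def)
  then have blm: "bl j < m" if "j < ?n" for j using B(2) that by auto
  have inj: "inj_on bl {..<?n}"
    using B by (intro inj_on_inverseI[where g = "nmem s ''pos''"]) (simp add: basis_state_def bl_def)
  have "bl ` {..<?n} = B"
  proof
    show "B \<subseteq> bl ` {..<?n}"
    proof
      fix e assume "e \<in> B"
      then have "nmem s ''pos'' e < ?n" "bl (nmem s ''pos'' e) = e" using B by (simp_all add: basis_state_def bl_def)
      then show "e \<in> bl ` {..<?n}" by (metis imageI lessThan_iff)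
    qed
  qed (use blB in auto)
  then have sum_bl: "(\<Sum>i<?n. h (bl i)) = (\<Sum>e\<in>B. h e)" for h :: "nat \<Rightarrow> real"
    using sum.reindex[OF inj, of h] by simp
  have ab: "rmem s ''a'' i = of_rat (a i)" "rmem s ''b'' i = of_rat (b i)" if "i < m" for i
    using inp that by (auto simp: inputs_def)
  let ?body1 = "''A'' ::=r RAdd (RV ''A'') (RRead ''a'' (NRead ''bl'' (V ''j'')));;
        ''S'' ::=r RAdd (RV ''S'') (RRead ''b'' (NRead ''bl'' (V ''j'')))"
  let ?body2 = "RAssign ''li'' (V ''j'') (RAdd (RSub (RV ''A'') (RRead ''a'' (NRead ''bl'' (V ''j''))))
          (RRead ''a'' (NRead ''rep'' (NRead ''bl'' (V ''j'')))));;
        RAssign ''ls'' (V ''j'') (RAdd (RSub (RV ''S'') (RRead ''b'' (NRead ''bl'' (V ''j''))))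
          (RRead ''b'' (NRead ''rep'' (NRead ''bl'' (V ''j'')))));;
        NAssign ''lord'' (V ''j'') (V ''j'')"
  let ?s = "rwrite (rwrite s ''A'' 0 0) ''S'' 0 0"
  define SA where "SA = (\<Sum>e\<in>B. of_rat (a e) :: real)"
  define SB where "SB = (\<Sum>e\<in>B. of_rat (b e) :: real)"
  have "wp (For ''j'' ''k'' ?body1) (wp (For ''j'' ''k'' ?body2) Q) ?s (t + 2)"
  proof (rule wp_For[where P = "\<lambda>j s' t'. rmem s' ''A'' 0 = (\<Sum>i<j. of_rat (a (bl i))) \<and>
      rmem s' ''S'' 0 = (\<Sum>i<j. of_rat (b (bl i))) \<and> t' \<le> t + 3 + 4 * real j"])
    fix j s' t' assume j: "j < nmem ?s ''k'' 0" "nmem s' ''j'' 0 = j" and ch: "changes_only (For ''j'' ''k'' ?body1) ?s s'"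
      and P: "rmem s' ''A'' 0 = (\<Sum>i<j. of_rat (a (bl i))) \<and> rmem s' ''S'' 0 = (\<Sum>i<j. of_rat (b (bl i))) \<and> t' \<le> t + 3 + 4 * real j"
    have "nmem s' ''bl'' = bl" "rmem s' ''a'' = rmem s ''a''" "rmem s' ''b'' = rmem s ''b''"
      using ch by (simp_all add: changes_only_def bl_def)
    then show "wp ?body1 (\<lambda>s'' t''. rmem (nwrite s'' ''j'' 0 (Suc j)) ''A'' 0 = (\<Sum>i<Suc j. of_rat (a (bl i))) \<and>
      rmem (nwrite s'' ''j'' 0 (Suc j)) ''S'' 0 = (\<Sum>i<Suc j. of_rat (b (bl i))) \<and> t'' + 1 \<le> t + 3 + 4 * real (Suc j)) s' (t' + 1)"
      using P j ab[OF blm[of j]] k by simp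
  next
    fix s1 t1 assume ch1: "changes_only (For ''j'' ''k'' ?body1) ?s s1"
      and P1: "rmem s1 ''A'' 0 = (\<Sum>i<nmem ?s ''k'' 0. of_rat (a (bl i))) \<and>
      rmem s1 ''S'' 0 = (\<Sum>i<nmem ?s ''k'' 0. of_rat (b (bl i))) \<and> t1 \<le> t + 3 + 4 * real (nmem ?s ''k'' 0)"
    have AS: "rmem s1 ''A'' 0 = SA" "rmem s1 ''S'' 0 = SB" and t1: "t1 \<le> t + 3 + 4 * real ?n"
      using P1 k sum_bl[of "\<lambda>i. of_rat (a i)"] sum_bl[of "\<lambda>i. of_rat (b i)"] unfolding SA_def SB_def by simp_all
    have fr1: "nmem s1 ''bl'' = bl" "nmem s1 ''rep'' = rp" "rmem s1 ''a'' = rmem s ''a''" "rmem s1 ''b'' = rmem s ''b''"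
        "nmem s1 ''k'' 0 = ?n"
      using ch1 k by (simp_all add: changes_only_def bl_def rp_def)
    have rpm: "rp (bl j) < m" if "j < ?n" for j using rep[OF blB[OF that]] unfolding rp_def .
    show "wp (For ''j'' ''k'' ?body2) Q s1 (t1 + 1)"
    proof (rule wp_For[where P = "\<lambda>j s' t'. (\<forall>i<j. rmem s' ''li'' i = SA - of_rat (a (bl i)) + of_rat (a (rp (bl i))) \<and>
        rmem s' ''ls'' i = SB - of_rat (b (bl i)) + of_rat (b (rp (bl i))) \<and> nmem s' ''lord'' i = i) \<and>
        t' \<le> t1 + 2 + 5 * real j"])
      fix j s' t' assume j: "j < nmem s1 ''k'' 0" "nmem s' ''j'' 0 = j" and ch: "changes_only (For ''j'' ''k'' ?body2) s1 s'"
        and P: "(\<forall>i<j. rmem s' ''li'' i = SA - of_rat (a (bl i)) + of_rat (a (rp (bl i))) \<and>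
        rmem s' ''ls'' i = SB - of_rat (b (bl i)) + of_rat (b (rp (bl i))) \<and> nmem s' ''lord'' i = i) \<and>
        t' \<le> t1 + 2 + 5 * real j"
      have fr: "nmem s' ''bl'' = bl" "nmem s' ''rep'' = rp" "rmem s' ''a'' = rmem s ''a''" "rmem s' ''b'' = rmem s ''b''"
          "rmem s' ''A'' 0 = SA" "rmem s' ''S'' 0 = SB"
        using ch fr1 AS by (simp_all add: changes_only_def)
      then show "wp ?body2 (\<lambda>s'' t''. (\<forall>i<Suc j. rmem (nwrite s'' ''j'' 0 (Suc j)) ''li'' i = SA - of_rat (a (bl i)) + of_rat (a (rp (bl i))) \<and>
        rmem (nwrite s'' ''j'' 0 (Suc j)) ''ls'' i = SB - of_rat (b (bl i)) + of_rat (b (rp (bl i))) \<and>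
        nmem (nwrite s'' ''j'' 0 (Suc j)) ''lord'' i = i) \<and> t'' + 1 \<le> t1 + 2 + 5 * real (Suc j)) s' (t' + 1)"
        using P j fr1 ab[OF blm[of j]] ab[OF rpm[of j]] by (auto simp: less_Suc_eq)
    next
      fix s2 t2 assume ch2: "changes_only (For ''j'' ''k'' ?body2) s1 s2"
        and P2: "(\<forall>i<nmem s1 ''k'' 0. rmem s2 ''li'' i = SA - of_rat (a (bl i)) + of_rat (a (rp (bl i))) \<and>
        rmem s2 ''ls'' i = SB - of_rat (b (bl i)) + of_rat (b (rp (bl i))) \<and> nmem s2 ''lord'' i = i) \<and>
        t2 \<le> t1 + 2 + 5 * real (nmem s1 ''k'' 0)"
      have sw: "set_weight a b B l = SA + l * SB" for l
        unfolding set_weight_def weight_def SA_def SB_def by (simp add: sum.distrib sum_distrib_left)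
      show "Q s2 (t2 + 1)"
      proof (rule Q)
        show "changes_only basis_lines s s2"
          using ch1 ch2 unfolding changes_only_def by (simp add: basis_lines_def)
        show "line (rmem s2 ''li'') (rmem s2 ''ls'') j l = set_weight a b B l - weight a b (nmem s ''bl'' j) l +
           weight a b (nmem s ''rep'' (nmem s ''bl'' j)) l" if "j < ?n" for j l
        proof -
          have eqs: "rmem s2 ''li'' j = SA - of_rat (a (bl j)) + of_rat (a (rp (bl j)))"
            "rmem s2 ''ls'' j = SB - of_rat (b (bl j)) + of_rat (b (rp (bl j)))" using P2 that fr1(5) by simp_all
          show ?thesis unfolding sw line_def weight_def bl_def[symmetric] rp_def[symmetric] eqs
            by (simp add: algebra_simps)
        qed
        show "nmem s2 ''lord'' j = j" if "j < ?n" for j using P2 that fr1(5) by simp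
        show "t2 + 1 \<le> t + 6 + 9 * real ?n" using P2 t1 fr1(5) by simp
      qed
    qed simp_all
  qed simp_all
  then show ?thesis unfolding basis_lines_def by (simp add: add.commute)
qed


lemma bval_pop_test:
  "bval s pop_test \<longleftrightarrow> pops (rmem s ''li'') (rmem s ''ls'') (nmem s ''p'' 0) (nmem s ''stk'') (rmem s ''st'') (nmem s ''g'' 0)"
proof (cases "nmem s ''p'' 0 = 1")
  case True
  then show ?thesis unfolding pop_test_def pops_def by simp
next
  case False
  then show ?thesis unfolding pop_test_def pops_def line_def by auto
qed

lemma bval_dominated_test:
  "bval s dominated_test \<longleftrightarrow> 0 < nmem s ''p'' 0 \<and>
     \<not> rmem s ''ls'' (nmem s ''stk'' (nmem s ''p'' 0 - 1)) < rmem s ''ls'' (nmem s ''g'' 0) \<and>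
     \<not> rmem s ''li'' (nmem s ''stk'' (nmem s ''p'' 0 - 1)) < rmem s ''li'' (nmem s ''g'' 0)"
  unfolding dominated_test_def by simp

definition stack_state :: "state \<Rightarrow> nat set \<Rightarrow> bool" where
  "stack_state s T \<longleftrightarrow>
     upper_stack (rmem s ''li'') (rmem s ''ls'') T (nmem s ''p'' 0) (nmem s ''stk'') (rmem s ''st'') \<and>
     covered_by (rmem s ''li'') (rmem s ''ls'') T (nmem s ''p'' 0) (nmem s ''stk'')"

text \<open>Each line is removed at most once, so the number of lines on the stack pays for the removals.\<close>

lemma wp_insert_line:
  assumes T: "stack_state s T" and g: "nmem s ''lord'' (nmem s ''i'' 0) = g"
    and steep: "\<And>j. j \<in> T \<Longrightarrow> rmem s ''ls'' j \<le> rmem s ''ls'' g"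
    and Q: "\<And>s' t'. changes_only insert_line s s' \<Longrightarrow> stack_state s' (insert g T) \<Longrightarrow>
      nmem s' ''p'' 0 \<le> Suc (nmem s ''p'' 0) \<Longrightarrow>
      t' + 2 * real (nmem s' ''p'' 0) \<le> t + 2 * real (nmem s ''p'' 0) + 10 \<Longrightarrow> Q s' t'"
  shows "wp insert_line Q s t"
proof -
  define c where "c = rmem s ''li''"
  define d where "d = rmem s ''ls''"
  define K where "K = nmem s ''stk''"
  define p where "p = nmem s ''p'' 0"
  let ?s = "nwrite s ''g'' 0 g"
  have S: "upper_stack c d T p K (rmem s ''st'')" and C: "covered_by c d T p K"
    using T unfolding stack_state_def c_def d_def K_def p_def by simp_all
  have top_le: "d (K (p - 1)) \<le> d g" if "p \<noteq> 0"
    using S that steep unfolding upper_stack_def d_def by simp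
  have ch: "changes_only insert_line s ?s" unfolding changes_only_def by simp
  let ?push = "Cond (NLess (NConst 0) (V ''p''))
         (RAssign ''st'' (V ''p'') (RDiv (RSub (RRead ''li'' top) (RRead ''li'' (V ''g'')))
            (RSub (RRead ''ls'' (V ''g'')) (RRead ''ls'' top)))) Skip;;
        NAssign ''stk'' (V ''p'') (V ''g'');; incr ''p''"
  let ?pop = "While pop_test (''p'' ::= NSub (V ''p'') (NConst (Suc 0)))"
  show ?thesis
  proof (cases "bval ?s dominated_test")
    case True
    then have p: "0 < p" "\<not> d (K (p - 1)) < d g" "\<not> c (K (p - 1)) < c g"
      unfolding bval_dominated_test by (simp_all add: c_def d_def K_def p_def)
    then have "line c d g x \<le> line c d (K (p - 1)) x" for x
      using top_le unfolding line_def by (simp add: not_less)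
    then have "covered_by c d (insert g T) p K" using C p(1) unfolding covered_by_def
      by (metis diff_less insert_iff zero_less_one)
    moreover have "upper_stack c d (insert g T) p K (rmem s ''st'')" using S unfolding upper_stack_def by simp
    ultimately have "stack_state ?s (insert g T)" unfolding stack_state_def c_def d_def K_def p_def by simp
    then have "Q ?s u" if "u \<le> t + 10" for u using ch that by (intro Q) simp_all
    then show ?thesis using True g unfolding insert_line_def by simp
  next
    case False
    then have start: "p \<noteq> 0 \<Longrightarrow> steeper_or_higher c d (K (p - 1)) g"
      using top_le unfolding bval_dominated_test steeper_or_higher_def
      by (auto simp: c_def d_def K_def p_def)
    have CT: "covered c d T p K g" using C unfolding covered_def covered_by_def by blast
    define Inv where "Inv s' t' \<longleftrightarrow> (\<exists>q. nmem s' ''p'' 0 = q \<and> q \<le> p \<and> upper_stack c d T q K (rmem s ''st'') \<and>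
      covered c d T q K g \<and> (q \<noteq> 0 \<longrightarrow> steeper_or_higher c d (K (q - 1)) g) \<and>
      t' + 2 * real q \<le> t + 2 * real p + 2)" for s' :: state and t' :: real
    have "wp ?pop (wp ?push Q) ?s (t + 2)"
    proof (rule wp_While[where Inv = Inv and \<mu> = "\<lambda>s. nmem s ''p'' 0"])
      show "Inv ?s (t + 2)" unfolding Inv_def using S CT start by (simp add: p_def)
    next
      fix s' t' assume ch': "changes_only (''p'' ::= NSub (V ''p'') (NConst (Suc 0))) ?s s'" and inv: "Inv s' t'"
        and test: "bval s' pop_test"
      have fr: "rmem s' ''li'' = c" "rmem s' ''ls'' = d" "nmem s' ''stk'' = K" "rmem s' ''st'' = rmem s ''st''"
          "nmem s' ''g'' 0 = g"
        using ch' by (simp_all add: changes_only_def c_def d_def K_def)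
      obtain q where q: "nmem s' ''p'' 0 = q" "q \<le> p" "upper_stack c d T q K (rmem s ''st'')"
        "covered c d T q K g" "q \<noteq> 0 \<longrightarrow> steeper_or_higher c d (K (q - 1)) g" "t' + 2 * real q \<le> t + 2 * real p + 2"
        using inv unfolding Inv_def by blast
      have pop: "pops c d q K (rmem s ''st'') g" using test unfolding bval_pop_test fr q(1) .
      then have q0: "q \<noteq> 0" by (simp add: pops_def)
      then have sh: "steeper_or_higher c d (K (q - 1)) g" using q(5) by simp
      have "Inv (nwrite s' ''p'' 0 (q - 1)) (t' + 2)" unfolding Inv_def
        using pop_stack[OF q(3,4) sh pop] q(2,6) q0 by (simp add: of_nat_diff)
      then show "wp (''p'' ::= NSub (V ''p'') (NConst (Suc 0))) (\<lambda>s'' t''. Inv s'' t'' \<and> nmem s'' ''p'' 0 < nmem s' ''p'' 0) s' (t' + 1)"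
        using q(1) q0 by (simp add: add.commute)
    next
      fix s' t' assume ch': "changes_only (''p'' ::= NSub (V ''p'') (NConst (Suc 0))) ?s s'" and inv: "Inv s' t'"
        and test: "\<not> bval s' pop_test"
      have fr: "rmem s' ''li'' = c" "rmem s' ''ls'' = d" "nmem s' ''stk'' = K" "rmem s' ''st'' = rmem s ''st''"
          "nmem s' ''g'' 0 = g"
        using ch' by (simp_all add: changes_only_def c_def d_def K_def)
      obtain q where q: "nmem s' ''p'' 0 = q" "q \<le> p" "upper_stack c d T q K (rmem s ''st'')"
        "covered c d T q K g" "q \<noteq> 0 \<longrightarrow> steeper_or_higher c d (K (q - 1)) g" "t' + 2 * real q \<le> t + 2 * real p + 2"
        using inv unfolding Inv_def by blast
      have pop: "\<not> pops c d q K (rmem s ''st'') g" using test unfolding bval_pop_test fr q(1) .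
      define s2 where "s2 = (if q = 0 then s' else rwrite s' ''st'' q (takeover c d (K (q - 1)) g))"
      let ?s3 = "nwrite (nwrite s2 ''stk'' q g) ''p'' 0 (Suc q)"
      have s2: "rmem s2 ''li'' = c" "rmem s2 ''ls'' = d" "nmem s2 = nmem s'"
        using fr by (simp_all add: s2_def)
      have st: "rmem s2 ''st'' i = rmem s ''st'' i" if "i < q" for i using that fr by (simp add: s2_def)
      have st': "rmem s2 ''st'' q = takeover c d (K (q - 1)) g" if "q \<noteq> 0" using that by (simp add: s2_def)
      have ps: "upper_stack c d (insert g T) (Suc q) (K(q := g)) (rmem s2 ''st'')"
          "covered_by c d (insert g T) (Suc q) (K(q := g))"
        using push_stack[OF q(3,4) _ pop refl st st'] q(5) by blast+
      have "stack_state ?s3 (insert g T)" unfolding stack_state_def using ps s2 fr by simp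
      moreover have "changes_only insert_line s ?s3"
        using ch' unfolding changes_only_def s2_def by (simp add: insert_line_def)
      moreover have "nmem ?s3 ''p'' 0 \<le> Suc (nmem s ''p'' 0)" using q(2) by (simp add: p_def)
      ultimately have fin: "Q ?s3 u" if "u \<le> t' + 6" for u
        using q(6) that by (intro Q) (simp_all add: p_def)
      show "wp ?push Q s' (t' + 1)"
      proof (cases "q = 0")
        case True
        then show ?thesis using fin q(1) fr unfolding s2_def by simp
      next
        case False
        then show ?thesis using fin q(1) fr unfolding s2_def takeover_def by simp
      qed
    qed
    then show ?thesis using False g unfolding insert_line_def by (simp add: add.commute)
  qed
qed

lemma wp_envelope:
  assumes n: "nmem s ''k'' 0 = n" and srt: "\<And>i j. i < j \<Longrightarrow> j < n \<Longrightarrow>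
      rmem s ''ls'' (nmem s ''lord'' i) \<le> rmem s ''ls'' (nmem s ''lord'' j)"
    and Q: "\<And>s' t'. changes_only envelope s s' \<Longrightarrow> stack_state s' (nmem s ''lord'' ` {..<n}) \<Longrightarrow>
      nmem s' ''p'' 0 \<le> n \<Longrightarrow> t' \<le> t + 3 + 12 * real n \<Longrightarrow> Q s' t'"
  shows "wp envelope Q s t"
proof -
  let ?od = "nmem s ''lord''" and ?s = "nwrite s ''p'' 0 0"
  have "wp (For ''i'' ''k'' insert_line) Q ?s (t + 1)"
  proof (rule wp_For[where P = "\<lambda>j s' t'. stack_state s' (?od ` {..<j}) \<and> nmem s' ''p'' 0 \<le> j \<and>
      t' + 2 * real (nmem s' ''p'' 0) \<le> t + 2 + 12 * real j"])
    show "stack_state (nwrite ?s ''i'' 0 0) (?od ` {..<0}) \<and> nmem (nwrite ?s ''i'' 0 0) ''p'' 0 \<le> 0 \<and>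
      t + 1 + 1 + 2 * real (nmem (nwrite ?s ''i'' 0 0) ''p'' 0) \<le> t + 2 + 12 * real 0"
      by (simp add: stack_state_def upper_stack_def covered_by_def)
  next
    fix j s' t' assume j: "j < nmem ?s ''k'' 0" "nmem s' ''i'' 0 = j"
      and ch: "changes_only (For ''i'' ''k'' insert_line) ?s s'"
      and P: "stack_state s' (?od ` {..<j}) \<and> nmem s' ''p'' 0 \<le> j \<and> t' + 2 * real (nmem s' ''p'' 0) \<le> t + 2 + 12 * real j"
    have fr: "nmem s' ''lord'' = ?od" "rmem s' ''ls'' = rmem s ''ls''"
      using ch by (simp_all add: changes_only_def)
    show "wp insert_line (\<lambda>s'' t''. stack_state (nwrite s'' ''i'' 0 (Suc j)) (?od ` {..<Suc j}) \<and>
        nmem (nwrite s'' ''i'' 0 (Suc j)) ''p'' 0 \<le> Suc j \<and>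
        t'' + 1 + 2 * real (nmem (nwrite s'' ''i'' 0 (Suc j)) ''p'' 0) \<le> t + 2 + 12 * real (Suc j)) s' (t' + 1)"
    proof (rule wp_insert_line[where g = "?od j"])
      show "stack_state s' (?od ` {..<j})" "nmem s' ''lord'' (nmem s' ''i'' 0) = ?od j" using P fr j by simp_all
      show "rmem s' ''ls'' i \<le> rmem s' ''ls'' (?od j)" if "i \<in> ?od ` {..<j}" for i
        using that srt j n fr by auto
      fix s'' t'' assume st: "stack_state s'' (insert (?od j) (?od ` {..<j}))"
        and p: "nmem s'' ''p'' 0 \<le> Suc (nmem s' ''p'' 0)"
        and t'': "t'' + 2 * real (nmem s'' ''p'' 0) \<le> t' + 1 + 2 * real (nmem s' ''p'' 0) + 10"
      have "stack_state (nwrite s'' ''i'' 0 (Suc j)) (?od ` {..<Suc j})"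
        using st unfolding stack_state_def by (simp add: lessThan_Suc)
      then show "stack_state (nwrite s'' ''i'' 0 (Suc j)) (?od ` {..<Suc j}) \<and>
        nmem (nwrite s'' ''i'' 0 (Suc j)) ''p'' 0 \<le> Suc j \<and>
        t'' + 1 + 2 * real (nmem (nwrite s'' ''i'' 0 (Suc j)) ''p'' 0) \<le> t + 2 + 12 * real (Suc j)"
        using P p t'' by simp
    qed
  next
    fix s' t' assume ch: "changes_only (For ''i'' ''k'' insert_line) ?s s'"
      and P: "stack_state s' (?od ` {..<nmem ?s ''k'' 0}) \<and> nmem s' ''p'' 0 \<le> nmem ?s ''k'' 0 \<and>
        t' + 2 * real (nmem s' ''p'' 0) \<le> t + 2 + 12 * real (nmem ?s ''k'' 0)"
    show "Q s' (t' + 1)"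
    proof (rule Q)
      show "changes_only envelope s s'" using ch unfolding changes_only_def by (simp add: envelope_def)
    qed (use P n in simp_all)
  qed simp_all
  then show ?thesis unfolding envelope_def by simp
qed

section \<open>Writing the output\<close>

definition best_at :: "nat \<Rightarrow> real \<Rightarrow> real \<Rightarrow> real \<Rightarrow> bool" where
  "best_at v c d l \<longleftrightarrow> (\<forall>g<m. y_val g l \<le> y_val v l) \<and> y_val v l = c + l * d"

definition piece_at :: "state \<Rightarrow> nat \<Rightarrow> real \<Rightarrow> bool" where
  "piece_at s i l \<longleftrightarrow> best_at (nmem s ''vital'' i) (rmem s ''icpt'' i) (rmem s ''slope'' i) l"

text \<open>The first \<open>n\<close> pieces are complete. Piece \<open>i\<close> ends at breakpoint \<open>i\<close>.\<close>

definition emitted :: "state \<Rightarrow> nat \<Rightarrow> bool" where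
  "emitted s n \<longleftrightarrow> nmem s ''n'' 0 = n \<and> (\<forall>i<n. rmem s ''bp'' i \<in> I) \<and>
     (\<forall>i j. i < j \<and> j < n \<longrightarrow> rmem s ''bp'' i < rmem s ''bp'' j) \<and>
     (\<forall>i<n. nmem s ''vital'' i < m \<and>
        (\<forall>l\<in>I. (0 < i \<longrightarrow> rmem s ''bp'' (i - 1) \<le> l) \<and> l \<le> rmem s ''bp'' i \<longrightarrow> piece_at s i l))"

lemma emitted_Suc:
  assumes E: "emitted s n" and x: "x \<in> I" "0 < n \<Longrightarrow> rmem s ''bp'' (n - 1) < x"
    and v: "nmem s ''vital'' n < m"
      "\<And>l. l \<in> I \<Longrightarrow> (0 < n \<Longrightarrow> rmem s ''bp'' (n - 1) \<le> l) \<Longrightarrow> l \<le> x \<Longrightarrow> piece_at s n l"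
  shows "emitted (nwrite (rwrite s ''bp'' n x) ''n'' 0 (Suc n)) (Suc n)"
proof -
  have last: "rmem s ''bp'' i < x" if "i < n" for i
  proof (cases "i = n - 1")
    case False
    then have "rmem s ''bp'' i < rmem s ''bp'' (n - 1)" using E that unfolding emitted_def by auto
    then show ?thesis using x(2) that by auto
  qed (use x(2) that in auto)
  show ?thesis unfolding emitted_def
  proof (intro conjI allI impI ballI)
    fix i assume i: "i < Suc n"
    show "rmem (nwrite (rwrite s ''bp'' n x) ''n'' 0 (Suc n)) ''bp'' i \<in> I"
      using E i x(1) unfolding emitted_def by (auto simp: less_Suc_eq)
    show "nmem (nwrite (rwrite s ''bp'' n x) ''n'' 0 (Suc n)) ''vital'' i < m"
      using E i v(1) unfolding emitted_def by (auto simp: less_Suc_eq)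
    fix l assume l: "l \<in> I" and *: "(0 < i \<longrightarrow> rmem (nwrite (rwrite s ''bp'' n x) ''n'' 0 (Suc n)) ''bp'' (i - 1) \<le> l) \<and>
      l \<le> rmem (nwrite (rwrite s ''bp'' n x) ''n'' 0 (Suc n)) ''bp'' i"
    have "piece_at s i l"
    proof (cases "i = n")
      case True
      have "rmem s ''bp'' (n - 1) \<le> l" if "0 < n" using * True that by (simp split: if_splits)
      then show ?thesis using v(2)[OF l] * True by simp
    next
      case False
      then have "i < n" "i - 1 \<noteq> n" using i by auto
      then have "(0 < i \<longrightarrow> rmem s ''bp'' (i - 1) \<le> l) \<and> l \<le> rmem s ''bp'' i" using * by simp
      then show ?thesis using E l \<open>i < n\<close> unfolding emitted_def by blast
    qed
    then show "piece_at (nwrite (rwrite s ''bp'' n x) ''n'' 0 (Suc n)) i l"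
      unfolding piece_at_def by simp
  next
    fix i j assume "i < j \<and> j < Suc n"
    then show "rmem (nwrite (rwrite s ''bp'' n x) ''n'' 0 (Suc n)) ''bp'' i <
       rmem (nwrite (rwrite s ''bp'' n x) ''n'' 0 (Suc n)) ''bp'' j"
      using E last unfolding emitted_def by (auto simp: less_Suc_eq)
  qed simp
qed

lemma emitted_write:
  assumes "emitted s n"
  shows "emitted (rwrite (rwrite (nwrite s ''vital'' n v) ''icpt'' n c) ''slope'' n d) n"
  using assms unfolding emitted_def piece_at_def by simp

text \<open>The current piece is correct up to the next takeover, within the region. \<open>L\<close> and \<open>R\<close> are the ends
  of the region, which are infinite if the flags are \<open>0\<close>.\<close>

definition current_piece :: "state \<Rightarrow> nat \<Rightarrow> nat \<Rightarrow> (nat \<Rightarrow> real) \<Rightarrow> nat \<Rightarrow> nat \<Rightarrow> real \<Rightarrow> nat \<Rightarrow> real \<Rightarrow> bool" where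
  "current_piece s p j st n Lf L Rf R \<longleftrightarrow> emitted s n \<and> nmem s ''vital'' n < m \<and>
     (\<forall>l\<in>I. (0 < n \<longrightarrow> rmem s ''bp'' (n - 1) \<le> l) \<and> (0 < Rf \<longrightarrow> l \<le> R) \<and> (Suc j < p \<longrightarrow> l \<le> st (Suc j)) \<longrightarrow>
        piece_at s n l) \<and>
     (0 < n \<longrightarrow> (0 < Lf \<longrightarrow> L \<le> rmem s ''bp'' (n - 1)) \<and> (0 < Rf \<longrightarrow> rmem s ''bp'' (n - 1) < R) \<and>
        (\<forall>x. (0 < Lf \<longrightarrow> L < x) \<and> (0 < j \<longrightarrow> st j < x) \<longrightarrow> rmem s ''bp'' (n - 1) < x)) \<and>
     (n = 0 \<longrightarrow> 0 < Lf \<longrightarrow> (\<forall>l\<in>I. L \<le> l))"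

lemma wp_emit:
  assumes cuts: "cut_points (rmem s ''cut'') (nmem s ''cutf'') D" "nmem s ''r'' 0 = r" "r \<le> length D"
    and em: "emitted s n" and n0: "n = 0 \<Longrightarrow> r = 0" and n1: "0 < n \<Longrightarrow> 0 < r \<and> rmem s ''bp'' (n - 1) = rmem s ''cut'' r"
    and p: "nmem s ''p'' 0 = p" "0 < p"
    and lines: "\<And>i. i < p \<Longrightarrow> nmem s ''bl'' (nmem s ''stk'' i) < m"
    and mono: "\<And>i. Suc (Suc i) < p \<Longrightarrow> rmem s ''st'' (Suc i) < rmem s ''st'' (Suc (Suc i))"
    and best: "\<And>i l. i < p \<Longrightarrow> l \<in> I \<Longrightarrow> closed_region (rmem s ''cut'') (nmem s ''cutf'') r l \<Longrightarrow>
      (0 < i \<Longrightarrow> rmem s ''st'' i \<le> l) \<Longrightarrow> (Suc i < p \<Longrightarrow> l \<le> rmem s ''st'' (Suc i)) \<Longrightarrow>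
      best_at (nmem s ''bl'' (nmem s ''stk'' i)) (rmem s ''li'' (nmem s ''stk'' i)) (rmem s ''ls'' (nmem s ''stk'' i)) l"
    and Q: "\<And>s' t' n'. changes_only emit s s' \<Longrightarrow> emitted s' n' \<Longrightarrow> nmem s' ''vital'' n' < m \<Longrightarrow>
      (\<And>l. l \<in> I \<Longrightarrow> (0 < n' \<Longrightarrow> rmem s' ''bp'' (n' - 1) \<le> l) \<Longrightarrow>
        (0 < nmem s ''cutf'' (Suc r) \<Longrightarrow> l \<le> rmem s ''cut'' (Suc r)) \<Longrightarrow> piece_at s' n' l) \<Longrightarrow>
      (0 < n' \<Longrightarrow> 0 < nmem s ''cutf'' (Suc r) \<Longrightarrow> rmem s' ''bp'' (n' - 1) < rmem s ''cut'' (Suc r)) \<Longrightarrow>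
      t' \<le> t + 7 + 10 * real p \<Longrightarrow> Q s' t'"
  shows "wp emit Q s t"
proof -
  define bl K c d st where defs: "bl = nmem s ''bl''" "K = nmem s ''stk''" "c = rmem s ''li''" "d = rmem s ''ls''" "st = rmem s ''st''"
  define Lf L Rf R where LR: "Lf = nmem s ''cutf'' r" "L = rmem s ''cut'' r"
    "Rf = nmem s ''cutf'' (Suc r)" "R = rmem s ''cut'' (Suc r)"
  note em' = em[unfolded emitted_def]
  have closed: "closed_region (rmem s ''cut'') (nmem s ''cutf'') r l \<longleftrightarrow> (0 < Lf \<longrightarrow> L \<le> l) \<and> (0 < Rf \<longrightarrow> l \<le> R)" for l
    unfolding closed_region_def LR ..
  have inI: "x \<in> I" if "0 < Lf \<Longrightarrow> L < x" "0 < Rf \<Longrightarrow> x < R" for x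
    by (rule strictly_inside_mem, rule open_region_inside[OF cuts(1,3)])
      (use that in \<open>simp add: open_region_def LR\<close>)
  have best': "best_at (bl (K i)) (c (K i)) (d (K i)) l"
    if "i < p" "l \<in> I" "0 < Lf \<Longrightarrow> L \<le> l" "0 < Rf \<Longrightarrow> l \<le> R" "0 < i \<Longrightarrow> st i \<le> l" "Suc i < p \<Longrightarrow> l \<le> st (Suc i)" for i l
    using best[of i l] that closed[of l] unfolding defs by simp
  have rD: "length D \<noteq> 0" if "0 < r" using that cuts(3) by auto
  define piece where "piece s' n i = rwrite (rwrite (nwrite s' ''vital'' n (bl (K i))) ''icpt'' n (c (K i))) ''slope'' n (d (K i))"
    for s' n i
  have start: "current_piece (piece s n 0) p 0 st n Lf L Rf R"
    unfolding current_piece_def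
  proof (intro conjI ballI allI impI)
    show "emitted (piece s n 0) n" unfolding piece_def by (rule emitted_write[OF em])
    show "nmem (piece s n 0) ''vital'' n < m" using lines[of 0] p unfolding piece_def defs by simp
    have L_le: "L \<le> l" if "0 < n \<longrightarrow> rmem (piece s n 0) ''bp'' (n - 1) \<le> l" "l \<in> I" "0 < Lf" for l
    proof (cases "n = 0")
      case True
      then have "bdd_below I" "L = Inf I" using cut_ends[OF cuts(1)] n0 that(3) unfolding LR by auto
      then show ?thesis using cInf_lower that(2) by metis
    next
      case False
      then show ?thesis using that(1) n1 unfolding piece_def LR by simp
    qed
    fix l assume "l \<in> I" and "(0 < n \<longrightarrow> rmem (piece s n 0) ''bp'' (n - 1) \<le> l) \<and> (0 < Rf \<longrightarrow> l \<le> R) \<and>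
      (Suc 0 < p \<longrightarrow> l \<le> st (Suc 0))"
    then show "piece_at (piece s n 0) n l"
      using best'[of 0 l] p(2) L_le[of l] unfolding piece_at_def by (simp add: piece_def)
  next
    assume "0 < n"
    then have eq: "rmem (piece s n 0) ''bp'' (n - 1) = L" "0 < r" using n1 unfolding piece_def LR by simp_all
    show "L \<le> rmem (piece s n 0) ''bp'' (n - 1)" using eq by simp
    have Lf: "0 < Lf" using cut_flag[OF cuts(1), of "r - 1"] eq(2) cuts(3) unfolding LR by simp
    show "rmem (piece s n 0) ''bp'' (n - 1) < R" if "0 < Rf"
      using cut_order(2)[OF cuts(1,3)] Lf that rD[OF eq(2)] eq(1) unfolding LR by simp
    show "rmem (piece s n 0) ''bp'' (n - 1) < x" if "(0 < Lf \<longrightarrow> L < x) \<and> (0 < (0::nat) \<longrightarrow> st 0 < x)" for x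
      using that Lf eq by simp
  next
    fix l assume "n = 0" "0 < Lf" "l \<in> I"
    then have "bdd_below I" "L = Inf I" using cut_ends[OF cuts(1)] n0 unfolding LR by auto
    then show "L \<le> l" using cInf_lower \<open>l \<in> I\<close> by metis
  qed
  let ?s = "nwrite (piece s n 0) ''p'' 0 (p - 1)"
  have cp_write: "current_piece (nwrite s' x i v) p j st n' Lf L Rf R = current_piece s' p j st n' Lf L Rf R"
      if "x \<notin> {''n'', ''vital''}" for s' x i v j n'
  proof -
    have "''n'' \<noteq> x" "''vital'' \<noteq> x" using that by auto
    then show ?thesis unfolding current_piece_def emitted_def piece_at_def by simp
  qed
  have "wp (For ''i'' ''p'' emit_piece) Q ?s (t + 4)"
  proof (rule wp_For[where P = "\<lambda>j s' t'. (\<exists>n. current_piece s' p j st n Lf L Rf R) \<and> t' \<le> t + 5 + 10 * real j"])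
      show "(\<exists>n. current_piece (nwrite ?s ''i'' 0 0) p 0 st n Lf L Rf R) \<and> t + 4 + 1 \<le> t + 5 + 10 * real 0"
        using start by (auto simp: cp_write)
    next
      fix j s' t' assume j: "j < nmem ?s ''p'' 0" "nmem s' ''i'' 0 = j" and ch: "changes_only (For ''i'' ''p'' emit_piece) ?s s'"
        and P: "(\<exists>n. current_piece s' p j st n Lf L Rf R) \<and> t' \<le> t + 5 + 10 * real j"
      then obtain n' where cp: "current_piece s' p j st n' Lf L Rf R" by blast
      note cp' = cp[unfolded current_piece_def]
      have em1: "emitted s' n'" and nn: "nmem s' ''n'' 0 = n'" using cp' unfolding emitted_def by blast+
      have jp: "Suc j < p" using j(1) by simp
      have fr: "nmem s' ''bl'' = bl" "nmem s' ''stk'' = K" "rmem s' ''li'' = c" "rmem s' ''ls'' = d" "rmem s' ''st'' = st"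
          "nmem s' ''cutf'' r = Lf" "rmem s' ''cut'' r = L" "nmem s' ''cutf'' (Suc r) = Rf" "rmem s' ''cut'' (Suc r) = R"
          "nmem s' ''r'' 0 = r"
        using ch cuts(2) unfolding defs LR by (simp_all add: changes_only_def piece_def)
      have vit: "bl (K (Suc j)) < m" using lines[OF jp] unfolding defs .
      define x where "x = st (Suc j)"
      have stj: "0 < j \<longrightarrow> st j < x" using mono[of "j - 1"] jp unfolding x_def defs by auto
      have st2: "x < st (Suc (Suc j))" if "Suc (Suc j) < p" using mono[OF that] unfolding x_def defs .
      consider (beyond) "0 < Rf" "R \<le> x" | (before) "0 < Rf \<longrightarrow> x < R" "0 < Lf" "x \<le> L"
        | (within) "0 < Rf \<longrightarrow> x < R" "0 < Lf \<longrightarrow> L < x" by fastforce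
      then show "wp emit_piece (\<lambda>s'' t''. (\<exists>n. current_piece (nwrite s'' ''i'' 0 (Suc j)) p (Suc j) st n Lf L Rf R) \<and>
        t'' + 1 \<le> t + 5 + 10 * real (Suc j)) s' (t' + 1)"
      proof cases
        \<comment> \<open>The next line takes over behind the region, so the current piece remains.\<close>
        case beyond
        have "current_piece s' p (Suc j) st n' Lf L Rf R" unfolding current_piece_def
        proof (intro conjI ballI allI impI)
          show "emitted s' n'" "nmem s' ''vital'' n' < m" using cp' by blast+
          fix l assume "l \<in> I" "(0 < n' \<longrightarrow> rmem s' ''bp'' (n' - 1) \<le> l) \<and> (0 < Rf \<longrightarrow> l \<le> R) \<and>
            (Suc (Suc j) < p \<longrightarrow> l \<le> st (Suc (Suc j)))"
          moreover from this have "l \<le> st (Suc j)" using beyond unfolding x_def by auto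
          ultimately show "piece_at s' n' l" using cp' by blast
        next
          assume n': "0 < n'"
          show "L \<le> rmem s' ''bp'' (n' - 1)" if "0 < Lf" using cp' n' that by blast
          show "rmem s' ''bp'' (n' - 1) < R" if "0 < Rf" using cp' n' that by blast
          show "rmem s' ''bp'' (n' - 1) < z" if z: "(0 < Lf \<longrightarrow> L < z) \<and> (0 < Suc j \<longrightarrow> st (Suc j) < z)" for z
          proof -
            have "0 < j \<longrightarrow> st j < z" using z stj unfolding x_def by auto
            then show ?thesis using cp' n' z by blast
          qed
        next
          fix l assume "n' = 0" "0 < Lf" "l \<in> I"
          then show "L \<le> l" using cp' by blast
        qed
        then show ?thesis using beyond P j fr unfolding emit_piece_def x_def by (auto simp: cp_write)
      next
        \<comment> \<open>The current piece ends before the region begins; it is overwritten.\<close>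
        case before
        have "current_piece (piece s' n' (Suc j)) p (Suc j) st n' Lf L Rf R" unfolding current_piece_def
        proof (intro conjI ballI allI impI)
          show "emitted (piece s' n' (Suc j)) n'" unfolding piece_def by (rule emitted_write[OF em1])
          show "nmem (piece s' n' (Suc j)) ''vital'' n' < m" using vit by (simp add: piece_def)
          fix l assume l: "l \<in> I" and *: "(0 < n' \<longrightarrow> rmem (piece s' n' (Suc j)) ''bp'' (n' - 1) \<le> l) \<and> (0 < Rf \<longrightarrow> l \<le> R) \<and>
            (Suc (Suc j) < p \<longrightarrow> l \<le> st (Suc (Suc j)))"
          have "L \<le> l"
          proof (cases "n' = 0")
            case True
            then show ?thesis using cp' before(2) l by blast
          next
            case False
            then have "L \<le> rmem s' ''bp'' (n' - 1)" using cp' before(2) by blast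
            then show ?thesis using * False by (simp add: piece_def)
          qed
          then show "piece_at (piece s' n' (Suc j)) n' l"
            using best'[OF jp l] * before unfolding piece_at_def x_def by (simp add: piece_def)
        next
          assume n': "0 < n'"
          have bp: "rmem (piece s' n' (Suc j)) ''bp'' = rmem s' ''bp''" by (simp add: piece_def)
          show "L \<le> rmem (piece s' n' (Suc j)) ''bp'' (n' - 1)" if "0 < Lf" unfolding bp using cp' n' that by blast
          show "rmem (piece s' n' (Suc j)) ''bp'' (n' - 1) < R" if "0 < Rf" unfolding bp using cp' n' that by blast
          show "rmem (piece s' n' (Suc j)) ''bp'' (n' - 1) < z" if z: "(0 < Lf \<longrightarrow> L < z) \<and> (0 < Suc j \<longrightarrow> st (Suc j) < z)" for z
          proof -
            have "0 < j \<longrightarrow> st j < z" using z stj unfolding x_def by auto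
            then show ?thesis unfolding bp using cp' n' z by blast
          qed
        next
          fix l assume "n' = 0" "0 < Lf" "l \<in> I"
          then show "L \<le> l" using cp' by blast
        qed
        then have "\<exists>n. current_piece (nwrite (piece s' n' (Suc j)) ''i'' 0 (Suc j)) p (Suc j) st n Lf L Rf R"
          by (auto simp: cp_write)
        then show ?thesis using before P j fr nn unfolding emit_piece_def write_piece_def x_def
          by (auto simp: piece_def)
      next
        \<comment> \<open>The takeover point is a breakpoint; it completes the current piece.\<close>
        case within
        define s1 where "s1 = nwrite (rwrite s' ''bp'' n' x) ''n'' 0 (Suc n')"
        have xI: "x \<in> I" using inI within by blast
        have em2: "emitted s1 (Suc n')" unfolding s1_def
        proof (rule emitted_Suc[OF em1 xI])
          show "rmem s' ''bp'' (n' - 1) < x" if "0 < n'" using cp' that within(2) stj by blast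
          show "nmem s' ''vital'' n' < m" using cp' by blast
          show "piece_at s' n' l" if l: "l \<in> I" "0 < n' \<Longrightarrow> rmem s' ''bp'' (n' - 1) \<le> l" "l \<le> x" for l
          proof -
            have "0 < Rf \<longrightarrow> l \<le> R" using within l(3) by auto
            then show ?thesis using cp' l unfolding x_def by blast
          qed
        qed
        have "current_piece (piece s1 (Suc n') (Suc j)) p (Suc j) st (Suc n') Lf L Rf R" unfolding current_piece_def
        proof (intro conjI ballI allI impI)
          show "emitted (piece s1 (Suc n') (Suc j)) (Suc n')" unfolding piece_def by (rule emitted_write[OF em2])
          show "nmem (piece s1 (Suc n') (Suc j)) ''vital'' (Suc n') < m" using vit by (simp add: piece_def)
          have bp: "rmem (piece s1 (Suc n') (Suc j)) ''bp'' (Suc n' - 1) = x" by (simp add: piece_def s1_def)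
          show "L \<le> rmem (piece s1 (Suc n') (Suc j)) ''bp'' (Suc n' - 1)" if "0 < Lf"
            unfolding bp using within that by simp
          show "rmem (piece s1 (Suc n') (Suc j)) ''bp'' (Suc n' - 1) < R" if "0 < Rf"
            unfolding bp using within that by simp
          show "rmem (piece s1 (Suc n') (Suc j)) ''bp'' (Suc n' - 1) < z"
            if "(0 < Lf \<longrightarrow> L < z) \<and> (0 < Suc j \<longrightarrow> st (Suc j) < z)" for z
            unfolding bp using that unfolding x_def by simp
          fix l assume l: "l \<in> I" and *: "(0 < Suc n' \<longrightarrow> rmem (piece s1 (Suc n') (Suc j)) ''bp'' (Suc n' - 1) \<le> l) \<and>
            (0 < Rf \<longrightarrow> l \<le> R) \<and> (Suc (Suc j) < p \<longrightarrow> l \<le> st (Suc (Suc j)))"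
          have xl: "x \<le> l" using * unfolding bp by simp
          then have "0 < Lf \<longrightarrow> L \<le> l" using within(2) by auto
          then show "piece_at (piece s1 (Suc n') (Suc j)) (Suc n') l"
            using best'[OF jp l] * xl unfolding piece_at_def x_def by (simp add: piece_def)
        qed simp
        then have "\<exists>n. current_piece (nwrite (piece s1 (Suc n') (Suc j)) ''i'' 0 (Suc j)) p (Suc j) st n Lf L Rf R"
          by (auto simp: cp_write)
        then show ?thesis using within P j fr nn unfolding emit_piece_def write_piece_def x_def
          by (auto simp: piece_def s1_def x_def)
      qed
    next
      fix s' t' assume ch: "changes_only (For ''i'' ''p'' emit_piece) ?s s'"
        and P: "(\<exists>n. current_piece s' p (nmem ?s ''p'' 0) st n Lf L Rf R) \<and> t' \<le> t + 5 + 10 * real (nmem ?s ''p'' 0)"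
      then obtain n' where cp: "current_piece s' p (p - 1) st n' Lf L Rf R" by auto
      note cp' = cp[unfolded current_piece_def]
      show "Q s' (t' + 1)"
      proof (rule Q)
        show "changes_only emit s s'" using ch unfolding changes_only_def by (simp add: emit_def piece_def)
        show "emitted s' n'" "nmem s' ''vital'' n' < m" using cp' by blast+
        show "piece_at s' n' l" if "l \<in> I" "0 < n' \<Longrightarrow> rmem s' ''bp'' (n' - 1) \<le> l"
            "0 < nmem s ''cutf'' (Suc r) \<Longrightarrow> l \<le> rmem s ''cut'' (Suc r)" for l
        proof -
          have "\<not> Suc (p - 1) < p" by simp
          then show ?thesis
            using bspec[OF cp'[THEN conjunct2, THEN conjunct2, THEN conjunct1] that(1)] that(2,3) by (simp add: LR)
        qed
        show "rmem s' ''bp'' (n' - 1) < rmem s ''cut'' (Suc r)" if "0 < n'" "0 < nmem s ''cutf'' (Suc r)"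
          using cp'[THEN conjunct2, THEN conjunct2, THEN conjunct2, THEN conjunct1] that unfolding LR by simp
        have "real (p - 1) \<le> real p" by simp
        moreover have "t' \<le> t + 5 + 10 * real (p - 1)" using P by simp
        ultimately show "t' + 1 \<le> t + 7 + 10 * real p" by linarith
      qed
  qed simp_all
  moreover have "nmem s ''n'' 0 = n" using em' by blast
  ultimately show ?thesis unfolding emit_def write_piece_def
    by (simp add: piece_def defs p add.commute)
qed

end


section \<open>The complete algorithm\<close>

definition region :: com where
  "region =
     (set_mu;; Replacements ''inB'' (RV ''mu'') ''rep'';; basis_lines;; sort_by ''lord'' ''ls'' ''k'';; envelope;; emit;;
      Cond (NLess (V ''r'') (V ''N''))
       (RAssign ''bp'' (V ''n'') (RRead ''cut'' next_r);; incr ''n'';; swap) Skip)"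

definition interdiction_program :: com where
  "interdiction_program =
     (generate_candidates;; sort_cuts;; set_mu;; greedy;;
      Cond (NLess (NConst 0) (V ''k'')) (''N1'' ::= NAdd (V ''N'') (NConst (Suc 0));; For ''r'' ''N1'' region) Skip)"

lemma writes_region [simp]:
  "nwrites region = {''rep'', ''j'', ''lord'', ''p'', ''i'', ''g'', ''stk'', ''vital'', ''n'', ''f'', ''inB'', ''y'', ''pos'', ''bl''} \<union> sort_vars"
  "rwrites region = {''mu'', ''A'', ''S'', ''li'', ''ls'', ''st'', ''bp'', ''icpt'', ''slope''}"
  by (auto simp: region_def)

lemma changes_only_nmem: "changes_only c s s' \<Longrightarrow> x \<notin> nwrites c \<Longrightarrow> nmem s' x = nmem s x"
  by (simp add: changes_only_def)

lemma changes_only_rmem: "changes_only c s s' \<Longrightarrow> x \<notin> rwrites c \<Longrightarrow> rmem s' x = rmem s x"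
  by (simp add: changes_only_def)

context interdiction_machine
begin

lemma basis_state_cong:
  "basis_state s B \<Longrightarrow> (\<And>x. x \<in> {''inB'', ''k'', ''bl'', ''pos''} \<Longrightarrow> nmem s' x = nmem s x) \<Longrightarrow> basis_state s' B"
  using marked_cong[of s' "''inB''" s] unfolding basis_state_def by simp

lemma cuts_state_cong:
  "cuts_state s D \<Longrightarrow> (\<And>x. x \<in> {''cutf'', ''N'', ''ce'', ''cf'', ''ord''} \<Longrightarrow> nmem s' x = nmem s x) \<Longrightarrow>
    rmem s' ''cut'' = rmem s ''cut'' \<Longrightarrow> cuts_state s' D"
  unfolding cuts_state_def by simp

lemma emitted_cong:
  "emitted s n \<Longrightarrow> (\<And>x. x \<in> {''n'', ''vital''} \<Longrightarrow> nmem s' x = nmem s x) \<Longrightarrow>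
    (\<And>x. x \<in> {''bp'', ''icpt'', ''slope''} \<Longrightarrow> rmem s' x = rmem s x) \<Longrightarrow> emitted s' n"
  unfolding emitted_def piece_at_def by simp

text \<open>On entering region \<open>r\<close>, the basis is the one that is optimal at its sample point, and the last breakpoint is the left
  end of the region.\<close>

definition region_start :: "state \<Rightarrow> (nat \<times> nat) list \<Rightarrow> nat \<Rightarrow> bool" where
  "region_start s D r \<longleftrightarrow> (\<exists>B n. basis_state s B \<and> opt_basis M (mu (rmem s ''cut'') (nmem s ''cutf'') r) B \<and>
     emitted s n \<and> (n = 0 \<longrightarrow> r = 0) \<and> (0 < n \<longrightarrow> 0 < r \<and> rmem s ''bp'' (n - 1) = rmem s ''cut'' r))"

definition solved :: "state \<Rightarrow> bool" where
  "solved s \<longleftrightarrow> (\<exists>n. emitted s n \<and> nmem s ''vital'' n < m \<and>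
     (\<forall>l\<in>I. (0 < n \<longrightarrow> rmem s ''bp'' (n - 1) \<le> l) \<longrightarrow> piece_at s n l))"

definition region_time :: real where
  "region_time = H m + f m + 40 + 60 * real k * (1 + log 2 (real k))"

text \<open>Inside the region, an element outside the basis is at most as vital as an element of the basis, so the upper
  envelope of the \<open>k\<close> lines of the basis elements is the optimal value.\<close>

lemma wp_region:
  assumes inp: "inputs s" and D: "cuts_state s D" and r: "nmem s ''r'' 0 = r" "r \<le> length D" and k0: "0 < k"
    and start: "region_start s D r"
    and Q: "\<And>s' t'. changes_only region s s' \<Longrightarrow> (r < length D \<Longrightarrow> region_start s' D (Suc r)) \<Longrightarrow>
      (r = length D \<Longrightarrow> solved s') \<Longrightarrow> t' \<le> t + region_time \<Longrightarrow> Q s' t'"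
  shows "wp region Q s t"
proof -
  define cu where "cu = rmem s ''cut''"
  define cf where "cf = nmem s ''cutf''"
  define u where "u = mu cu cf r"
  have cuts: "cut_points cu cf D" and N: "nmem s ''N'' 0 = length D"
    and Dr: "\<And>i. i < length D \<Longrightarrow> nmem s ''ce'' (nmem s ''ord'' i) = fst (D ! i)"
      "\<And>i. i < length D \<Longrightarrow> nmem s ''cf'' (nmem s ''ord'' i) = snd (D ! i)"
    using D unfolding cuts_state_def cu_def cf_def by auto
  obtain B n where B: "basis_state s B" "opt_basis M u B"
    and em: "emitted s n" "n = 0 \<longrightarrow> r = 0" "0 < n \<longrightarrow> 0 < r \<and> rmem s ''bp'' (n - 1) = cu r"
    using start unfolding region_start_def u_def cu_def cf_def by blast
  have bB: "basis F B" using opt_basis_min[OF B(2)] by (simp add: min_weight_basis_def)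
  then have cB: "card B = k" and Bm: "B \<subseteq> {..<m}"
    using basis_card indep_subset_ground by (auto simp: basis_iff)
  have ks: "nmem s ''k'' 0 = k" using B(1) cB by (simp add: basis_state_def)
  have mk: "marked M s ''inB'' = B" using B(1) by (simp add: basis_state_def)
  have uI: "u \<in> I" unfolding u_def by (rule mu_mem[OF cuts r(2)])
  define bl where "bl = nmem s ''bl''"
  have bl: "bl j \<in> B" if "j < k" for j using B(1) that cB by (simp add: basis_state_def bl_def)
  have bl_ex: "\<exists>j<k. bl j = e" if "e \<in> B" for e
  proof -
    have "nmem s ''pos'' e < k" "bl (nmem s ''pos'' e) = e" using B(1) that cB by (simp_all add: basis_state_def bl_def)
    then show ?thesis by blast
  qed
  define s1 where "s1 = write_replacements M (rwrite s ''mu'' 0 u) B u ''rep''"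
  let ?tail = "Cond (NLess (V ''r'') (V ''N'')) (RAssign ''bp'' (V ''n'') (RRead ''cut'' next_r);; incr ''n'';; swap) Skip"
  have "wp basis_lines (wp (sort_by ''lord'' ''ls'' ''k'') (wp envelope (wp emit (wp ?tail Q)))) s1 (t + 3 + H m)"
  proof (rule wp_basis_lines)
    show "inputs s1" by (rule inputs_cong[OF inp]) (auto simp: s1_def)
    show "basis_state s1 B" by (rule basis_state_cong[OF B(1)]) (auto simp: s1_def)
    show "B \<subseteq> {..<m}" by fact
    show "nmem s1 ''rep'' e < m" if "e \<in> B" for e
      using replacement_correct(1)[OF that bB] that unfolding s1_def by simp
    fix s2 t2
    assume ch2: "changes_only basis_lines s1 s2"
      and li: "\<And>j l. j < card B \<Longrightarrow> line (rmem s2 ''li'') (rmem s2 ''ls'') j l =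
         set_weight a b B l - weight a b (nmem s1 ''bl'' j) l + weight a b (nmem s1 ''rep'' (nmem s1 ''bl'' j)) l"
      and lord: "\<And>j. j < card B \<Longrightarrow> nmem s2 ''lord'' j = j"
      and t2: "t2 \<le> t + 3 + H m + 6 + 9 * real (card B)"
    define c where "c = rmem s2 ''li''"
    define d where "d = rmem s2 ''ls''"
    have line: "line c d j l = set_weight a b B l - weight a b (bl j) l + weight a b (replacement M B u (bl j)) l"
      if "j < k" for j l
      using li[of j l] that cB bl[OF that] unfolding c_def d_def s1_def bl_def by simp
    have k2: "nmem s2 ''k'' 0 = k" using ch2 ks by (simp add: changes_only_def s1_def)
    show "wp (sort_by ''lord'' ''ls'' ''k'') (wp envelope (wp emit (wp ?tail Q))) s2 t2"
    proof (rule wp_sort_by[OF k2])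
      fix s3 t3
      assume ch3: "changes_only (sort_by ''lord'' ''ls'' ''k'') s2 s3"
        and ms: "mset (map (nmem s3 ''lord'') [0..<k]) = mset (map (nmem s2 ''lord'') [0..<k])"
        and srt: "\<And>i j. i < j \<Longrightarrow> j < k \<Longrightarrow> rmem s2 ''ls'' (nmem s3 ''lord'' i) \<le> rmem s2 ''ls'' (nmem s3 ''lord'' j)"
        and t3: "t3 \<le> t2 + 2 + 24 * real k * (1 + log 2 (real k))"
      have "map (nmem s2 ''lord'') [0..<k] = [0..<k]" using lord cB by (intro map_idI) auto
      then have "set (map (nmem s3 ''lord'') [0..<k]) = set [0..<k]" using mset_eq_setD[OF ms] by simp
      then have od: "nmem s3 ''lord'' ` {..<k} = {..<k}" by (simp add: lessThan_atLeast0)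
      have fr3: "rmem s3 ''ls'' = d" "rmem s3 ''li'' = c" "nmem s3 ''k'' 0 = k"
        using ch3 k2 by (simp_all add: changes_only_def c_def d_def)
      show "wp envelope (wp emit (wp ?tail Q)) s3 t3"
      proof (rule wp_envelope[OF fr3(3)])
        show "rmem s3 ''ls'' (nmem s3 ''lord'' i) \<le> rmem s3 ''ls'' (nmem s3 ''lord'' j)" if "i < j" "j < k" for i j
          using srt[OF that] fr3 by (simp add: d_def)
        fix s4 t4
        assume ch4: "changes_only envelope s3 s4" and st4: "stack_state s4 (nmem s3 ''lord'' ` {..<k})"
          and p4: "nmem s4 ''p'' 0 \<le> k" and t4: "t4 \<le> t3 + 3 + 12 * real k"
        define p where "p = nmem s4 ''p'' 0"
        define K where "K = nmem s4 ''stk''"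
        define st where "st = rmem s4 ''st''"
        have fr4: "rmem s4 ''li'' = c" "rmem s4 ''ls'' = d" "rmem s4 ''cut'' = cu" "nmem s4 ''cutf'' = cf"
            "nmem s4 ''r'' 0 = r" "nmem s4 ''N'' 0 = length D" "nmem s4 ''bl'' = bl" "nmem s4 ''n'' = nmem s ''n''"
            "rmem s4 ''bp'' = rmem s ''bp''" "nmem s4 ''vital'' = nmem s ''vital''"
            "rmem s4 ''icpt'' = rmem s ''icpt''" "rmem s4 ''slope'' = rmem s ''slope''"
          using ch2 ch3 ch4 r(1) N by (simp_all add: changes_only_def s1_def c_def d_def cu_def cf_def bl_def)
        have up: "upper_stack c d {..<k} p K st" and cov: "covered_by c d {..<k} p K"
          using st4 fr4 unfolding stack_state_def od p_def K_def st_def by simp_all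
        have p0: "0 < p" using cov k0 unfolding covered_by_def by fastforce
        have Kk: "K i < k" if "i < p" for i using up that unfolding upper_stack_def by simp
        have em4: "emitted s4 n" by (rule emitted_cong[OF em(1)]) (auto simp: fr4)
        have best: "best_at (bl (K i)) (c (K i)) (d (K i)) l"
          if i: "i < p" and l: "l \<in> I" "closed_region cu cf r l" and x: "0 < i \<Longrightarrow> st i \<le> l" "Suc i < p \<Longrightarrow> l \<le> st (Suc i)" for i l
        proof -
          note reg = region_values[OF B(2) region_no_crossing[OF cuts r(2) l(2), folded u_def]]
          have yv: "y_val (bl j) l = line c d j l" if "j < k" for j
            using reg(2)[OF _ bl[OF that]] line[OF that] by simp
          have le: "line c d j l \<le> line c d (K i) l" if "j < k" for j
          proof -
            have "\<exists>i'<p. line c d j l \<le> line c d (K i') l" using cov that by (simp add: covered_by_def)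
            then obtain i' where i': "i' < p" "line c d j l \<le> line c d (K i') l" by blast
            have "line c d (K i') l \<le> line c d (K i) l" by (rule upper_stack_piece[OF up i i'(1) x])
            then show ?thesis using i'(2) by simp
          qed
          have "y_val g l \<le> y_val (bl (K i)) l" if "g < m" for g
          proof (cases "g \<in> B")
            case True
            then obtain j where "j < k" "bl j = g" using bl_ex by blast
            then show ?thesis using yv[of j] yv[OF Kk[OF i]] le[of j] by simp
          next
            case False
            then show ?thesis using reg(3)[OF _ that] reg(4)[OF _ bl[OF Kk[OF i]]] by simp
          qed
          then show ?thesis using yv[OF Kk[OF i]] unfolding best_at_def line_def by simp
        qed
        show "wp emit (wp ?tail Q) s4 t4"
        proof (rule wp_emit[where D = D and r = r and n = n and p = p])
          show "cut_points (rmem s4 ''cut'') (nmem s4 ''cutf'') D" using cuts fr4 by simp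
          show "nmem s4 ''r'' 0 = r" "r \<le> length D" "emitted s4 n" "nmem s4 ''p'' 0 = p" "0 < p"
            using fr4 r em4 p0 by (simp_all add: p_def)
          show "n = 0 \<Longrightarrow> r = 0" "0 < n \<Longrightarrow> 0 < r \<and> rmem s4 ''bp'' (n - 1) = rmem s4 ''cut'' r"
            using em(2,3) fr4 by simp_all
          show "nmem s4 ''bl'' (nmem s4 ''stk'' i) < m" if "i < p" for i
            using bl[OF Kk[OF that]] Bm fr4 unfolding K_def by auto
          show "rmem s4 ''st'' (Suc i) < rmem s4 ''st'' (Suc (Suc i))" if "Suc (Suc i) < p" for i
            using up that unfolding upper_stack_def st_def by simp
          show "best_at (nmem s4 ''bl'' (nmem s4 ''stk'' i)) (rmem s4 ''li'' (nmem s4 ''stk'' i)) (rmem s4 ''ls'' (nmem s4 ''stk'' i)) l"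
            if "i < p" "l \<in> I" "closed_region (rmem s4 ''cut'') (nmem s4 ''cutf'') r l"
              "0 < i \<Longrightarrow> rmem s4 ''st'' i \<le> l" "Suc i < p \<Longrightarrow> l \<le> rmem s4 ''st'' (Suc i)" for i l
            using best[of i l] that fr4 unfolding K_def st_def by simp
          fix s5 t5 n'
          assume ch5: "changes_only emit s4 s5" and em5: "emitted s5 n'" and v5: "nmem s5 ''vital'' n' < m"
            and pc: "\<And>l. l \<in> I \<Longrightarrow> (0 < n' \<Longrightarrow> rmem s5 ''bp'' (n' - 1) \<le> l) \<Longrightarrow>
              (0 < nmem s4 ''cutf'' (Suc r) \<Longrightarrow> l \<le> rmem s4 ''cut'' (Suc r)) \<Longrightarrow> piece_at s5 n' l"
            and lt: "0 < n' \<Longrightarrow> 0 < nmem s4 ''cutf'' (Suc r) \<Longrightarrow> rmem s5 ''bp'' (n' - 1) < rmem s4 ''cut'' (Suc r)"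
            and t5: "t5 \<le> t4 + 7 + 10 * real p"
          have nn: "nmem s5 ''n'' 0 = n'" using em5 by (simp add: emitted_def)
          have fr5: "rmem s5 ''cut'' = cu" "nmem s5 ''cutf'' = cf" "nmem s5 ''r'' 0 = r" "nmem s5 ''N'' 0 = length D"
            using ch5 fr4 by (simp_all add: changes_only_def)
          have same5: "nmem s5 x = nmem s x" if "x \<in> {''inB'', ''k'', ''bl'', ''pos'', ''ce'', ''cf'', ''ord''}" for x
          proof -
            have "nmem s5 ''inB'' = nmem s ''inB''" "nmem s5 ''k'' = nmem s ''k''" "nmem s5 ''bl'' = nmem s ''bl''"
              "nmem s5 ''pos'' = nmem s ''pos''" "nmem s5 ''ce'' = nmem s ''ce''" "nmem s5 ''cf'' = nmem s ''cf''"
              "nmem s5 ''ord'' = nmem s ''ord''"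
              using ch2 ch3 ch4 ch5 by (simp_all add: changes_only_def s1_def)
            then show ?thesis using that by auto
          qed
          have ch: "changes_only region s s5"
            using ch2 ch3 ch4 ch5 unfolding changes_only_def by (simp add: s1_def) (simp add: region_def)
          have pk: "real p \<le> real k" using p4 by (simp add: p_def)
          have lk: "0 \<le> real k * log 2 (real k)" using k0 by simp
          have time: "t5 + 13 + f m \<le> t + region_time"
            using t2 t3 t4 t5 pk lk cB unfolding region_time_def by (simp add: algebra_simps)
          show "wp ?tail Q s5 t5"
          proof (cases "r < length D")
            case True
            have fl: "0 < cf (Suc r)" by (rule cut_flag[OF cuts True])
            have xI: "cu (Suc r) \<in> I" by (rule strictly_inside_mem[OF cut_inside[OF cuts True]])
            let ?s6 = "nwrite (rwrite s5 ''bp'' n' (cu (Suc r))) ''n'' 0 (Suc n')"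
            have em6: "emitted ?s6 (Suc n')"
            proof (rule emitted_Suc[OF em5 xI _ v5])
              show "rmem s5 ''bp'' (n' - 1) < cu (Suc r)" if "0 < n'" using lt that fl fr4 by simp
              show "piece_at s5 n' l" if "l \<in> I" "0 < n' \<Longrightarrow> rmem s5 ''bp'' (n' - 1) \<le> l" "l \<le> cu (Suc r)" for l
                using pc[of l] that fr4 by simp
            qed
            obtain e g where eg: "D ! r = (e, g)" by (cases "D ! r")
            have "(e, g) \<in> set D" using eg True nth_mem by metis
            moreover have "\<forall>(e, g)\<in>set D. e < m \<and> g < m \<and> b g < b e \<and> strictly_inside (cross e g)"
              using cuts by (simp add: cut_points_def all_candidates_def)
            ultimately have eg': "e < m" "g < m" by auto
            have B6: "basis_state ?s6 B" by (rule basis_state_cong[OF B(1)]) (auto simp: same5)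
            have "wp swap Q ?s6 (t5 + 3)"
            proof (rule wp_swap[OF B6, where e = e and g = g])
              show "nmem ?s6 ''ce'' (nmem ?s6 ''ord'' (nmem ?s6 ''r'' 0)) = e"
                "nmem ?s6 ''cf'' (nmem ?s6 ''ord'' (nmem ?s6 ''r'' 0)) = g"
                using Dr[OF True] eg same5 fr5 by simp_all
              show "e < m" "g < m" by fact+
              fix s7 t7
              let ?B = "if e \<in> B \<and> g \<notin> B \<and> insert g (B - {e}) \<in> F then insert g (B - {e}) else B"
              assume ch7: "changes_only swap ?s6 s7" and B7: "basis_state s7 ?B" and t7: "t7 \<le> t5 + 3 + 10 + f m"
              have fr7: "rmem s7 ''cut'' = cu" "nmem s7 ''cutf'' = cf" "rmem s7 ''bp'' n' = cu (Suc r)"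
                using ch7 fr5 by (simp_all add: changes_only_def)
              have em7: "emitted s7 (Suc n')"
                by (rule emitted_cong[OF em6 changes_only_nmem[OF ch7] changes_only_rmem[OF ch7]]) auto
              obtain B' where B': "opt_basis M (mu cu cf (Suc r)) B'" using ex1_opt_basis' by blast
              then have "B' = ?B" using opt_basis_next_region[OF cuts True _ B' eg] B(2) unfolding u_def by blast
              then have start7: "region_start s7 D (Suc r)" unfolding region_start_def
                using B7 B' em7 fr7 by (intro exI[of _ ?B] exI[of _ "Suc n'"]) simp
              show "Q s7 t7"
              proof (rule Q)
                show "changes_only region s s7"
                  using ch ch7 unfolding changes_only_def by simp (simp add: region_def)
                show "solved s7" if "r = length D" using that True by simp
                show "region_start s7 D (Suc r)" by (rule start7)
                show "t7 \<le> t + region_time" using t7 time by simp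
              qed
            qed
            then show ?thesis using True fr5 nn by (simp add: add.commute)
          next
            case False
            then have rD: "r = length D" using r(2) by simp
            have "piece_at s5 n' l" if "l \<in> I" "0 < n' \<longrightarrow> rmem s5 ''bp'' (n' - 1) \<le> l" for l
            proof (rule pc[OF that(1)])
              show "rmem s5 ''bp'' (n' - 1) \<le> l" if "0 < n'" using \<open>0 < n' \<longrightarrow> _\<close> that by simp
              assume "0 < nmem s4 ''cutf'' (Suc r)"
              then have "bdd_above I" "cu (Suc r) = Sup I" using cut_ends[OF cuts] fr4 rD by simp_all
              then show "l \<le> rmem s4 ''cut'' (Suc r)" using cSup_upper[OF that(1)] fr4 by simp
            qed
            then have "solved s5" unfolding solved_def using em5 v5 by blast
            then have "Q s5 u'" if "u' \<le> t5 + 2" for u'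
              using ch rD time that costs by (intro Q) simp_all
            then show ?thesis using False fr5 by simp
          qed
        qed
      qed
    qed simp_all
  qed
  then show ?thesis unfolding region_def
    using uI B(2) mk r(1) by (simp add: s1_def u_def cu_def cf_def ground_size_M param_interval_M add.commute add.left_commute)
qed

lemma inputs_input_state: "inputs (input_state M)"
  unfolding inputs_def input_state_def Let_def
  by (simp add: ground_size_M param_interval_M const_coeff_M slope_coeff_M)

lemma input_state_zero:
  "x \<notin> {''m'', ''lo_kind'', ''hi_kind''} \<Longrightarrow> nmem (input_state M) x = (\<lambda>i. 0)"
  "x \<notin> {''a'', ''b'', ''lo'', ''hi''} \<Longrightarrow> rmem (input_state M) x = (\<lambda>i. 0)"
  unfolding input_state_def Let_def by auto

definition total_time :: real where
  "total_time = 2 + real m * (candidates_time + 2) +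
     (20 + 14 * (real k * real m) + 24 * (2 * real k * real m) * (1 + log 2 (2 * real k * real m))) + 3 +
     (2 + real m * (20 + f m + 5 * real m)) + 5 +
     (if k = 0 then 0 else (2 * real k * real m + 1) * (region_time + 2))"

lemma wp_interdiction_program:
  "wp interdiction_program (\<lambda>s t. solved s \<and> t \<le> total_time) (input_state M) 0"
  unfolding interdiction_program_def wp_Seq
proof (rule wp_generate_candidates[OF inputs_input_state])
  let ?s0 = "input_state M"
  let ?Q = "\<lambda>s t. solved s \<and> t \<le> total_time"
  let ?loop = "''N1'' ::= NAdd (V ''N'') (NConst (Suc 0));; For ''r'' ''N1'' region"
  let ?rest = "Cond (NLess (NConst 0) (V ''k'')) ?loop Skip"
  show "nmem ?s0 ''N'' 0 = 0" by (simp add: input_state_zero)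
  fix s1 t1 L
  assume ch1: "changes_only generate_candidates ?s0 s1" and rec: "recs s1 L" and L: "all_candidates L"
    and t1: "t1 \<le> 0 + 2 + real m * (candidates_time + 2)"
  have inp1: "inputs s1" using inputs_changes_only[OF inputs_input_state ch1] by simp
  have len: "length L \<le> 2 * k * m" using L by (simp add: all_candidates_def)
  show "wp sort_cuts (wp set_mu (wp greedy (wp ?rest ?Q))) s1 t1"
  proof (rule wp_sort_cuts[OF inp1 rec L])
    fix s2 t2 D
    assume ch2: "changes_only sort_cuts s1 s2" and D: "cuts_state s2 D" "length D = length L"
      and t2: "t2 \<le> t1 + 20 + 7 * real (length L) + 24 * real (length L) * (1 + log 2 (real (length L)))"
    have inp2: "inputs s2" using inputs_changes_only[OF inp1 ch2] by simp
    define cu where "cu = rmem s2 ''cut''"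
    define cf where "cf = nmem s2 ''cutf''"
    have zero: "nmem s2 ''r'' = (\<lambda>i. 0)" "nmem s2 ''k'' = (\<lambda>i. 0)" "nmem s2 ''inB'' = (\<lambda>i. 0)"
        "nmem s2 ''done'' = (\<lambda>i. 0)" "nmem s2 ''n'' = (\<lambda>i. 0)" "nmem s2 ''vital'' = (\<lambda>i. 0)"
        "rmem s2 ''icpt'' = (\<lambda>i. 0)" "rmem s2 ''slope'' = (\<lambda>i. 0)"
      using ch1 ch2 by (simp_all add: changes_only_def input_state_zero)
    let ?s = "rwrite s2 ''mu'' 0 (mu cu cf 0)"
    have "wp greedy (wp ?rest ?Q) ?s (t2 + 3)"
    proof (rule wp_greedy)
      show "inputs ?s" "nmem ?s ''k'' 0 = 0" "marked M ?s ''inB'' = {}" "marked M ?s ''done'' = {}"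
        using inp2 zero by (simp_all add: marked_def)
      fix s3 t3 B
      assume ch3: "changes_only greedy ?s s3" and B: "basis_state s3 B" "opt_basis M (rmem ?s ''mu'' 0) B"
        and t3: "t3 \<le> t2 + 3 + 2 + real m * (20 + f m + 5 * real m)"
      have optB: "opt_basis M (mu cu cf 0) B" using B(2) by simp
      have cB: "card B = k" using basis_card opt_basis_min[OF B(2)] by (simp add: min_weight_basis_def)
      have k3: "nmem s3 ''k'' 0 = k" using B(1) cB by (simp add: basis_state_def)
      have inp3: "inputs s3" using inputs_changes_only[OF _ ch3] inp2 by simp
      have D3: "cuts_state s3 D" by (rule cuts_state_cong[OF D(1)]) (auto simp: changes_only_nmem[OF ch3] changes_only_rmem[OF ch3])
      have fr3: "rmem s3 ''cut'' = cu" "nmem s3 ''cutf'' = cf" "nmem s3 ''n'' = (\<lambda>i. 0)" "nmem s3 ''vital'' = (\<lambda>i. 0)"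
          "rmem s3 ''icpt'' = (\<lambda>i. 0)" "rmem s3 ''slope'' = (\<lambda>i. 0)"
        using ch3 zero by (simp_all add: changes_only_def cu_def cf_def)
      have em3: "emitted s3 0" unfolding emitted_def using fr3 by simp
      have lenr: "real (length L) \<le> 2 * real k * real m"
        using len by (metis of_nat_le_iff of_nat_mult of_nat_numeral)
      have "real (length L) * (1 + log 2 (real (length L))) \<le> 2 * real k * real m * (1 + log 2 (2 * real k * real m))"
      proof (cases "k = 0")
        case False
        then show ?thesis using n_log_n_mono[OF len] m_pos by simp
      qed (use len in simp)
      then have time: "t3 + 5 + (if k = 0 then 0 else (2 * real k * real m + 1) * (region_time + 2)) \<le> total_time"
        using t1 t2 t3 lenr unfolding total_time_def by simp
      show "wp ?rest ?Q s3 t3"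
      proof (cases "k = 0")
        case True
        \<comment> \<open>In rank \<open>0\<close> all values are \<open>0\<close>, and the zeros in the initial memory are a correct output.\<close>
        have "y_val g l = 0" if "g < m" for g l
        proof -
          obtain B' where B': "opt_basis M l B'" using ex1_opt_basis' by blast
          have "basis F B'" using opt_basis_min[OF B'] by (simp add: min_weight_basis_def)
          then have "B' = {}" using basis_card[of B'] True indep_finite[of B'] by (auto simp: basis_iff)
          then show ?thesis using region_values(3)[OF B', of l g] that by (simp add: set_weight_def)
        qed
        then have "solved s3" unfolding solved_def piece_at_def best_at_def
          using em3 fr3 m_pos by (intro exI[of _ 0]) simp
        then show ?thesis using time True k3 by simp
      next
        case False
        then have k0: "0 < k" by simp
        have N3: "nmem s3 ''N'' 0 = length D" using D3 by (simp add: cuts_state_def)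
        let ?s4 = "nwrite s3 ''N1'' 0 (Suc (length D))"
        have "wp (For ''r'' ''N1'' region) ?Q ?s4 (t3 + 2)"
        proof (rule wp_For[where P = "\<lambda>r s t. (r \<le> length D \<longrightarrow> region_start s D r) \<and> (r = Suc (length D) \<longrightarrow> solved s) \<and>
            t \<le> t3 + 3 + real r * (region_time + 2)"])
          have "region_start (nwrite ?s4 ''r'' 0 0) D 0" unfolding region_start_def
            by (intro exI[of _ B] exI[of _ 0] conjI basis_state_cong[OF B(1)] emitted_cong[OF em3])
              (use optB fr3 in auto)
          then show "(0 \<le> length D \<longrightarrow> region_start (nwrite ?s4 ''r'' 0 0) D 0) \<and> (0 = Suc (length D) \<longrightarrow> solved (nwrite ?s4 ''r'' 0 0)) \<and>
            t3 + 2 + 1 \<le> t3 + 3 + real 0 * (region_time + 2)" by simp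
        next
          fix r s t assume r: "r < nmem ?s4 ''N1'' 0" "nmem s ''r'' 0 = r" and ch: "changes_only (For ''r'' ''N1'' region) ?s4 s"
            and P: "(r \<le> length D \<longrightarrow> region_start s D r) \<and> (r = Suc (length D) \<longrightarrow> solved s) \<and> t \<le> t3 + 3 + real r * (region_time + 2)"
          have rD: "r \<le> length D" using r(1) by simp
          have inp: "inputs s" using inputs_changes_only[OF _ ch] inp3 by simp
          have D': "cuts_state s D" by (rule cuts_state_cong[OF D3]) (auto simp: changes_only_nmem[OF ch] changes_only_rmem[OF ch])
          have st: "region_start s D r" using P rD by simp
          show "wp region (\<lambda>s'' t''. (Suc r \<le> length D \<longrightarrow> region_start (nwrite s'' ''r'' 0 (Suc r)) D (Suc r)) \<and>
            (Suc r = Suc (length D) \<longrightarrow> solved (nwrite s'' ''r'' 0 (Suc r))) \<and>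
            t'' + 1 \<le> t3 + 3 + real (Suc r) * (region_time + 2)) s (t + 1)"
          proof (rule wp_region[OF inp D' r(2) rD k0 st])
            fix s' t' assume next_r: "r < length D \<Longrightarrow> region_start s' D (Suc r)"
              and last_r: "r = length D \<Longrightarrow> solved s'" and t': "t' \<le> t + 1 + region_time"
            have w1: "region_start (nwrite s' ''r'' 0 (Suc r)) D (Suc r)" if rs: "region_start s' D (Suc r)"
            proof -
              obtain B n where *: "basis_state s' B" "opt_basis M (mu (rmem s' ''cut'') (nmem s' ''cutf'') (Suc r)) B"
                "emitted s' n" "n = 0 \<longrightarrow> Suc r = 0" "0 < n \<longrightarrow> 0 < Suc r \<and> rmem s' ''bp'' (n - 1) = rmem s' ''cut'' (Suc r)"
                using rs unfolding region_start_def by blast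
              show ?thesis unfolding region_start_def
                by (intro exI[of _ B] exI[of _ n] conjI basis_state_cong[OF *(1)] emitted_cong[OF *(3)]) (use * in auto)
            qed
            have w2: "solved (nwrite s' ''r'' 0 (Suc r))" if sv: "solved s'"
            proof -
              obtain n where *: "emitted s' n" "nmem s' ''vital'' n < m"
                "\<forall>l\<in>I. (0 < n \<longrightarrow> rmem s' ''bp'' (n - 1) \<le> l) \<longrightarrow> piece_at s' n l" using sv unfolding solved_def by blast
              have "emitted (nwrite s' ''r'' 0 (Suc r)) n" by (rule emitted_cong[OF *(1)]) auto
              then show ?thesis unfolding solved_def using * by (intro exI[of _ n]) (simp add: piece_at_def)
            qed
            show "(Suc r \<le> length D \<longrightarrow> region_start (nwrite s' ''r'' 0 (Suc r)) D (Suc r)) \<and>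
              (Suc r = Suc (length D) \<longrightarrow> solved (nwrite s' ''r'' 0 (Suc r))) \<and>
              t' + 1 \<le> t3 + 3 + real (Suc r) * (region_time + 2)"
            proof (intro conjI impI)
              show "region_start (nwrite s' ''r'' 0 (Suc r)) D (Suc r)" if "Suc r \<le> length D"
                using w1 next_r that by simp
              show "solved (nwrite s' ''r'' 0 (Suc r))" if "Suc r = Suc (length D)"
                by (rule w2, rule last_r) (use that in simp)
              show "t' + 1 \<le> t3 + 3 + real (Suc r) * (region_time + 2)"
                using t' P by (simp add: algebra_simps)
            qed
          qed
        next
          fix s t assume "changes_only (For ''r'' ''N1'' region) ?s4 s"
            and P: "(nmem ?s4 ''N1'' 0 \<le> length D \<longrightarrow> region_start s D (nmem ?s4 ''N1'' 0)) \<and>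
              (nmem ?s4 ''N1'' 0 = Suc (length D) \<longrightarrow> solved s) \<and> t \<le> t3 + 3 + real (nmem ?s4 ''N1'' 0) * (region_time + 2)"
          have "0 \<le> real k * (1 + log 2 (real k))" using k0 by simp
          then have "0 \<le> region_time + 2" unfolding region_time_def using costs by simp
          then have "real (Suc (length D)) * (region_time + 2) \<le> (2 * real k * real m + 1) * (region_time + 2)"
            using lenr D(2) by (intro mult_right_mono) auto
          then show "solved s \<and> t + 1 \<le> total_time" using P time False by simp
        qed simp_all
        then show ?thesis using k3 k0 N3 by (simp add: add.commute)
      qed
    qed
    then show "wp set_mu (wp greedy (wp ?rest ?Q)) s2 t2" using zero by (simp add: cu_def cf_def)
  qed
qed


text \<open>Two terms need a reason. As \<open>k \<le> m\<close>, the number of candidates is \<open>O(m\<^sup>2)\<close> and its logarithm \<open>O(log m)\<close>. The time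
  \<open>O(m k\<^sup>2)\<close> for scanning lists of length \<open>k\<close> is covered by \<open>m k H\<close> if \<open>k = 1\<close>, and by \<open>m k\<^sup>2 log k\<close>
  otherwise, since then \<open>log 2 k \<ge> 1\<close>.\<close>

lemma total_time_bound:
  "total_time \<le> 2000 * ((real m)\<^sup>2 * (log 2 (real m) + f m) + real m * G m +
     real m * real k * (H m + real k * log 2 (real k)))"
proof -
  define x where "x = real m"
  define y where "y = real k"
  define lx where "lx = log 2 x"
  define ly where "ly = log 2 y"
  define U1 where "U1 = x * x * lx"
  define U2 where "U2 = x * x * f m"
  define U3 where "U3 = x * G m"
  define U4 where "U4 = x * y * H m"
  define U5 where "U5 = x * y * (y * ly)"
  have x1: "1 \<le> x" using m_pos unfolding x_def by simp
  have yx: "0 \<le> y" "y \<le> x" using rank_le_card_ground unfolding x_def y_def by simp_all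
  have lx0: "0 \<le> lx" using x1 unfolding lx_def by simp
  have xx: "x \<le> x * x" "1 \<le> x * x" using mult_mono[of 1 x 1 x] mult_left_mono[of 1 x x] x1 by simp_all
  have xxU2: "x * x \<le> U2" unfolding U2_def using mult_left_mono[OF costs(1), of "x * x"] by simp
  have U2: "1 \<le> U2" "x \<le> U2" using xx xxU2 by linarith+
  have U1: "0 \<le> U1" unfolding U1_def using x1 lx0 by simp
  have U3: "0 \<le> U3" unfolding U3_def using x1 costs by simp
  have xyxx: "x * y \<le> x * x" using yx x1 by (intro mult_left_mono) auto
  then have xy: "x * y \<le> U2" using xxU2 by linarith
  have xf: "x * f m \<le> U2" unfolding U2_def using xx(1) costs by (intro mult_right_mono) auto
  have xyf: "x * y * f m \<le> U2" unfolding U2_def using xyxx costs by (intro mult_right_mono) auto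
  have ly_cases: "y = 0 \<or> y = 1 \<or> 2 \<le> y" unfolding y_def by (auto simp: numeral_2_eq_2)
  have ly0: "0 \<le> y * ly" using ly_cases unfolding ly_def by auto
  have U4: "0 \<le> U4" unfolding U4_def using x1 yx costs by simp
  have U5: "0 \<le> U5" unfolding U5_def using x1 yx ly0 by simp
  have xyy: "x * y * y \<le> U4 + U5"
  proof -
    have "y \<le> H m + y * ly"
      using ly_cases
    proof (elim disjE)
      assume "2 \<le> y"
      then have "1 \<le> ly" unfolding ly_def by (subst le_log_iff) auto
      then have "y * 1 \<le> y * ly" using yx by (intro mult_left_mono) auto
      then show ?thesis using costs by simp
    qed (use costs ly0 in auto)
    then have "x * y * y \<le> x * y * (H m + y * ly)" using x1 yx by (intro mult_left_mono) auto
    then show ?thesis unfolding U4_def U5_def by (simp add: algebra_simps)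
  qed
  have ct: "candidates_time = G m + 10 + 60 * x * (1 + lx) + 2 * x * f m + 2 * y * (20 + 5 * y)"
    unfolding candidates_time_def x_def y_def lx_def ..
  have t1: "x * (candidates_time + 2) \<le> U3 + 12 * U2 + 60 * U2 + 60 * U1 + 2 * U2 + 40 * U2 + 10 * (U4 + U5)"
  proof -
    have "x * (candidates_time + 2) = U3 + 12 * x + 60 * (x * x) + 60 * U1 + 2 * U2 + 40 * (x * y) + 10 * (x * y * y)"
      unfolding ct U1_def U2_def U3_def by (simp add: algebra_simps)
    then show ?thesis using U2 xxU2 xy xyy by simp
  qed
  have t2: "2 * y * x * (1 + log 2 (2 * y * x)) \<le> 4 * U2 + 4 * U1"
  proof (cases "y = 0")
    case False
    then have y1: "1 \<le> y" using ly_cases by auto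
    have "log 2 (2 * y * x) \<le> log 2 (2 * x * x)" using y1 yx x1 by (intro log_mono mult_mono) auto
    also have "\<dots> = 1 + 2 * lx" using x1 unfolding lx_def by (simp add: log_mult)
    finally have "2 * y * x * (1 + log 2 (2 * y * x)) \<le> 2 * y * x * (2 + 2 * lx)"
      using y1 x1 by (intro mult_left_mono) auto
    also have "\<dots> \<le> 2 * x * x * (2 + 2 * lx)" using yx x1 lx0 by (intro mult_right_mono mult_mono) auto
    also have "\<dots> = 4 * (x * x) + 4 * U1" unfolding U1_def by (simp add: algebra_simps)
    finally show ?thesis using xxU2 by simp
  qed (use U1 U2 in simp)
  have t3: "x * (20 + f m + 5 * x) \<le> 26 * U2"
  proof -
    have "x * (20 + f m + 5 * x) = 20 * x + x * f m + 5 * (x * x)" by (simp add: algebra_simps)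
    then show ?thesis using U2 xf xxU2 by simp
  qed
  have t4: "(if k = 0 then 0 else (2 * y * x + 1) * (region_time + 2)) \<le> 3 * U4 + 3 * U2 + 126 * U2 + 180 * (U4 + U5) + 180 * U5"
  proof (cases "k = 0")
    case False
    then have y1: "1 \<le> y" unfolding y_def by simp
    have rt: "region_time = H m + f m + 40 + 60 * y * (1 + ly)" unfolding region_time_def y_def ly_def ..
    have "2 * y * x + 1 \<le> 3 * (x * y)" using mult_mono[of 1 x 1 y] x1 y1 by (simp add: mult.commute)
    moreover have "0 \<le> region_time + 2" unfolding rt using costs yx ly0 by (simp add: algebra_simps)
    ultimately have "(2 * y * x + 1) * (region_time + 2) \<le> 3 * (x * y) * (region_time + 2)" by (intro mult_right_mono) auto
    also have "\<dots> = 3 * U4 + 3 * (x * y * f m) + 126 * (x * y) + 180 * (x * y * y) + 180 * U5"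
      unfolding rt U4_def U5_def by (simp add: algebra_simps)
    also have "\<dots> \<le> 3 * U4 + 3 * U2 + 126 * U2 + 180 * (U4 + U5) + 180 * U5"
      using xyf xy xyy by simp
    finally show ?thesis using False by simp
  qed (use U2 U4 U5 in simp)
  have sum_up: "2 + p1 + (20 + 14 * p5 + 24 * p2) + 3 + (2 + p3) + 5 + p4 \<le> 2000 * (U1 + U2 + U3 + U4 + U5)"
    if "p1 \<le> U3 + 12 * U2 + 60 * U2 + 60 * U1 + 2 * U2 + 40 * U2 + 10 * (U4 + U5)" "p2 \<le> 4 * U2 + 4 * U1"
      "p3 \<le> 26 * U2" "p4 \<le> 3 * U4 + 3 * U2 + 126 * U2 + 180 * (U4 + U5) + 180 * U5" "p5 \<le> U2" for p1 p2 p3 p4 p5 :: real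
    using that U1 U2(1) U3 U4 U5 by (simp add: algebra_simps)
  have "total_time = 2 + x * (candidates_time + 2) + (20 + 14 * (x * y) + 24 * (2 * y * x * (1 + log 2 (2 * y * x)))) + 3 +
     (2 + x * (20 + f m + 5 * x)) + 5 + (if k = 0 then 0 else (2 * y * x + 1) * (region_time + 2))"
    unfolding total_time_def x_def y_def by (simp add: mult.commute mult.left_commute)
  also have "\<dots> \<le> 2000 * (U1 + U2 + U3 + U4 + U5)"
    by (rule sum_up[OF t1 t2 t3 t4 xy])
  also have "U1 + U2 + U3 + U4 + U5 = (real m)\<^sup>2 * (log 2 (real m) + f m) + real m * G m +
     real m * real k * (H m + real k * log 2 (real k))"
    unfolding U1_def U2_def U3_def U4_def U5_def x_def y_def lx_def ly_def
    by (simp add: power2_eq_square algebra_simps)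
  finally show ?thesis .
qed

end

lemma solved_solves_interdiction:
  assumes es: "encoded es F"
    and inst: "interdiction_machine (length es) (indep_sets (encode es F a b I)) (\<lambda>i. a (es ! i)) (\<lambda>i. b (es ! i))
      (encode es F a b I) f G H I"
    and s: "interdiction_machine.solved (length es) (indep_sets (encode es F a b I)) (\<lambda>i. a (es ! i)) (\<lambda>i. b (es ! i)) I s"
  shows "solves_interdiction es F a b I s"
proof -
  interpret encoded es F a b I by fact
  interpret X: interdiction_machine "length es" IF "\<lambda>i. a (h i)" "\<lambda>i. b (h i)" "encode es F a b I" f G H I by fact
  obtain n where n: "X.emitted s n" "nmem s ''vital'' n < length es"
    "\<forall>l\<in>I. (0 < n \<longrightarrow> rmem s ''bp'' (n - 1) \<le> l) \<longrightarrow> X.piece_at s n l"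
    using s unfolding X.solved_def by blast
  note em = n(1)[unfolded X.emitted_def]
  have vital: "nmem s ''vital'' i < length es" if "i \<le> n" for i using em n(2) that by (cases "i = n") auto
  have piece: "X.piece_at s i l"
    if "i \<le> n" "l \<in> I" "0 < i \<longrightarrow> rmem s ''bp'' (i - 1) \<le> l" "i < n \<longrightarrow> l \<le> rmem s ''bp'' i" for i l
    using em n(3) that by (cases "i = n") auto
  have correct: "most_vital (set es) F a b (h v) l \<and>
      optimal_value (set es) F a b l = interdicted_value (set es) F a b (h v) l \<and>
      optimal_value (set es) F a b l = c + l * d"
    if v: "v < length es" and best: "X.best_at v c d l" for v c d l
  proof -
    have le: "interdicted_value (set es) F a b g l \<le> interdicted_value (set es) F a b (h v) l" if g: "g \<in> set es" for g
    proof -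
      obtain i where i: "i < length es" "g = h i" using g by (metis in_set_conv_nth)
      have "X.y_val i l \<le> X.y_val v l" using conjunct1[OF best[unfolded X.best_at_def]] i(1) by simp
      then show ?thesis by (simp only: i(2) interdicted_value_N[OF i(1)] interdicted_value_N[OF v])
    qed
    have "optimal_value (set es) F a b l = interdicted_value (set es) F a b (h v) l"
      unfolding optimal_value_def by (rule Max_eqI) (use le v in auto)
    moreover have "interdicted_value (set es) F a b (h v) l = c + l * d"
      using conjunct2[OF best[unfolded X.best_at_def]] by (simp only: interdicted_value_N[OF v])
    ultimately show ?thesis using le v unfolding most_vital_def by simp
  qed
  have nn: "nmem s ''n'' 0 = n" using em by blast
  show ?thesis unfolding solves_interdiction_def Let_def nn
  proof (intro conjI allI impI ballI)
    fix i assume "i < n"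
    then show "rmem s ''bp'' i \<in> I" using em by blast
  next
    fix i j assume "i < j \<and> j < n"
    then show "rmem s ''bp'' i < rmem s ''bp'' j" using em by blast
  next
    fix i assume i: "i \<le> n"
    show "nmem s ''vital'' i < length es" by (rule vital[OF i])
    fix l assume l: "l \<in> I" "(0 < i \<longrightarrow> rmem s ''bp'' (i - 1) \<le> l) \<and> (i < n \<longrightarrow> l \<le> rmem s ''bp'' i)"
    have "X.piece_at s i l" using piece[OF i l(1)] l(2) by blast
    then show "most_vital (set es) F a b (h (nmem s ''vital'' i)) l"
      "optimal_value (set es) F a b l = interdicted_value (set es) F a b (h (nmem s ''vital'' i)) l"
      "optimal_value (set es) F a b l = rmem s ''icpt'' i + l * rmem s ''slope'' i"
      using correct[OF vital[OF i]] unfolding X.piece_at_def by blast+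
  qed
qed

theorem theorem4p5:
  "\<exists>(P :: com) (C :: real). \<forall>(E :: 'a set) F es a b I f G H.
     matroid E F \<and> E \<noteq> {} \<and> distinct es \<and> set es = E \<and>
     is_interval I \<and> I \<noteq> {} \<and>
     (\<forall>e\<in>E. \<exists>B. basis (restriction F (E - {e})) B \<and> card B = matroid_rank F) \<and>
     distinct_equality_points E a b I \<and>
     1 \<le> f (card E) \<and> 1 \<le> G (card E) \<and> 1 \<le> H (card E) \<longrightarrow>
     (\<exists>t s. let m = card E; k = matroid_rank F; M = encode es F a b I in
        run M f G H P (input_state M) t s \<and>
        solves_interdiction es F a b I s \<and>
        t \<le> C * ((real m)\<^sup>2 * (log 2 (real m) + f m) + real m * G m
                 + real m * real k * (H m + real k * log 2 (real k))))"
proof (rule exI[of _ interdiction_program], rule exI[of _ 2000], intro allI impI, elim conjE)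
  fix E :: "'a set" and F es a b I and f G H :: "nat \<Rightarrow> real"
  assume mat: "matroid E F" and E: "E \<noteq> {}" and es: "distinct es" "set es = E"
    and I: "is_interval I" "I \<noteq> {}"
    and rank: "\<forall>e\<in>E. \<exists>B. basis (restriction F (E - {e})) B \<and> card B = matroid_rank F"
    and dep: "distinct_equality_points E a b I" and c: "1 \<le> f (card E)" "1 \<le> G (card E)" "1 \<le> H (card E)"
  have m: "card E = length es" using distinct_card[OF es(1)] es(2) by simp
  let ?M = "encode es F a b I"
  have enc: "encoded es F" using mat es by unfold_locales (auto simp: matroid_def)
  interpret encoded es F a b I by (rule enc)
  have ne: "es \<noteq> []" using E es by auto
  have inst: "interdiction_machine (length es) IF (\<lambda>i. a (h i)) (\<lambda>i. b (h i)) ?M f G H I"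
  proof -
    have "parametric_matroid (length es) IF (\<lambda>i. a (h i)) (\<lambda>i. b (h i)) ?M"
      using matroid_N unfolding parametric_matroid_def parametric_matroid_axioms_def by (simp add: encode_def)
    then have "interdiction_instance (length es) IF (\<lambda>i. a (h i)) (\<lambda>i. b (h i)) ?M"
      using interdicted_rank_N rank es(2) unfolding interdiction_instance_def interdiction_instance_axioms_def by simp
    moreover have "interdiction_machine_axioms (length es) (\<lambda>i. a (h i)) (\<lambda>i. b (h i)) ?M f G H I"
      using I distinct_equality_points_N dep es(2) c m ne
      unfolding interdiction_machine_axioms_def by (simp add: encode_def)
    ultimately show ?thesis unfolding interdiction_machine_def by blast
  qed
  interpret X: interdiction_machine "length es" IF "\<lambda>i. a (h i)" "\<lambda>i. b (h i)" ?M f G H I by (rule inst)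
  obtain t s where run: "run ?M f G H interdiction_program (input_state ?M) t s" "X.solved s" "t \<le> X.total_time"
    using X.wp_interdiction_program unfolding X.wp_def by auto
  have "solves_interdiction es F a b I s" by (rule solved_solves_interdiction[OF enc inst run(2)])
  moreover have "t \<le> 2000 * ((real (card E))\<^sup>2 * (log 2 (real (card E)) + f (card E)) + real (card E) * G (card E)
       + real (card E) * real (matroid_rank F) * (H (card E) + real (matroid_rank F) * log 2 (real (matroid_rank F))))"
    using run(3) X.total_time_bound unfolding m rank_N by linarith
  ultimately show "\<exists>t s. let m = card E; k = matroid_rank F; M = encode es F a b I in
        run M f G H interdiction_program (input_state M) t s \<and> solves_interdiction es F a b I s \<and>
        t \<le> 2000 * ((real m)\<^sup>2 * (log 2 (real m) + f m) + real m * G m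
                 + real m * real k * (H m + real k * log 2 (real k)))"
    using run(1) unfolding Let_def by blast
qed

end
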